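(* Let $\Omega\subset\mathbb{R}^2$ be a bounded domain and let $1<p<\infty$. There exist constants $M>0$ and $C>0$ (depending only on $\Omega$ and $p$) such that for every eigenvalue $\lambda>M$ of the Dirichlet $p$-Laplacian on $\Omega$ and every eigenfunction $u_\lambda$ associated to $\lambda$, the nodal set $\mathcal{Z}_\lambda=\{x\in\Omega: u_\lambda(x)=0\}$ satisfies $$\mathcal{H}^1(\mathcal{Z}_\lambda)\ \ge\ C\,\lambda^{1/p}.$$
   Context: $\mathcal{H}^1$ is the one-dimensional Hausdorff measure (the value $+\infty$ is allowed). A real number $\lambda$ is an eigenvalue of $-\Delta_p$ on $\Omega$ (Dirichlet boundary condition), with eigenfunction $u_\lambda$, if $u_\lambda\in W_0^{1,p}(\Omega)$ is a nontrivial weak solution of $\Delta_p u+\lambda|u|^{p-2}u=0$ in $\Omega$, where $\Delta_p u=\operatorname{div}(|\nabla u|^{p-2}\nabla u)$; that is, for all $v\in C_0^\infty(\Omega)$, $$\int_\Omega|\nabla u_\lambda|^{p-2}\nabla u_\lambda\cdot\nabla v-\lambda\int_\Omega|u_\lambda|^{p-2}u_\lambda v=0.$$ Eigenfunctions are identified with their continuous representatives in $\Omega$. *)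

theory Defs
  imports "HOL-Analysis.Analysis"
begin

section \<open>One-dimensional Hausdorff measure\<close>

(* The library's diameter is a real number, and only meaningful on bounded sets;
   hence the boundedness condition on the covering sets. *)
definition hausdorff1_pre :: "real \<Rightarrow> 'a::metric_space set \<Rightarrow> ennreal" where
  "hausdorff1_pre \<delta> A =
     Inf {(\<Sum>i. ennreal (diameter (U i))) | U :: nat \<Rightarrow> 'a set.
            A \<subseteq> (\<Union>i. U i) \<and> (\<forall>i. bounded (U i) \<and> diameter (U i) \<le> \<delta>)}"

(* In dimension one the usual normalising constant equals 1. *)
definition hausdorff1 :: "'a::metric_space set \<Rightarrow> ennreal" where
  "hausdorff1 A = (SUP \<delta>\<in>{0<..}. hausdorff1_pre \<delta> A)"

section \<open>Test functions\<close>

definition grad :: "('a::euclidean_space \<Rightarrow> real) \<Rightarrow> 'a \<Rightarrow> 'a" where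
  "grad f x = (THE D. GDERIV f x :> D)"

primrec Ck :: "nat \<Rightarrow> ('a::euclidean_space \<Rightarrow> real) \<Rightarrow> bool" where
  "Ck 0 f \<longleftrightarrow> continuous_on UNIV f"
| "Ck (Suc k) f \<longleftrightarrow>
     f differentiable_on UNIV \<and> (\<forall>b\<in>Basis. Ck k (\<lambda>x. frechet_derivative f (at x) b))"

(* C_0^infinity(Omega): functions on the whole space, extended by 0 outside Omega. *)
definition test_function :: "'a::euclidean_space set \<Rightarrow> ('a \<Rightarrow> real) \<Rightarrow> bool" where
  "test_function \<Omega> \<phi> \<longleftrightarrow> (\<forall>k. Ck k \<phi>) \<and>
     compact (closure {x. \<phi> x \<noteq> 0}) \<and> closure {x. \<phi> x \<noteq> 0} \<subseteq> \<Omega>"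

section \<open>Sobolev spaces\<close>

(* Functions are total, but only their values on Omega, up to null sets, matter. *)
definition in_Lp :: "real \<Rightarrow> 'a::euclidean_space set \<Rightarrow> ('a \<Rightarrow> 'b::euclidean_space) \<Rightarrow> bool" where
  "in_Lp p \<Omega> f \<longleftrightarrow> f \<in> borel_measurable (lebesgue_on \<Omega>) \<and>
     integrable (lebesgue_on \<Omega>) (\<lambda>x. norm (f x) powr p)"

(* Only used for locally integrable u and g, so that all integrands are integrable. *)
definition weak_gradient ::
    "'a::euclidean_space set \<Rightarrow> ('a \<Rightarrow> real) \<Rightarrow> ('a \<Rightarrow> 'a) \<Rightarrow> bool" where
  "weak_gradient \<Omega> u g \<longleftrightarrow> (\<forall>\<phi>. test_function \<Omega> \<phi> \<longrightarrow>
     (LINT x|lebesgue_on \<Omega>. u x *\<^sub>R grad \<phi> x) = - (LINT x|lebesgue_on \<Omega>. \<phi> x *\<^sub>R g x))"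

(* u belongs to W^{1,p}(Omega), with weak gradient g (which is unique almost everywhere). *)
definition in_W1p ::
    "real \<Rightarrow> 'a::euclidean_space set \<Rightarrow> ('a \<Rightarrow> real) \<Rightarrow> ('a \<Rightarrow> 'a) \<Rightarrow> bool" where
  "in_W1p p \<Omega> u g \<longleftrightarrow> in_Lp p \<Omega> u \<and> in_Lp p \<Omega> g \<and> weak_gradient \<Omega> u g"

definition W1p_norm ::
    "real \<Rightarrow> 'a::euclidean_space set \<Rightarrow> ('a \<Rightarrow> real) \<Rightarrow> ('a \<Rightarrow> 'a) \<Rightarrow> real" where
  "W1p_norm p \<Omega> u g =
     ((LINT x|lebesgue_on \<Omega>. \<bar>u x\<bar> powr p) + (LINT x|lebesgue_on \<Omega>. norm (g x) powr p)) powr (1 / p)"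

(* The closure of the test functions in W^{1,p}(Omega). *)
definition in_W01p ::
    "real \<Rightarrow> 'a::euclidean_space set \<Rightarrow> ('a \<Rightarrow> real) \<Rightarrow> ('a \<Rightarrow> 'a) \<Rightarrow> bool" where
  "in_W01p p \<Omega> u g \<longleftrightarrow> in_W1p p \<Omega> u g \<and>
     (\<exists>\<phi>. (\<forall>n. test_function \<Omega> (\<phi> n)) \<and>
        (\<lambda>n::nat. W1p_norm p \<Omega> (\<lambda>x. u x - \<phi> n x) (\<lambda>x. g x - grad (\<phi> n) x)) \<longlonglongrightarrow> 0)"

section \<open>Dirichlet eigenvalues of the p-Laplacian\<close>

(* Since 0 powr a = 0 for every a, both |g|^(p-2) g and |u|^(p-2) u vanish where g resp. u does,
   which is the usual convention when p < 2. *)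
definition p_eigenfunction ::
    "real \<Rightarrow> 'a::euclidean_space set \<Rightarrow> real \<Rightarrow> ('a \<Rightarrow> real) \<Rightarrow> bool" where
  "p_eigenfunction p \<Omega> lam u \<longleftrightarrow>
     \<not> (AE x in lebesgue_on \<Omega>. u x = 0) \<and>
     (\<exists>g. in_W01p p \<Omega> u g \<and>
        (\<forall>v. test_function \<Omega> v \<longrightarrow>
           (LINT x|lebesgue_on \<Omega>. norm (g x) powr (p - 2) * (inner (g x) (grad v x)))
           - lam * (LINT x|lebesgue_on \<Omega>. \<bar>u x\<bar> powr (p - 2) * u x * v x) = 0))"

definition p_eigenvalue :: "real \<Rightarrow> 'a::euclidean_space set \<Rightarrow> real \<Rightarrow> bool" where
  "p_eigenvalue p \<Omega> lam \<longleftrightarrow> (\<exists>u. p_eigenfunction p \<Omega> lam u)"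

definition nodal_set :: "'a set \<Rightarrow> ('a \<Rightarrow> real) \<Rightarrow> 'a set" where
  "nodal_set \<Omega> u = {x \<in> \<Omega>. u x = 0}"

end

theory Submission
  imports Defs
begin

text \<open>
  Inside \<open>\<Omega>\<close> one can place a number of order \<open>lam powr (2 / p)\<close> of mutually separated squares of
  side \<open>R\<close> comparable to \<open>lam powr (- 1 / p)\<close>, so it suffices that in each of them the nodal set has
  a coordinate projection of length at least \<open>\<epsilon> * R\<close>. Suppose both projections \<open>E1\<close>, \<open>E2\<close> in some square
  are shorter. All horizontal and vertical lines off the projections are free of zeros and meet each
  other, so \<open>u\<close> has one sign on them, say positive, and \<open>u \<le> 0\<close> only on a subset of \<open>E1 \<times> E2\<close>. The
  Poincare inequality on this narrow set forces the negative part of \<open>u\<close> to vanish in a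
  slightly smaller square. Then Picone's argument shows that \<open>lam * R powr p\<close> times the fraction of
  the square where \<open>u > 0\<close> is bounded by a constant, which is impossible once \<open>R * lam powr (1 / p)\<close>
  is a large constant.
\<close>

section \<open>Smooth functions\<close>

text \<open>The two estimates are invariant under scaling and meet in the quantity
  \<open>R * lam powr (1 / p)\<close>: Picone's argument needs it above \<open>K\<close>, the
  Poincare inequality on a narrow strip needs it below \<open>2 * K\<close>. So \<open>K\<close> is
  fixed first, and \<open>\<epsilon>\<close> is then taken small relative to \<open>K\<close>. The
  obstacle is how little is known about \<open>u\<close>. Hence every identity is proved for smooth
  approximants composed with a function of one variable and then passed to the limit. The
  one-dimensional Poincare inequality takes the form of a divergence identity for a field built from
  a function \<open>\<theta>\<close> of one coordinate that has slope 1 on the projection and stays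
  bounded by little more than the measure of that projection. The cutoff of the negative part causes
  no error, because the sides of the box avoid the projections and the cutoff can be 1 near all
  points of the box where \<open>u \<le> 0\<close>.\<close>

lemma Ck_SucI:
  assumes "\<And>x. (f has_derivative f' x) (at x)" "\<And>b. b \<in> Basis \<Longrightarrow> Ck k (\<lambda>x. f' x b)"
  shows "Ck (Suc k) f"
proof -
  have "frechet_derivative f (at x) = f' x" for x
    using frechet_derivative_at[OF assms(1)] by simp
  then show ?thesis
    using assms by (auto simp: differentiable_on_def differentiable_def)
qed

lemma Ck_Suc_has_derivative:
  "Ck (Suc k) f \<Longrightarrow> (f has_derivative frechet_derivative f (at x)) (at x)"
  by (auto simp: differentiable_on_def frechet_derivative_works)

lemma Ck_Suc_partial:
  "Ck (Suc k) f \<Longrightarrow> b \<in> Basis \<Longrightarrow> Ck k (\<lambda>x. frechet_derivative f (at x) b)"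
  by auto

lemma Ck_continuous: "Ck k f \<Longrightarrow> continuous_on UNIV f"
  by (cases k) (auto intro: differentiable_imp_continuous_on)

text \<open>The product and chain rules leave one factor undifferentiated, and the induction
  hypothesis needs that factor one order lower.\<close>

lemma Ck_mono: "Ck (Suc k) f \<Longrightarrow> Ck k f"
proof (induction k arbitrary: f)
  case 0
  then show ?case using Ck_continuous by fastforce
next
  case (Suc k)
  from Suc.prems show ?case
    by (rule Ck_SucI[OF Ck_Suc_has_derivative]) (rule Suc.IH, rule Ck_Suc_partial, rule Suc.prems)
qed

lemma Ck_const: "Ck k (\<lambda>x. c)"
proof (induction k arbitrary: c)
  case (Suc k)
  show ?case by (rule Ck_SucI[where f' = "\<lambda>x h. 0"]) (auto intro: Suc)
qed auto

lemma Ck_inner: "Ck k (\<lambda>x. inner x c)"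
proof (cases k)
  case (Suc j)
  show ?thesis unfolding Suc
    by (rule Ck_SucI[where f' = "\<lambda>x h. inner h c"])
       (auto intro: Ck_const bounded_linear_imp_has_derivative bounded_linear_inner_left)
qed (auto intro!: continuous_intros)

lemma Ck_add: "Ck k f \<Longrightarrow> Ck k g \<Longrightarrow> Ck k (\<lambda>x. f x + g x)"
proof (induction k arbitrary: f g)
  case (Suc k)
  show ?case
    by (rule Ck_SucI[OF has_derivative_add[OF Ck_Suc_has_derivative[OF Suc.prems(1)]
        Ck_Suc_has_derivative[OF Suc.prems(2)]]])
       (intro Suc.IH Ck_Suc_partial Suc.prems)
qed (auto intro: continuous_on_add)

lemma Ck_mult: "Ck k f \<Longrightarrow> Ck k g \<Longrightarrow> Ck k (\<lambda>x. f x * g x)"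
proof (induction k arbitrary: f g)
  case (Suc k)
  show ?case
    by (rule Ck_SucI[OF has_derivative_mult[OF Ck_Suc_has_derivative[OF Suc.prems(1)]
        Ck_Suc_has_derivative[OF Suc.prems(2)]]])
       (intro Ck_add Suc.IH Ck_Suc_partial Suc.prems Suc.prems[THEN Ck_mono]; assumption)
qed (auto intro: continuous_on_mult)

lemma frechet_derivative_real:
  assumes "(f has_derivative f') (at (t::real))"
  shows "f' h = f' 1 * h"
  using has_derivative_linear[OF assms] linear_scale[of f' h 1] by (simp add: mult.commute)

text \<open>A linear map on the reals is multiplication by its value at 1, so the derivative is a
  product. Its first factor is again a composition, now with the derivative of \<open>F\<close>
  outside; hence the induction over all outer functions.\<close>

lemma Ck_compose:
  fixes F :: "real \<Rightarrow> real"
  shows "Ck k F \<Longrightarrow> Ck k f \<Longrightarrow> Ck k (\<lambda>x. F (f x))"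
proof (induction k arbitrary: F)
  case 0
  then show ?case using continuous_on_compose2[of UNIV F UNIV f] by simp
next
  case (Suc k)
  note F' = Ck_Suc_has_derivative[OF Suc.prems(1)] and f' = Ck_Suc_has_derivative[OF Suc.prems(2)]
  have eq: "frechet_derivative F (at (f x)) (frechet_derivative f (at x) h) =
      frechet_derivative F (at (f x)) 1 * frechet_derivative f (at x) h" for x h
    by (rule frechet_derivative_real[OF F'])
  have "((\<lambda>x. F (f x)) has_derivative
      (\<lambda>h. frechet_derivative F (at (f x)) 1 * frechet_derivative f (at x) h)) (at x)" for x
    using has_derivative_compose[OF f' F'] unfolding eq .
  then show ?case
  proof (rule Ck_SucI)
    fix b :: 'a assume b: "b \<in> Basis"
    have "Ck k (\<lambda>t. frechet_derivative F (at t) 1)"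
      using Ck_Suc_partial[OF Suc.prems(1)] by simp
    from Suc.IH[OF this Ck_mono[OF Suc.prems(2)]] Ck_Suc_partial[OF Suc.prems(2) b]
    show "Ck k (\<lambda>x. frechet_derivative F (at (f x)) 1 * frechet_derivative f (at x) b)"
      by (rule Ck_mult)
  qed
qed

text \<open>Differentiation lowers the exponent by one, hence the induction over arbitrary
  \<open>a\<close>; positivity of \<open>f\<close> keeps every such power differentiable.\<close>

lemma Ck_powr:
  assumes pos: "\<And>x. f x > 0"
  shows "Ck k f \<Longrightarrow> Ck k (\<lambda>x. f x powr a)"
proof (induction k arbitrary: a)
  case 0
  then show ?case using pos by (auto intro!: continuous_on_powr continuous_on_const) (metis less_irrefl)
next
  case (Suc k)
  note f' = Ck_Suc_has_derivative[OF Suc.prems]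
  have D: "((\<lambda>x. f x powr a) has_derivative
      (\<lambda>h. (a * f x powr (a - 1)) * frechet_derivative f (at x) h)) (at x)" for x
    using has_derivative_compose[OF f' has_real_derivative_powr[OF pos, unfolded has_field_derivative_def]] by simp
  then show ?case
    by (rule Ck_SucI) (intro Ck_mult Ck_const Suc.IH Ck_mono[OF Suc.prems] Ck_Suc_partial[OF Suc.prems])
qed

lemma Ck_real:
  fixes f :: "real \<Rightarrow> real"
  assumes "\<And>t. (f has_real_derivative f' t) (at t)" "Ck k f'"
  shows "Ck (Suc k) f"
  by (rule Ck_SucI[where f' = "\<lambda>t h. f' t * h"]) (use assms in \<open>auto simp: has_field_derivative_def\<close>)

definition smooth :: "('a::euclidean_space \<Rightarrow> real) \<Rightarrow> bool" where
  "smooth f \<longleftrightarrow> (\<forall>k. Ck k f)"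

lemma smooth_const: "smooth (\<lambda>x. c)"
  by (simp add: smooth_def Ck_const)

lemma smooth_inner: "smooth (\<lambda>x. inner x b)"
  by (simp add: smooth_def Ck_inner)

lemma smooth_add: "smooth f \<Longrightarrow> smooth h \<Longrightarrow> smooth (\<lambda>x. f x + h x)"
  by (simp add: smooth_def Ck_add)

lemma smooth_mult: "smooth f \<Longrightarrow> smooth h \<Longrightarrow> smooth (\<lambda>x. f x * h x)"
  by (simp add: smooth_def Ck_mult)

lemma smooth_compose: "smooth F \<Longrightarrow> smooth f \<Longrightarrow> smooth (\<lambda>x. F (f x))"
  unfolding smooth_def by (intro allI Ck_compose[of _ F f]) auto

lemma smooth_powr: "smooth f \<Longrightarrow> (\<And>x. f x > 0) \<Longrightarrow> smooth (\<lambda>x. f x powr a)"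
  unfolding smooth_def by (intro allI Ck_powr[of f]) auto

lemma smooth_power: "smooth f \<Longrightarrow> smooth (\<lambda>x. f x ^ n)"
proof (induction n)
  case 0
  then show ?case using smooth_const[of 1] by simp
next
  case (Suc n)
  then show ?case using smooth_mult[of f "\<lambda>x. f x ^ n"] by simp
qed

lemma smooth_ident: "smooth (\<lambda>t::real. t)"
  using smooth_inner[of "1::real"] by simp

lemma smooth_affine: "smooth (\<lambda>t::real. c * t + d)"
  by (intro smooth_add smooth_mult smooth_const smooth_ident)

lemma smooth_has_derivative:
  "smooth f \<Longrightarrow> (f has_derivative frechet_derivative f (at x)) (at x)"
  unfolding smooth_def by (metis Ck_Suc_has_derivative)

lemma smooth_continuous: "smooth f \<Longrightarrow> continuous_on S f"
  unfolding smooth_def by (meson Ck_continuous continuous_on_subset subset_UNIV)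

text \<open>\<open>grad\<close> is a definite description, so a concrete candidate is needed: the
  Riesz representative \<open>D\<close> of the derivative, unique because derivatives are.\<close>

lemma has_derivative_grad:
  assumes "(f has_derivative f') (at x)"
  shows "f' h = inner (grad f x) h"
proof -
  define D where "D = (\<Sum>b\<in>Basis. f' b *\<^sub>R b)"
  have f': "f' h = inner h D" for h
    using linear_sum[OF has_derivative_linear[OF assms], of "\<lambda>b. inner h b *\<^sub>R b" Basis]
    by (simp add: D_def inner_sum_right linear_scale[OF has_derivative_linear[OF assms]] euclidean_representation mult.commute)
  then have "f' = (\<lambda>h. inner h D)" by auto
  have "GDERIV f x :> D' \<longleftrightarrow> D' = D" for D'
    using assms has_derivative_unique[OF assms, of "\<lambda>h. inner h D'"] vector_eq_rdot[of D' D]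
    unfolding gderiv_def \<open>f' = _\<close> by (metis inner_commute)
  then have "grad f x = D" unfolding grad_def by (intro the_equality) auto
  then show ?thesis using f' by (simp add: inner_commute)
qed

lemma grad_eqI:
  assumes "(f has_derivative (\<lambda>h. inner D h)) (at x)"
  shows "grad f x = D"
  using has_derivative_grad[OF assms] by (metis inner_commute vector_eq_rdot)

lemma smooth_grad: "smooth f \<Longrightarrow> (f has_derivative (\<lambda>h. inner (grad f x) h)) (at x)"
  using smooth_has_derivative has_derivative_grad by (metis (no_types, lifting) ext)

lemma smooth_continuous_grad:
  assumes "smooth f" shows "continuous_on S (grad f)"
proof -
  have "continuous_on UNIV (\<lambda>x. inner (grad f x) b)" if "b \<in> Basis" for b
  proof -
    have "Ck 0 (\<lambda>x. frechet_derivative f (at x) b)"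
      using assms that Ck_Suc_partial unfolding smooth_def by metis
    then show ?thesis using has_derivative_grad[OF smooth_has_derivative[OF assms]] by simp
  qed
  then have "continuous_on UNIV (\<lambda>x. \<Sum>b\<in>Basis. inner (grad f x) b *\<^sub>R b)"
    by (intro continuous_on_sum continuous_on_scaleR continuous_on_const)
  then have "continuous_on UNIV (grad f)" by (simp add: euclidean_representation)
  then show ?thesis by (rule continuous_on_subset) auto
qed

lemma smooth_real_derivative:
  fixes f :: "real \<Rightarrow> real"
  assumes "smooth f"
  shows "(f has_real_derivative deriv f t) (at t)"
    and "continuous_on S (deriv f)"
proof -
  have *: "(f has_real_derivative grad f t) (at t)" for t
    using smooth_grad[OF assms, of t] by (simp add: has_field_derivative_def)
  then have "deriv f = grad f" using DERIV_imp_deriv by blast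
  then show "(f has_real_derivative deriv f t) (at t)" "continuous_on S (deriv f)"
    using * smooth_continuous_grad[OF assms] by auto
qed

section \<open>Smooth cutoffs\<close>

text \<open>\<open>flat 0\<close> is the classical \<open>exp (- 1 / t)\<close> extended by 0. The
  extra powers of \<open>1 / t\<close> make the family closed under differentiation up to linear
  combinations, so smoothness of all members is a single induction.\<close>

definition flat :: "nat \<Rightarrow> real \<Rightarrow> real" where
  "flat j t = (if t > 0 then exp (- (1 / t)) / t ^ j else 0)"

text \<open>The term of order \<open>j + 2\<close> in the series of \<open>exp (1 / t)\<close> beats
  the denominator with a square to spare; this quadratic decay makes the difference quotient at 0
  tend to 0.\<close>

lemma flat_le:
  assumes "t > 0" shows "flat j t \<le> fact (j + 2) * t\<^sup>2"
proof -
  have "(1 / t) ^ (j + 2) / fact (j + 2) \<le> exp (1 / t)"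
  proof -
    have "(\<Sum>i\<in>{j + 2}. (1 / t) ^ i /\<^sub>R fact i) \<le> (\<Sum>i. (1 / t) ^ i /\<^sub>R fact i)"
      by (rule sum_le_suminf) (use assms in \<open>auto intro: summable_exp\<close>)
    then show ?thesis by (simp add: exp_def divide_inverse_commute)
  qed
  then have "1 \<le> fact (j + 2) * t ^ (j + 2) * exp (1 / t)"
    using assms by (simp only: power_one_over power_divide power_one divide_divide_eq_left)
      (simp only: pos_divide_le_eq zero_less_mult_iff zero_less_power fact_gt_zero mult_ac simp_thms)
  then have "exp (- (1 / t)) \<le> fact (j + 2) * t ^ (j + 2)"
    by (simp only: exp_minus inverse_eq_divide pos_divide_le_eq[OF exp_gt_zero])
  then have "exp (- (1 / t)) \<le> fact (j + 2) * t\<^sup>2 * t ^ j"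
    by (simp only: power_add mult_ac)
  then show ?thesis
    using assms by (simp only: flat_def if_True pos_divide_le_eq[OF zero_less_power])
qed

lemma flat_has_derivative:
  "(flat j has_real_derivative flat (j + 2) t - real j * flat (j + 1) t) (at t)"
proof (cases "t = 0")
  case True
  have "((\<lambda>h. flat j h / h) \<longlongrightarrow> 0) (at 0)"
  proof (rule Lim_null_comparison)
    have "norm (flat j h / h) \<le> fact (j + 2) * \<bar>h\<bar>" for h
    proof (cases "h > 0")
      case True
      then have "norm (flat j h / h) = flat j h / h" by (simp add: flat_def)
      also have "\<dots> \<le> fact (j + 2) * h\<^sup>2 / h" using True flat_le[OF True] by (intro divide_right_mono) auto
      finally show ?thesis using True by (simp add: power2_eq_square)
    next
      case False
      have "0 \<le> fact (j + 2) * \<bar>h\<bar>" by (intro mult_nonneg_nonneg) auto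
      then show ?thesis using False by (simp only: flat_def if_False div_0 norm_zero)
    qed
    then show "\<forall>\<^sub>F h in at 0. norm (flat j h / h) \<le> fact (j + 2) * \<bar>h\<bar>" by simp
    show "((\<lambda>h. fact (j + 2) * \<bar>h\<bar>) \<longlongrightarrow> 0) (at (0::real))"
      by (rule tendsto_eq_intros refl | simp)+
  qed
  then show ?thesis using True by (simp add: DERIV_def flat_def cong: if_cong)
next
  case False
  show ?thesis
  proof (cases "t > 0")
    case True
    have "((\<lambda>t. exp (- (1 / t)) / t ^ j) has_real_derivative flat (j + 2) t - real j * flat (j + 1) t) (at t)"
      using True
      by (auto intro!: derivative_eq_intros simp: flat_def field_simps power2_eq_square)
         (cases j; simp add: field_simps)
    moreover have "\<forall>\<^sub>F s in nhds t. flat j s = exp (- (1 / s)) / s ^ j"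
      using eventually_nhds_in_open[of "{0<..}" t] True by (auto simp: flat_def elim: eventually_mono)
    ultimately show ?thesis using DERIV_cong_ev[OF refl _ refl] by fast
  next
    case neg: False
    have "\<forall>\<^sub>F s in nhds t. flat j s = 0"
      using eventually_nhds_in_open[of "{..<0}" t] neg False by (auto simp: flat_def elim: eventually_mono)
    then show ?thesis using DERIV_cong_ev[OF refl _ refl, of "flat j" "\<lambda>_. 0" t] neg by (simp add: flat_def)
  qed
qed

lemma smooth_flat: "smooth (flat j)"
proof -
  have "Ck k (flat j)" for k j
  proof (induction k arbitrary: j)
    case 0
    show ?case by (auto intro!: continuous_at_imp_continuous_on DERIV_isCont flat_has_derivative)
  next
    case (Suc k)
    show ?case
      using Ck_add[OF Suc Ck_mult[OF Ck_const[of k "- real j"] Suc], of "j + 2" "j + 1"]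
      by (intro Ck_real[OF flat_has_derivative]) simp
  qed
  then show ?thesis by (simp add: smooth_def)
qed

text \<open>The standard transition from 0 to 1. The quotient is written with exponent
  \<open>- 1\<close> so that the rule for powers of positive functions applies.\<close>

definition smooth_step :: "real \<Rightarrow> real" where
  "smooth_step t = flat 0 t * (flat 0 t + flat 0 (1 - t)) powr (- 1)"

lemma smooth_step_denom: "flat 0 t + flat 0 (1 - t) > 0"
  by (auto simp: flat_def add_pos_pos)

lemma smooth_smooth_step: "smooth smooth_step"
proof -
  have "smooth (\<lambda>t. flat 0 ((- 1) * t + 1))" by (rule smooth_compose[OF smooth_flat smooth_affine])
  then have "smooth (\<lambda>t. flat 0 (1 - t))" by simp
  then have "smooth (\<lambda>t. flat 0 t * (flat 0 t + flat 0 (1 - t)) powr (- 1))"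
    using smooth_step_denom by (intro smooth_mult smooth_powr smooth_add smooth_flat)
  then show ?thesis by (simp add: smooth_step_def[abs_def])
qed

lemma smooth_step_values:
  "t \<le> 0 \<Longrightarrow> smooth_step t = 0" "t \<ge> 1 \<Longrightarrow> smooth_step t = 1"
  "0 \<le> smooth_step t" "smooth_step t \<le> 1"
  using smooth_step_denom[of t]
  by (auto simp: smooth_step_def flat_def powr_minus divide_simps)

text \<open>A rising and a falling step are multiplied, so an empty plateau does no harm.
  \<open>box_cutoff\<close> relies on this: its margins are distances to closed sets and may exceed
  the interval.\<close>

lemma smooth_cutoff_real:
  fixes a a' b' b :: real
  assumes "a < a'" "b' < b"
  obtains e :: "real \<Rightarrow> real" where "smooth e" "\<And>t. 0 \<le> e t" "\<And>t. e t \<le> 1"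
    "\<And>t. a' \<le> t \<Longrightarrow> t \<le> b' \<Longrightarrow> e t = 1" "\<And>t. t \<notin> {a..b} \<Longrightarrow> e t = (0::real)"
proof
  define e where "e t = smooth_step (1 / (a' - a) * t + (- a / (a' - a))) * smooth_step ((- 1 / (b - b')) * t + b / (b - b'))" for t
  have e: "e t = smooth_step ((t - a) / (a' - a)) * smooth_step ((b - t) / (b - b'))" for t
    by (simp add: e_def diff_divide_distrib)
  show "smooth e"
    unfolding e_def[abs_def] by (intro smooth_mult smooth_compose[OF smooth_smooth_step] smooth_affine)
  show "0 \<le> e t" "e t \<le> 1" for t
    unfolding e by (auto intro!: mult_le_one mult_nonneg_nonneg smooth_step_values)
  show "e t = 1" if "a' \<le> t" "t \<le> b'" for t
    unfolding e using that assms by (simp add: smooth_step_values)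
  show "e t = 0" if "t \<notin> {a..b}" for t
    unfolding e using that assms by (auto simp: smooth_step_values divide_le_0_iff)
qed

lemma deriv_locally_const:
  fixes f :: "real \<Rightarrow> real"
  assumes "open S" "t \<in> S" "\<And>s. s \<in> S \<Longrightarrow> f s = c"
  shows "deriv f t = 0"
proof -
  have "(f has_real_derivative 0) (at t)"
    by (rule has_field_derivative_transform_within_open[of "\<lambda>_. c" _ _ S]) (use assms in auto)
  then show ?thesis by (rule DERIV_imp_deriv)
qed

lemma continuous_compact_support_bounded:
  fixes f :: "'a::topological_space \<Rightarrow> 'b::real_normed_vector"
  assumes "continuous_on UNIV f" "compact K" "\<And>x. x \<notin> K \<Longrightarrow> f x = 0"
  obtains B where "B > 0" "\<And>x. norm (f x) \<le> B"
proof -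
  have "compact (f ` K)" using assms by (meson compact_continuous_image continuous_on_subset subset_UNIV)
  then obtain B where "B > 0" "\<And>y. y \<in> f ` K \<Longrightarrow> norm y \<le> B"
    using compact_imp_bounded bounded_pos by metis
  then show ?thesis using assms(3) that[of B] by (metis imageI less_eq_real_def norm_zero)
qed

text \<open>Taking a high power of a cutoff bounds its gradient by a fractional power of the
  cutoff itself, which is what Young's inequality absorbs in Picone's argument.\<close>
lemma power_cutoff:
  assumes "1 < (p::real)"
  obtains z :: "real \<Rightarrow> real" and C where "smooth z" "\<And>t. 0 \<le> z t" "\<And>t. z t \<le> 1"
    "\<And>t. 1/4 \<le> t \<Longrightarrow> t \<le> 3/4 \<Longrightarrow> z t = 1" "\<And>t. t \<notin> {1/8..7/8} \<Longrightarrow> z t = (0::real)"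
    "C > 0" "\<And>t. \<bar>deriv z t\<bar> \<le> C * z t powr ((p - 1) / p)"
proof -
  obtain e :: "real \<Rightarrow> real" where e: "smooth e" "\<And>t. 0 \<le> e t" "\<And>t. e t \<le> 1"
    "\<And>t. 1/4 \<le> t \<Longrightarrow> t \<le> 3/4 \<Longrightarrow> e t = 1" "\<And>t. t \<notin> {1/8..7/8} \<Longrightarrow> e t = (0::real)"
    by (rule smooth_cutoff_real[of "1/8" "1/4" "3/4" "7/8"]) (simp, simp, rule that)
  have "deriv e t = 0" if "t \<notin> {1/8..7/8}" for t
    using deriv_locally_const[of "- {1/8..7/8}" t e 0] that e(5) by (simp add: open_Compl)
  then obtain B where B: "B > 0" "\<And>t. norm (deriv e t) \<le> B"
    using continuous_compact_support_bounded[OF smooth_real_derivative(2)[OF e(1)], of "{1/8..7/8}"]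
    by (metis compact_Icc)
  \<comment> \<open>For \<open>m \<ge> p\<close> the exponent \<open>m - 1\<close> is at least
    \<open>m * (p - 1) / p\<close>. As \<open>0 \<le> e \<le> 1\<close>, the factor
    \<open>e ^ (m - 1)\<close> in the derivative then lies below the required power of
    \<open>e ^ m\<close>.\<close>
  obtain m :: nat where m: "real m \<ge> p" using real_arch_simple by blast
  have "((\<lambda>t. e t ^ m) has_real_derivative real m * e t ^ (m - 1) * deriv e t) (at t)" for t
    using smooth_real_derivative(1)[OF e(1), of t] by (auto intro!: derivative_eq_intros)
  then have d: "deriv (\<lambda>t. e t ^ m) t = real m * e t ^ (m - 1) * deriv e t" for t
    by (rule DERIV_imp_deriv)
  have "\<bar>deriv (\<lambda>t. e t ^ m) t\<bar> \<le> (m * B) * (e t ^ m) powr ((p - 1) / p)" for t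
  proof (cases "e t = 0")
    case True
    moreover have "m - 1 > 0" using m assms by linarith
    ultimately show ?thesis by (simp add: d zero_power)
  next
    case False
    then have pos: "e t > 0" using e(2)[of t] by simp
    have "real m * ((p - 1) / p) \<le> real (m - 1)"
      using m assms by (simp add: of_nat_diff field_simps)
    then have "e t powr real (m - 1) \<le> e t powr (real m * ((p - 1) / p))"
      using pos e(3)[of t] by (intro powr_mono') auto
    then have "e t ^ (m - 1) \<le> (e t ^ m) powr ((p - 1) / p)"
      using pos by (simp add: powr_powr flip: powr_realpow)
    then have "real m * (e t ^ (m - 1) * \<bar>deriv e t\<bar>) \<le> real m * ((e t ^ m) powr ((p - 1) / p) * B)"
      using B(1) B(2)[of t] by (intro mult_left_mono mult_mono) auto
    then show ?thesis using pos by (simp add: d abs_mult mult_ac)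
  qed
  moreover have "m > 0" using m assms by (cases m) auto
  ultimately show ?thesis
    using that[of "\<lambda>t. e t ^ m" "m * B"] e B by (auto simp: smooth_power power_le_one)
qed

lemma smooth_primitive:
  fixes f :: "real \<Rightarrow> real"
  assumes "continuous_on UNIV f"
  obtains F where "\<And>t. (F has_real_derivative f t) (at t)" "F c = 0"
proof -
  have "\<exists>F. \<forall>x::real. - \<infinity> < ereal x \<longrightarrow> ereal x < \<infinity> \<longrightarrow> (F has_vector_derivative f x) (at x)"
    by (rule einterval_antiderivative) (use assms in \<open>auto simp: continuous_on_eq_continuous_at\<close>)
  then obtain F where "\<And>x. (F has_real_derivative f x) (at x)"
    by (auto simp: has_real_derivative_iff_has_vector_derivative)
  then have "((\<lambda>t. F t - F c) has_real_derivative f x) (at x)" for x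
    by (auto intro!: derivative_eq_intros)
  then show ?thesis using that[of "\<lambda>t. F t - F c"] by simp
qed

section \<open>Passing to the limit in chain rule integrals\<close>

lemma lborel_integral_translate:
  fixes f :: "'a::euclidean_space \<Rightarrow> real"
  assumes "integrable lborel f"
  shows "integrable lborel (\<lambda>x. f (x + c))" "(LINT x|lborel. f (x + c)) = (LINT x|lborel. f x)"
proof -
  have *: "distr lborel lborel (\<lambda>x. x + c) = lborel"
    using lborel_distr_plus[of c] by (simp add: add.commute distr_cong[of lborel lborel lborel borel] cong: distr_cong)
  show "integrable lborel (\<lambda>x. f (x + c))"
    using integrable_distr[of "\<lambda>x. x + c" lborel lborel f] assms unfolding * by simp
  show "(LINT x|lborel. f (x + c)) = (LINT x|lborel. f x)"
    using integral_distr[of "\<lambda>x. x + c" lborel lborel f] assms unfolding * by simp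
qed

text \<open>Translation invariance makes the integral of every difference quotient 0, and the mean
  value theorem bounds the quotients uniformly, so dominated convergence applies.\<close>

lemma integral_directional_derivative:
  fixes f :: "'a::euclidean_space \<Rightarrow> real"
  assumes d: "\<And>x. (f has_derivative f' x) (at x)"
    and cont: "continuous_on UNIV (\<lambda>x. f' x b)"
    and K: "compact K" "\<And>x. x \<notin> K \<Longrightarrow> f x = 0"
  shows "(LINT x|lborel. f' x b) = 0"
proof -
  obtain r where r: "K \<subseteq> cball 0 r"
    using compact_imp_bounded[OF K(1)] by (auto simp: bounded_iff subset_iff)
  have f'0: "f' x b = 0" if "x \<notin> K" for x
  proof -
    have "(f has_derivative (\<lambda>h. 0)) (at x)"
      by (rule has_derivative_transform_within_open[of "\<lambda>_. 0" _ _ _ "- K"])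
         (use that K in \<open>auto simp: open_Compl compact_imp_closed\<close>)
    then show ?thesis using has_derivative_unique[OF d] by metis
  qed
  obtain B where B: "B > 0" "\<And>x. norm (f' x b) \<le> B"
    using continuous_compact_support_bounded[OF cont K(1) f'0] by blast
  have contf: "continuous_on UNIV f"
    by (meson d has_derivative_at_withinI has_derivative_continuous_on)
  have int: "integrable lborel f"
  proof -
    have "integrable lborel (\<lambda>x. indicator K x *\<^sub>R f x)"
      using contf K(1) by (intro borel_integrable_compact) (auto intro: continuous_on_subset)
    moreover have "(\<lambda>x. indicator K x *\<^sub>R f x) = f"
      using K(2) by (auto simp: fun_eq_iff indicator_def)
    ultimately show ?thesis by simp
  qed
  define q where "q n x = (f (x + inverse (real (Suc n)) *\<^sub>R b) - f x) * real (Suc n)" for n x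
  have q0: "(LINT x|lborel. q n x) = 0" for n
    unfolding q_def using lborel_integral_translate[OF int] int by simp
  have line: "((\<lambda>t. f (x + t *\<^sub>R b)) has_real_derivative f' (x + t *\<^sub>R b) b) (at t)" for x t
  proof -
    have "((\<lambda>t. f (x + t *\<^sub>R b)) has_derivative (\<lambda>h. f' (x + t *\<^sub>R b) (h *\<^sub>R b))) (at t)"
      by (rule has_derivative_compose[OF _ d]) (auto intro!: derivative_eq_intros)
    then show ?thesis
      using linear_scale[OF has_derivative_linear[OF d], of "x + t *\<^sub>R b" _ b]
      by (simp add: has_field_derivative_def mult_commute_abs)
  qed
  have "(\<lambda>n. LINT x|lborel. q n x) \<longlonglongrightarrow> (LINT x|lborel. f' x b)"
  \<comment> \<open>The step lengths are at most 1, so all quotients vanish outside one ball,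
    enlarged by \<open>norm b\<close>.\<close>
  proof (rule integral_dominated_convergence[where w = "\<lambda>x. B * indicator (cball 0 (r + norm b)) x"])
    show "(\<lambda>x. f' x b) \<in> borel_measurable lborel"
      using cont by (simp add: borel_measurable_continuous_onI)
    show "q n \<in> borel_measurable lborel" for n
      unfolding q_def using contf
      by (intro borel_measurable_times borel_measurable_diff borel_measurable_const)
         (auto intro!: borel_measurable_continuous_onI continuous_on_compose2[OF contf] continuous_intros)
    show "integrable lborel (\<lambda>x. B * indicator (cball 0 (r + norm b)) x)"
      by (auto intro!: integrable_mult_right integrable_real_indicator emeasure_lborel_cball_finite)
    show "AE x in lborel. (\<lambda>n. q n x) \<longlonglongrightarrow> f' x b"
    proof (rule AE_I2)
      fix x
      have "((\<lambda>h. (f (x + h *\<^sub>R b) - f x) / h) \<longlongrightarrow> f' x b) (at 0)"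
        using line[of x 0] by (simp add: DERIV_def)
      moreover have "filterlim (\<lambda>n. inverse (real (Suc n))) (at 0) sequentially"
        using LIMSEQ_inverse_real_of_nat by (auto simp: filterlim_at)
      ultimately have "(\<lambda>n. (f (x + inverse (real (Suc n)) *\<^sub>R b) - f x) / inverse (real (Suc n))) \<longlonglongrightarrow> f' x b"
        by (rule filterlim_compose)
      then show "(\<lambda>n. q n x) \<longlonglongrightarrow> f' x b" by (simp add: q_def divide_inverse)
    qed
    show "AE x in lborel. norm (q n x) \<le> B * indicator (cball 0 (r + norm b)) x" for n
    proof (rule AE_I2)
      fix x :: 'a
      define h where "h = inverse (real (Suc n))"
      have h: "0 < h" "h \<le> 1" by (auto simp: h_def inverse_le_1_iff)
      have q: "q n x = (f (x + h *\<^sub>R b) - f x) / h" by (simp add: q_def h_def divide_inverse)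
      show "norm (q n x) \<le> B * indicator (cball 0 (r + norm b)) x"
      proof (cases "x \<in> cball 0 (r + norm b)")
        case True
        obtain z where "f (x + h *\<^sub>R b) - f (x + 0 *\<^sub>R b) = (h - 0) * f' (x + z *\<^sub>R b) b"
          using MVT2[OF h(1) line] by blast
        then have "q n x = f' (x + z *\<^sub>R b) b" using h by (simp add: q)
        then show ?thesis using B True by simp
      next
        case False
        have "norm (h *\<^sub>R b) \<le> norm b" using h by (simp add: mult_left_le_one_le)
        then have "norm (x + h *\<^sub>R b) > r" "norm x > r"
          using False norm_triangle_ineq2[of x "- (h *\<^sub>R b)"] norm_ge_zero[of b] by (auto simp del: norm_scaleR norm_ge_zero)
        then have "x \<notin> K" "x + h *\<^sub>R b \<notin> K" using r by auto
        then show ?thesis using K(2) B(1) by (simp add: q indicator_def)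
      qed
    qed
  qed
  then show ?thesis by (simp add: q0 LIMSEQ_const_iff)
qed

section \<open>Chain rule integrals under convergence in L^p\<close>

lemma powr_mult_self: "0 \<le> (a::real) \<Longrightarrow> a powr (p - 1) * a = a powr p"
  using powr_mult_base[of a "p - 1"] by (simp add: mult.commute)

text \<open>Comparing \<open>b\<close> with \<open>t * a\<close> decides which term on the right
  dominates alone. The weight \<open>t\<close> stays free: small in limit arguments,
  \<open>1/2\<close> for absorption, \<open>p - 1\<close> for an exact cancellation in Picone's
  inequality.\<close>

lemma powr_young:
  fixes a b t p :: real
  assumes "0 \<le> a" "0 \<le> b" "0 < t" "1 < p"
  shows "a powr (p - 1) * b \<le> t * a powr p + t powr (1 - p) * b powr p"
proof (cases "b \<le> t * a")
  case True
  have "a powr (p - 1) * b \<le> a powr (p - 1) * (t * a)" by (rule mult_left_mono[OF True]) simp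
  also have "\<dots> = t * a powr p" using powr_mult_self[OF assms(1), of p] by (simp add: mult_ac)
  finally show ?thesis by (simp add: add_increasing2)
next
  case False
  then have "a \<le> b / t" using assms by (simp add: field_simps)
  then have "a powr (p - 1) * b \<le> (b / t) powr (p - 1) * b"
    using assms by (intro mult_right_mono powr_mono2) auto
  also have "\<dots> = t powr (1 - p) * (b powr (p - 1) * b)"
    using assms powr_minus[of t "p - 1"] by (simp add: powr_divide field_simps)
  also have "\<dots> = t powr (1 - p) * b powr p" using powr_mult_self[OF assms(2)] by simp
  finally show ?thesis using assms by (simp add: add_increasing)
qed

text \<open>This takes the place of Hoelder's inequality: a small Young weight \<open>t\<close>
  first makes the share of the fixed function \<open>a\<close> less than \<open>e / 2\<close>; the
  large factor \<open>t powr (1 - p)\<close> is then harmless, since the integrals of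
  \<open>b n\<close> tend to 0.\<close>

lemma integral_powr_mult_tendsto_0:
  fixes a :: "'x \<Rightarrow> real"
  assumes p: "1 < p"
    and a: "a \<in> borel_measurable M" "\<And>x. 0 \<le> a x" "integrable M (\<lambda>x. a x powr p)"
    and b: "\<And>n. b n \<in> borel_measurable M" "\<And>n x. 0 \<le> b n x" "\<And>n. integrable M (\<lambda>x. b n x powr p)"
    and lim: "(\<lambda>n. LINT x|M. b n x powr p) \<longlonglongrightarrow> 0"
  shows "integrable M (\<lambda>x. a x powr (p - 1) * b n x)"
    and "(\<lambda>n. LINT x|M. a x powr (p - 1) * b n x) \<longlonglongrightarrow> 0"
proof -
  have int: "integrable M (\<lambda>x. a x powr (p - 1) * b n x)" for n
  proof (rule Bochner_Integration.integrable_bound)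
    show "integrable M (\<lambda>x. 1 * a x powr p + 1 powr (1 - p) * b n x powr p)"
      using a b by (intro Bochner_Integration.integrable_add integrable_mult_right)
    show "(\<lambda>x. a x powr (p - 1) * b n x) \<in> borel_measurable M" using a b by measurable
    show "AE x in M. norm (a x powr (p - 1) * b n x) \<le> norm (1 * a x powr p + 1 powr (1 - p) * b n x powr p)"
      using powr_young[OF a(2) b(2) zero_less_one p] a b by (intro AE_I2) (auto simp: abs_mult)
  qed
  then show "integrable M (\<lambda>x. a x powr (p - 1) * b n x)" .
  define A where "A = (LINT x|M. a x powr p)"
  have A: "A \<ge> 0" unfolding A_def by simp
  show "(\<lambda>n. LINT x|M. a x powr (p - 1) * b n x) \<longlonglongrightarrow> 0"
  proof (rule tendstoI)
    fix e :: real assume e: "e > 0"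
    define t where "t = e / (2 * (A + 1))"
    have t: "t > 0" "t * A < e / 2"
      using e A by (auto simp: t_def field_simps add_pos_nonneg)
    have "(\<lambda>n. t powr (1 - p) * (LINT x|M. b n x powr p)) \<longlonglongrightarrow> t powr (1 - p) * 0"
      by (intro tendsto_intros lim)
    then have "\<forall>\<^sub>F n in sequentially. t powr (1 - p) * (LINT x|M. b n x powr p) < e / 2"
      using e by (intro order_tendstoD(2)) auto
    then show "\<forall>\<^sub>F n in sequentially. dist (LINT x|M. a x powr (p - 1) * b n x) 0 < e"
    proof eventually_elim
      case (elim n)
      have "(LINT x|M. a x powr (p - 1) * b n x)
          \<le> (LINT x|M. t * a x powr p + t powr (1 - p) * b n x powr p)"
        using a b t p int by (intro integral_mono) (auto intro!: powr_young)
      also have "\<dots> = t * A + t powr (1 - p) * (LINT x|M. b n x powr p)"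
        using a b by (simp add: A_def)
      also have "\<dots> < e" using t elim by simp
      finally show ?case using a b by (simp add: integral_nonneg_AE)
    qed
  qed
qed

lemma abs_integral_diff_le_tendsto:
  fixes I :: "'x \<Rightarrow> real"
  assumes I: "integrable M I" "\<And>n. J n \<in> borel_measurable M"
    and e: "\<And>n. integrable M (e n)" "(\<lambda>n. LINT x|M. e n x) \<longlonglongrightarrow> 0"
    and le: "\<And>n x. x \<in> space M \<Longrightarrow> \<bar>J n x - I x\<bar> \<le> e n x"
  shows "(\<lambda>n. LINT x|M. J n x) \<longlonglongrightarrow> (LINT x|M. I x)"
proof -
  have d: "integrable M (\<lambda>x. J n x - I x)" for n
    by (rule Bochner_Integration.integrable_bound[OF e(1)[of n]])
       (use I le in \<open>auto intro!: AE_I2 intro: order_trans[OF _ abs_ge_self]\<close>)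
  have J: "integrable M (J n)" for n
    using Bochner_Integration.integrable_add[OF d[of n] I(1)] by simp
  have "(\<lambda>n. (LINT x|M. J n x) - (LINT x|M. I x)) \<longlonglongrightarrow> 0"
  proof (rule Lim_null_comparison[OF _ e(2)], intro always_eventually allI)
    fix n
    have "norm ((LINT x|M. J n x) - (LINT x|M. I x)) = \<bar>LINT x|M. J n x - I x\<bar>"
      using I J by simp
    also have "\<dots> \<le> (LINT x|M. \<bar>J n x - I x\<bar>)" by (rule integral_abs_bound)
    also have "\<dots> \<le> (LINT x|M. e n x)" using d e le by (intro integral_mono) auto
    finally show "norm ((LINT x|M. J n x) - (LINT x|M. I x)) \<le> (LINT x|M. e n x)" .
  qed
  then show ?thesis by (simp add: LIM_zero_iff)
qed

text \<open>Convergence in L^p controls differences, but composition with a merely continuous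
  function also needs convergence almost everywhere, so both are recorded. Finiteness of the measure
  puts constants into L^p.\<close>

locale Lp_approx = finite_measure M for M :: "'x measure" +
  fixes p :: real and u :: "'x \<Rightarrow> real" and g :: "'x \<Rightarrow> 'b::euclidean_space" and \<phi> \<psi>
  assumes p: "1 < p"
    and meas [measurable]: "u \<in> borel_measurable M" "g \<in> borel_measurable M"
      "\<And>n. \<phi> n \<in> borel_measurable M" "\<And>n. \<psi> n \<in> borel_measurable M"
    and int: "integrable M (\<lambda>x. \<bar>u x\<bar> powr p)" "integrable M (\<lambda>x. norm (g x) powr p)"
    and int_diff: "\<And>n. integrable M (\<lambda>x. \<bar>\<phi> n x - u x\<bar> powr p)"
      "\<And>n. integrable M (\<lambda>x. norm (\<psi> n x - g x) powr p)"
    and conv: "(\<lambda>n. LINT x|M. \<bar>\<phi> n x - u x\<bar> powr p) \<longlonglongrightarrow> 0"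
      "(\<lambda>n. LINT x|M. norm (\<psi> n x - g x) powr p) \<longlonglongrightarrow> 0"
    and AE_conv: "AE x in M. (\<lambda>n. \<phi> n x) \<longlonglongrightarrow> u x"
begin

text \<open>Weights of size \<open>maj powr (p - 1)\<close> cover the flux of the p-Laplacian, the
  zero-order term and, thanks to the summand 1, bounded coefficients. Paired with \<open>u\<close>
  or \<open>g\<close> they stay below the integrable \<open>maj powr p\<close>.\<close>

definition maj :: "'x \<Rightarrow> real" where "maj x = 1 + \<bar>u x\<bar> + norm (g x)"

lemma maj_ge: "1 \<le> maj x" "\<bar>u x\<bar> \<le> maj x" "norm (g x) \<le> maj x" "0 \<le> maj x"
  by (auto simp: maj_def)

lemma maj_measurable [measurable]: "maj \<in> borel_measurable M"
  unfolding maj_def[abs_def] by measurable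

lemma integrable_dom: "integrable M (\<lambda>x. maj x powr p)"
proof (rule Bochner_Integration.integrable_bound)
  show "integrable M (\<lambda>x. 3 powr p * (1 + \<bar>u x\<bar> powr p + norm (g x) powr p))"
    using int by auto
  show "AE x in M. norm (maj x powr p) \<le> norm (3 powr p * (1 + \<bar>u x\<bar> powr p + norm (g x) powr p))"
  proof (rule AE_I2)
    fix x
    define m where "m = Max {1, \<bar>u x\<bar>, norm (g x)}"
    have m: "m \<in> {1, \<bar>u x\<bar>, norm (g x)}" unfolding m_def by (rule Max_in) auto
    have "maj x \<le> 3 * m" by (simp add: maj_def m_def)
    then have "maj x powr p \<le> (3 * m) powr p"
      using p maj_ge(4)[of x] by (intro powr_mono2) auto
    also have "\<dots> = 3 powr p * m powr p" using m by (auto simp: powr_mult)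
    also have "m powr p \<le> 1 + \<bar>u x\<bar> powr p + norm (g x) powr p" using m by (auto simp: add_increasing)
    finally show "norm (maj x powr p) \<le> norm (3 powr p * (1 + \<bar>u x\<bar> powr p + norm (g x) powr p))"
      by simp
  qed
qed measurable

text \<open>The bound on \<open>f\<close> makes \<open>F\<close> Lipschitz. The difference of the
  integrands splits into errors in \<open>F (\<phi> n)\<close>, in \<open>\<psi> n\<close> and in
  \<open>f (\<phi> n)\<close>. The first two are linear in the distances of the approximants; the
  third has only continuity and boundedness of \<open>f\<close> to rely on and goes by dominated
  convergence.\<close>

lemma
  assumes [measurable]: "A0 \<in> borel_measurable M" "A1 \<in> borel_measurable M"
    and A0: "\<And>x. x \<in> space M \<Longrightarrow> \<bar>A0 x\<bar> \<le> C * maj x powr (p - 1)"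
    and A1: "\<And>x. x \<in> space M \<Longrightarrow> norm (A1 x) \<le> C * maj x powr (p - 1)"
    and F: "\<And>t. (F has_real_derivative f t) (at t)" and f: "continuous_on UNIV f" "\<And>t. \<bar>f t\<bar> \<le> D"
  shows integrable_chain_limit: "integrable M (\<lambda>x. A0 x * F (u x) + f (u x) * inner (A1 x) (g x))"
    and tendsto_chain_integral:
      "(\<lambda>n. LINT x|M. A0 x * F (\<phi> n x) + f (\<phi> n x) * inner (A1 x) (\<psi> n x))
         \<longlonglongrightarrow> (LINT x|M. A0 x * F (u x) + f (u x) * inner (A1 x) (g x))"
proof -
  have contF: "continuous_on UNIV F" by (meson F DERIV_isCont continuous_at_imp_continuous_on)
  have [measurable]: "F \<in> borel_measurable borel" "f \<in> borel_measurable borel"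
    using contF f by (auto intro: borel_measurable_continuous_onI)
  have D: "0 \<le> D" using f(2)[of 0] by (meson abs_ge_zero order_trans)
  have lip: "\<bar>F s - F t\<bar> \<le> D * \<bar>s - t\<bar>" for s t
    using field_differentiable_bound[of UNIV F f D s t] F f(2)
    by (auto simp: has_field_derivative_at_within)
  have pow: "maj x powr (p - 1) * maj x = maj x powr p" for x
    by (rule powr_mult_self[OF maj_ge(4)])
  have C0: "0 \<le> C * maj x powr (p - 1)" if "x \<in> space M" for x
    using A0[OF that] by (meson abs_ge_zero order_trans)
  have "integrable M (\<lambda>x. (\<bar>F 0\<bar> + D) * (C * maj x powr p) + D * (C * maj x powr p))"
    using integrable_dom by auto
  then show I: "integrable M (\<lambda>x. A0 x * F (u x) + f (u x) * inner (A1 x) (g x))"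
  proof (rule Bochner_Integration.integrable_bound)
    show "AE x in M. norm (A0 x * F (u x) + f (u x) * inner (A1 x) (g x))
        \<le> norm ((\<bar>F 0\<bar> + D) * (C * maj x powr p) + D * (C * maj x powr p))"
    proof (rule AE_I2)
      fix x assume x: "x \<in> space M"
      have "\<bar>F (u x)\<bar> \<le> \<bar>F 0\<bar> + D * \<bar>u x\<bar>" using lip[of "u x" 0] by simp
      also have "\<dots> \<le> (\<bar>F 0\<bar> + D) * maj x"
        using maj_ge[of x] D by (simp add: distrib_right mult_left_mono mult_left_le add_mono mult_le_cancel_left1)
      finally have "\<bar>A0 x * F (u x)\<bar> \<le> (C * maj x powr (p - 1)) * ((\<bar>F 0\<bar> + D) * maj x)"
        unfolding abs_mult using A0[OF x] C0[OF x] by (intro mult_mono) auto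
      moreover have "\<bar>f (u x) * inner (A1 x) (g x)\<bar> \<le> D * ((C * maj x powr (p - 1)) * maj x)"
        unfolding abs_mult using A1[OF x] C0[OF x] D maj_ge[of x] f(2)
        by (intro mult_mono order_trans[OF Cauchy_Schwarz_ineq2]) auto
      ultimately have "\<bar>A0 x * F (u x)\<bar> + \<bar>f (u x) * inner (A1 x) (g x)\<bar>
          \<le> (\<bar>F 0\<bar> + D) * (C * (maj x powr (p - 1) * maj x)) + D * (C * (maj x powr (p - 1) * maj x))"
        by (simp add: mult_ac)
      then show "norm (A0 x * F (u x) + f (u x) * inner (A1 x) (g x))
        \<le> norm ((\<bar>F 0\<bar> + D) * (C * maj x powr p) + D * (C * maj x powr p))"
        unfolding pow by (simp add: abs_triangle_ineq[THEN order_trans])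
    qed
  qed measurable
  define e where "e n x = \<bar>C\<bar> * D * (maj x powr (p - 1) * \<bar>\<phi> n x - u x\<bar>)
    + \<bar>C\<bar> * D * (maj x powr (p - 1) * norm (\<psi> n x - g x))
    + \<bar>C\<bar> * (\<bar>f (\<phi> n x) - f (u x)\<bar> * maj x powr p)" for n x
  note y1 = integral_powr_mult_tendsto_0[OF p maj_measurable maj_ge(4) integrable_dom _ _ int_diff(1) conv(1)]
  note y2 = integral_powr_mult_tendsto_0[OF p maj_measurable maj_ge(4) integrable_dom _ _ int_diff(2) conv(2)]
  have i3: "integrable M (\<lambda>x. \<bar>f (\<phi> n x) - f (u x)\<bar> * maj x powr p)" for n
  proof (rule Bochner_Integration.integrable_bound)
    show "integrable M (\<lambda>x. (2 * D) * maj x powr p)" using integrable_dom by auto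
    show "AE x in M. norm (\<bar>f (\<phi> n x) - f (u x)\<bar> * maj x powr p) \<le> norm (2 * D * maj x powr p)"
    proof (rule AE_I2)
      fix x show "norm (\<bar>f (\<phi> n x) - f (u x)\<bar> * maj x powr p) \<le> norm (2 * D * maj x powr p)"
        using f(2)[of "\<phi> n x"] f(2)[of "u x"] D by (auto simp: abs_mult intro!: mult_right_mono)
    qed
  qed measurable
  have l3: "(\<lambda>n. LINT x|M. \<bar>f (\<phi> n x) - f (u x)\<bar> * maj x powr p) \<longlonglongrightarrow> (LINT x|M. 0)"
  proof (rule integral_dominated_convergence[where w = "\<lambda>x. (2 * D) * maj x powr p"])
    show "AE x in M. (\<lambda>n. \<bar>f (\<phi> n x) - f (u x)\<bar> * maj x powr p) \<longlonglongrightarrow> 0"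
      using AE_conv
    proof eventually_elim
      case (elim x)
      have "isCont f (u x)" using f(1) by (simp add: continuous_on_eq_continuous_at)
      then have "(\<lambda>n. f (\<phi> n x)) \<longlonglongrightarrow> f (u x)" using elim by (rule isCont_tendsto_compose)
      then have "(\<lambda>n. \<bar>f (\<phi> n x) - f (u x)\<bar> * maj x powr p) \<longlonglongrightarrow> \<bar>f (u x) - f (u x)\<bar> * maj x powr p"
        by (intro tendsto_intros)
      then show ?case by simp
    qed
    show "AE x in M. norm (\<bar>f (\<phi> n x) - f (u x)\<bar> * maj x powr p) \<le> 2 * D * maj x powr p" for n
    proof (rule AE_I2)
      fix x show "norm (\<bar>f (\<phi> n x) - f (u x)\<bar> * maj x powr p) \<le> 2 * D * maj x powr p"
        using f(2)[of "\<phi> n x"] f(2)[of "u x"] D by (auto simp: abs_mult intro!: mult_right_mono)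
    qed
  qed (use integrable_dom in auto)
  have ie: "integrable M (e n)" for n
    unfolding e_def using y1(1) y2(1) i3 by auto
  have "(LINT x|M. e n x) = \<bar>C\<bar> * D * (LINT x|M. maj x powr (p - 1) * \<bar>\<phi> n x - u x\<bar>)
    + \<bar>C\<bar> * D * (LINT x|M. maj x powr (p - 1) * norm (\<psi> n x - g x))
    + \<bar>C\<bar> * (LINT x|M. \<bar>f (\<phi> n x) - f (u x)\<bar> * maj x powr p)" for n
    unfolding e_def using y1(1) y2(1) i3 by simp
  moreover have "(\<lambda>n. \<bar>C\<bar> * D * (LINT x|M. maj x powr (p - 1) * \<bar>\<phi> n x - u x\<bar>)
    + \<bar>C\<bar> * D * (LINT x|M. maj x powr (p - 1) * norm (\<psi> n x - g x))
    + \<bar>C\<bar> * (LINT x|M. \<bar>f (\<phi> n x) - f (u x)\<bar> * maj x powr p)) \<longlonglongrightarrow> \<bar>C\<bar> * D * 0 + \<bar>C\<bar> * D * 0 + \<bar>C\<bar> * (LINT x|M. 0)"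
    by (intro tendsto_intros y1(2) y2(2) l3) auto
  ultimately have le0: "(\<lambda>n. LINT x|M. e n x) \<longlonglongrightarrow> 0" by simp
  show "(\<lambda>n. LINT x|M. A0 x * F (\<phi> n x) + f (\<phi> n x) * inner (A1 x) (\<psi> n x))
         \<longlonglongrightarrow> (LINT x|M. A0 x * F (u x) + f (u x) * inner (A1 x) (g x))"
  proof (rule abs_integral_diff_le_tendsto[OF I _ ie le0])
    fix n x assume x: "x \<in> space M"
    have 0: "A0 x * F (\<phi> n x) + f (\<phi> n x) * inner (A1 x) (\<psi> n x) - (A0 x * F (u x) + f (u x) * inner (A1 x) (g x))
      = A0 x * (F (\<phi> n x) - F (u x)) + f (\<phi> n x) * inner (A1 x) (\<psi> n x - g x) + (f (\<phi> n x) - f (u x)) * inner (A1 x) (g x)"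
      by (simp add: algebra_simps inner_diff_right)
    have A0': "\<bar>A0 x\<bar> \<le> \<bar>C\<bar> * maj x powr (p - 1)" and A1': "norm (A1 x) \<le> \<bar>C\<bar> * maj x powr (p - 1)"
      using A0[OF x] A1[OF x] mult_right_mono[OF abs_ge_self[of C] powr_ge_zero[of "maj x" "p - 1"]] by linarith+
    have "\<bar>A0 x * (F (\<phi> n x) - F (u x))\<bar> \<le> (\<bar>C\<bar> * maj x powr (p - 1)) * (D * \<bar>\<phi> n x - u x\<bar>)"
      unfolding abs_mult by (intro mult_mono A0' lip) auto
    moreover have "\<bar>f (\<phi> n x) * inner (A1 x) (\<psi> n x - g x)\<bar> \<le> D * ((\<bar>C\<bar> * maj x powr (p - 1)) * norm (\<psi> n x - g x))"
      unfolding abs_mult using D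
      by (intro mult_mono f(2) order_trans[OF Cauchy_Schwarz_ineq2] mult_right_mono A1') auto
    moreover have "\<bar>(f (\<phi> n x) - f (u x)) * inner (A1 x) (g x)\<bar>
        \<le> \<bar>f (\<phi> n x) - f (u x)\<bar> * ((\<bar>C\<bar> * maj x powr (p - 1)) * maj x)"
      unfolding abs_mult
      by (intro mult_left_mono order_trans[OF Cauchy_Schwarz_ineq2] mult_mono A1' maj_ge) auto
    ultimately show "\<bar>A0 x * F (\<phi> n x) + f (\<phi> n x) * inner (A1 x) (\<psi> n x) - (A0 x * F (u x) + f (u x) * inner (A1 x) (g x))\<bar> \<le> e n x"
      unfolding 0 e_def pow[symmetric] by (simp add: mult_ac) linarith
  qed measurable
qed

end

section \<open>The weak equation for functions of the solution\<close>

text \<open>With an arbitrary compact \<open>K\<close> in place of the closed support, a product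
  simply inherits the \<open>K\<close> of one of its factors.\<close>

lemma test_function_iff:
  "test_function \<Omega> v \<longleftrightarrow> smooth v \<and> (\<exists>K. compact K \<and> K \<subseteq> \<Omega> \<and> (\<forall>x. x \<notin> K \<longrightarrow> v x = 0))"
proof
  assume "test_function \<Omega> v"
  then show "smooth v \<and> (\<exists>K. compact K \<and> K \<subseteq> \<Omega> \<and> (\<forall>x. x \<notin> K \<longrightarrow> v x = 0))"
    using closure_subset[of "{x. v x \<noteq> 0}"]
    by (auto simp: test_function_def smooth_def intro!: exI[of _ "closure {x. v x \<noteq> 0}"])
next
  assume "smooth v \<and> (\<exists>K. compact K \<and> K \<subseteq> \<Omega> \<and> (\<forall>x. x \<notin> K \<longrightarrow> v x = 0))"
  then obtain K where K: "smooth v" "compact K" "K \<subseteq> \<Omega>" "\<And>x. x \<notin> K \<Longrightarrow> v x = 0" by blast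
  then have "closure {x. v x \<noteq> 0} \<subseteq> K"
    by (intro closure_minimal compact_imp_closed) auto
  then show "test_function \<Omega> v"
    using K by (auto simp: test_function_def smooth_def intro: compact_closure[THEN iffD2] bounded_subset[OF compact_imp_bounded])
qed

lemma grad_locally_const:
  assumes "open S" "x \<in> S" "\<And>y. y \<in> S \<Longrightarrow> f y = c"
  shows "grad f x = 0"
  by (rule grad_eqI, rule has_derivative_transform_within_open[of "\<lambda>_. c" _ _ _ S])
     (use assms in auto)

lemma compact_support_grad_bounded:
  assumes "smooth f" "compact K" "\<And>x. x \<notin> K \<Longrightarrow> f x = 0"
  obtains B where "B > 0" "\<And>x. \<bar>f x\<bar> \<le> B" "\<And>x. norm (grad f x) \<le> B"
proof -
  have "grad f x = 0" if "x \<notin> K" for x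
    using grad_locally_const[of "- K" x f 0] assms(2,3) that by (auto simp: open_Compl compact_imp_closed)
  then obtain B1 where "B1 > 0" "\<And>x. norm (grad f x) \<le> B1"
    using continuous_compact_support_bounded[OF smooth_continuous_grad[OF assms(1)] assms(2)] by metis
  moreover obtain B2 where "B2 > 0" "\<And>x. norm (f x) \<le> B2"
    using continuous_compact_support_bounded[OF smooth_continuous[OF assms(1)] assms(2,3)] by metis
  ultimately show ?thesis
    using that[of "max B1 B2"] by (auto simp: le_max_iff_disj)
qed

lemma powr_add_le:
  fixes a b p :: real
  assumes "0 \<le> a" "0 \<le> b" "1 < p"
  shows "(a + b) powr p \<le> 2 powr p * (a powr p + b powr p)"
proof -
  have "(a + b) powr p \<le> (2 * max a b) powr p" using assms by (intro powr_mono2) auto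
  also have "\<dots> = 2 powr p * max a b powr p" using assms by (simp add: powr_mult)
  also have "max a b powr p \<le> a powr p + b powr p" by (auto simp: max_def)
  finally show ?thesis by simp
qed

lemma (in finite_measure) integrable_bounded_diff_powr:
  fixes f g :: "'a \<Rightarrow> 'b::euclidean_space"
  assumes [measurable]: "f \<in> borel_measurable M" "g \<in> borel_measurable M"
    and "1 < p" "integrable M (\<lambda>x. norm (g x) powr p)" "\<And>x. norm (f x) \<le> B"
  shows "integrable M (\<lambda>x. norm (f x - g x) powr p)"
proof (rule Bochner_Integration.integrable_bound)
  show "integrable M (\<lambda>x. 2 powr p * (B powr p + norm (g x) powr p))"
    using assms by auto
  show "AE x in M. norm (norm (f x - g x) powr p) \<le> norm (2 powr p * (B powr p + norm (g x) powr p))"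
  proof (rule AE_I2)
    fix x
    have "norm (f x - g x) powr p \<le> (B + norm (g x)) powr p"
      using assms(5)[of x] assms(3) norm_triangle_ineq4[of "f x" "g x"] by (intro powr_mono2) auto
    also have "\<dots> \<le> 2 powr p * (B powr p + norm (g x) powr p)"
      using assms(3) assms(5)[of x] norm_ge_zero[of "f x"] by (intro powr_add_le) (linarith | simp)+
    finally show "norm (norm (f x - g x) powr p) \<le> norm (2 powr p * (B powr p + norm (g x) powr p))"
      by simp
  qed
qed measurable

lemma powr_tendsto_0:
  assumes "\<And>n. 0 \<le> X n" "X \<longlonglongrightarrow> 0" "0 < (a::real)"
  shows "(\<lambda>n. X n powr a) \<longlonglongrightarrow> 0"
  using tendsto_powr'[OF assms(2) tendsto_const[of a]] assms by simp

text \<open>Bundles an eigenfunction with one weak gradient and one sequence of test functions, so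
  that each later identity can be proved for \<open>\<phi> n\<close> and passed to the
  limit.\<close>

locale p_eig = Lp_approx "lebesgue_on \<Omega>" p u g \<phi> "\<lambda>n. grad (\<phi> n)"
  for \<Omega> :: "'a::euclidean_space set" and p u g \<phi> +
  fixes lam :: real
  assumes open_\<Omega>: "open \<Omega>"
    and test: "\<And>n. test_function \<Omega> (\<phi> n)"
    and weak: "\<And>v. test_function \<Omega> v \<Longrightarrow>
        (LINT x|lebesgue_on \<Omega>. norm (g x) powr (p - 2) * (inner (g x) (grad v x)))
           = lam * (LINT x|lebesgue_on \<Omega>. \<bar>u x\<bar> powr (p - 2) * u x * v x)"

lemma p_eigenfunction_approx:
  fixes \<Omega> :: "'a::euclidean_space set"
  assumes "open \<Omega>" "bounded \<Omega>" "1 < p" "p_eigenfunction p \<Omega> lam u"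
  obtains g \<phi> where "p_eig \<Omega> p u g \<phi> lam"
proof -
  let ?M = "lebesgue_on \<Omega>"
  have [measurable]: "\<Omega> \<in> sets lebesgue" using assms(1) by auto
  interpret finite_measure ?M
    using assms(1,2) by (intro finite_measureI)
      (auto simp: emeasure_restrict_space dest: emeasure_bounded_finite)
  obtain g \<phi> where g: "in_W1p p \<Omega> u g" and t: "\<And>n. test_function \<Omega> (\<phi> n)"
    and W: "(\<lambda>n::nat. W1p_norm p \<Omega> (\<lambda>x. u x - \<phi> n x) (\<lambda>x. g x - grad (\<phi> n) x)) \<longlonglongrightarrow> 0"
    and weak: "\<And>v. test_function \<Omega> v \<Longrightarrow>
        (LINT x|?M. norm (g x) powr (p - 2) * (inner (g x) (grad v x)))
           = lam * (LINT x|?M. \<bar>u x\<bar> powr (p - 2) * u x * v x)"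
    using assms(4) unfolding p_eigenfunction_def in_W01p_def by auto
  have sm: "smooth (\<phi> n)" for n using t test_function_iff by blast
  have [measurable]: "u \<in> borel_measurable ?M" "g \<in> borel_measurable ?M"
    and int: "integrable ?M (\<lambda>x. \<bar>u x\<bar> powr p)" "integrable ?M (\<lambda>x. norm (g x) powr p)"
    using g by (auto simp: in_W1p_def in_Lp_def)
  have [measurable]: "\<phi> n \<in> borel_measurable ?M" "grad (\<phi> n) \<in> borel_measurable ?M" for n
    using smooth_continuous[OF sm] smooth_continuous_grad[OF sm]
    by (auto intro!: continuous_imp_measurable_on_sets_lebesgue)
  have bd: "\<exists>B. \<forall>x. \<bar>\<phi> n x\<bar> \<le> B \<and> norm (grad (\<phi> n) x) \<le> B" for n
    using t[of n] unfolding test_function_iff by (metis compact_support_grad_bounded)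
  have id: "integrable ?M (\<lambda>x. \<bar>\<phi> n x - u x\<bar> powr p)" "integrable ?M (\<lambda>x. norm (grad (\<phi> n) x - g x) powr p)" for n
    using bd[of n] integrable_bounded_diff_powr[of "\<phi> n" u p] integrable_bounded_diff_powr[of "grad (\<phi> n)" g p] int assms(3)
    by auto
  define I1 where "I1 n = (LINT x|?M. \<bar>\<phi> n x - u x\<bar> powr p)" for n
  define I2 where "I2 n = (LINT x|?M. norm (grad (\<phi> n) x - g x) powr p)" for n
  have nonneg: "0 \<le> I1 n" "0 \<le> I2 n" for n by (simp_all add: I1_def I2_def)
  have "W1p_norm p \<Omega> (\<lambda>x. u x - \<phi> n x) (\<lambda>x. g x - grad (\<phi> n) x) = (I1 n + I2 n) powr (1 / p)" for n
    by (simp add: W1p_norm_def I1_def I2_def abs_minus_commute norm_minus_commute)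
  then have "(\<lambda>n. ((I1 n + I2 n) powr (1 / p)) powr p) \<longlonglongrightarrow> 0"
    using W assms(3) by (intro powr_tendsto_0[of "\<lambda>n. (I1 n + I2 n) powr (1 / p)"]) simp_all
  then have sum: "(\<lambda>n. I1 n + I2 n) \<longlonglongrightarrow> 0"
    using assms(3) nonneg by (simp add: powr_powr)
  have I1: "I1 \<longlonglongrightarrow> 0" and I2: "I2 \<longlonglongrightarrow> 0"
    by (rule Lim_null_comparison[OF _ sum], use nonneg in simp)+
  \<comment> \<open>Convergence in L^p yields convergence almost everywhere only along a
    subsequence; the subsequence inherits the other limits.\<close>
  obtain r where r: "strict_mono r" and AE: "AE x in ?M. (\<lambda>n. \<bar>\<phi> (r n) x - u x\<bar> powr p) \<longlonglongrightarrow> 0"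
    using tendsto_L1_AE_subseq[of ?M "\<lambda>n x. \<bar>\<phi> n x - u x\<bar> powr p"] id(1) I1 unfolding I1_def by auto
  have "AE x in ?M. (\<lambda>n. \<phi> (r n) x) \<longlonglongrightarrow> u x"
    using AE
  proof eventually_elim
    case (elim x)
    have "(\<lambda>n. (\<bar>\<phi> (r n) x - u x\<bar> powr p) powr (1 / p)) \<longlonglongrightarrow> 0"
      using assms(3) by (intro powr_tendsto_0 elim) auto
    then have "(\<lambda>n. \<bar>\<phi> (r n) x - u x\<bar>) \<longlonglongrightarrow> 0" using assms(3) by (simp add: powr_powr)
    then show ?case by (simp add: LIM_zero_iff tendsto_rabs_zero_iff)
  qed
  moreover have "(\<lambda>n. I1 (r n)) \<longlonglongrightarrow> 0" "(\<lambda>n. I2 (r n)) \<longlonglongrightarrow> 0"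
    using LIMSEQ_subseq_LIMSEQ[OF I1 r] LIMSEQ_subseq_LIMSEQ[OF I2 r] by (simp_all add: o_def)
  ultimately have "p_eig \<Omega> p u g (\<lambda>n. \<phi> (r n)) lam"
    using assms(1,3) int id t weak unfolding I1_def I2_def
    by unfold_locales auto
  then show ?thesis by (rule that)
qed

text \<open>The weak equation is odd in the pair \<open>u\<close>, \<open>g\<close>. This allows the
  sign of \<open>u\<close> off the projections to be taken positive.\<close>

lemma p_eig_uminus:
  assumes "p_eig \<Omega> p u g \<phi> lam"
  shows "p_eig \<Omega> p (\<lambda>x. - u x) (\<lambda>x. - g x) (\<lambda>n x. - \<phi> n x) lam"
proof -
  interpret p_eig \<Omega> p u g \<phi> lam by fact
  have sm: "smooth (\<phi> n)" for n using test test_function_iff by blast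
  have gr: "grad (\<lambda>x. - \<phi> n x) x = - grad (\<phi> n) x" for n x
    by (rule grad_eqI) (use has_derivative_minus[OF smooth_grad[OF sm]] in simp)
  have gr': "grad (\<lambda>x. - \<phi> n x) = (\<lambda>x. - grad (\<phi> n) x)" for n
    using gr by auto
  have t: "test_function \<Omega> (\<lambda>x. - \<phi> n x)" for n
    using test[of n] smooth_mult[OF smooth_const[of "-1"] sm[of n]] unfolding test_function_iff by auto
  show ?thesis
  proof unfold_locales
    show "AE x in lebesgue_on \<Omega>. (\<lambda>n. - \<phi> n x) \<longlonglongrightarrow> - u x"
      using AE_conv by eventually_elim (rule tendsto_minus)
  qed (use p int int_diff conv weak open_\<Omega> t in \<open>auto simp: gr' abs_minus_commute norm_minus_commute\<close>)
qed

lemma integral_lebesgue_on_compact_support: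
  fixes f :: "'a::euclidean_space \<Rightarrow> real"
  assumes "\<Omega> \<in> sets lebesgue" "continuous_on UNIV f" "\<And>x. x \<notin> \<Omega> \<Longrightarrow> f x = 0"
  shows "(LINT x|lebesgue_on \<Omega>. f x) = (LINT x|lborel. f x)"
proof -
  have "(LINT x|lebesgue_on \<Omega>. f x) = (LINT x|lebesgue. indicator \<Omega> x *\<^sub>R f x)"
    using assms(1) by (intro integral_restrict_space) auto
  also have "(\<lambda>x. indicator \<Omega> x *\<^sub>R f x) = f" using assms(3) by (auto simp: fun_eq_iff indicator_def)
  also have "(LINT x|lebesgue. f x) = (LINT x|lborel. f x)"
    using assms(2) by (intro integral_completion) (auto intro: borel_measurable_continuous_onI)
  finally show ?thesis .
qed

context p_eig
begin

lemma \<Omega>_lebesgue [measurable]: "\<Omega> \<in> sets lebesgue"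
  using open_\<Omega> by auto

lemma continuous_lebesgue_on: "continuous_on UNIV f \<Longrightarrow> f \<in> borel_measurable (lebesgue_on \<Omega>)"
  by (intro continuous_imp_measurable_on_sets_lebesgue) (auto intro: continuous_on_subset)

lemma smooth_\<phi>: "smooth (\<phi> n)"
  using test test_function_iff by blast

lemma powr_le_maj: "norm (g x) powr (p - 1) \<le> maj x powr (p - 1)" "\<bar>u x\<bar> powr (p - 1) \<le> maj x powr (p - 1)"
  using p maj_ge by (auto intro!: powr_mono2)

lemma norm_powr_g: "norm (norm (g x) powr (p - 2) *\<^sub>R g x) = norm (g x) powr (p - 1)"
  using powr_mult_self[of "norm (g x)" "p - 1"] by simp

text \<open>Test with \<open>\<zeta> * F (\<phi> n)\<close>, which is smooth and vanishes off
  \<open>K\<close>, while the coefficients keep the true \<open>u\<close> and \<open>g\<close>; then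
  let \<open>n\<close> tend to infinity. The result is the weak equation tested with
  \<open>\<zeta> * F (u)\<close>, which need not be smooth.\<close>

lemma
  assumes \<zeta>: "smooth \<zeta>" "compact K" "K \<subseteq> \<Omega>" "\<And>x. x \<notin> K \<Longrightarrow> \<zeta> x = 0"
    and F: "smooth F" "\<And>t. \<bar>deriv F t\<bar> \<le> D"
  shows integrable_weak_lhs: "integrable (lebesgue_on \<Omega>) (\<lambda>x. norm (g x) powr (p - 2) * inner (g x) (grad \<zeta> x) * F (u x)
          + deriv F (u x) * (\<zeta> x * norm (g x) powr p))" (is "integrable _ ?L")
    and weak_chain: "(LINT x|lebesgue_on \<Omega>. norm (g x) powr (p - 2) * inner (g x) (grad \<zeta> x) * F (u x)
          + deriv F (u x) * (\<zeta> x * norm (g x) powr p))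
        = lam * (LINT x|lebesgue_on \<Omega>. \<bar>u x\<bar> powr (p - 2) * u x * \<zeta> x * F (u x))"
proof -
  obtain B where B: "B > 0" "\<And>x. \<bar>\<zeta> x\<bar> \<le> B" "\<And>x. norm (grad \<zeta> x) \<le> B"
    using compact_support_grad_bounded[OF \<zeta>(1,2,4)] by blast
  note F' = smooth_real_derivative[OF F(1)]
  have [measurable]: "\<zeta> \<in> borel_measurable (lebesgue_on \<Omega>)" "grad \<zeta> \<in> borel_measurable (lebesgue_on \<Omega>)"
    using smooth_continuous[OF \<zeta>(1)] smooth_continuous_grad[OF \<zeta>(1)] by (auto intro!: continuous_lebesgue_on)
  define A1 where "A1 x = \<zeta> x *\<^sub>R (norm (g x) powr (p - 2) *\<^sub>R g x)" for x
  define A0 where "A0 x = norm (g x) powr (p - 2) * inner (g x) (grad \<zeta> x)" for x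
  define A where "A x = \<bar>u x\<bar> powr (p - 2) * u x * \<zeta> x" for x
  have [measurable]: "A0 \<in> borel_measurable (lebesgue_on \<Omega>)" "A1 \<in> borel_measurable (lebesgue_on \<Omega>)"
    "A \<in> borel_measurable (lebesgue_on \<Omega>)"
    unfolding A0_def[abs_def] A1_def[abs_def] A_def[abs_def] by measurable
  have bA1: "norm (A1 x) \<le> B * maj x powr (p - 1)" for x
    unfolding A1_def norm_scaleR[of "\<zeta> x"] norm_powr_g
    using B powr_le_maj(1) by (intro mult_mono) auto
  have bA0: "\<bar>A0 x\<bar> \<le> B * maj x powr (p - 1)" for x
  proof -
    have "\<bar>A0 x\<bar> = \<bar>inner (norm (g x) powr (p - 2) *\<^sub>R g x) (grad \<zeta> x)\<bar>" by (simp add: A0_def)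
    also have "\<dots> \<le> norm (norm (g x) powr (p - 2) *\<^sub>R g x) * norm (grad \<zeta> x)" by (rule Cauchy_Schwarz_ineq2)
    also have "\<dots> \<le> maj x powr (p - 1) * B"
      unfolding norm_powr_g using B powr_le_maj(1) by (intro mult_mono) auto
    finally show ?thesis by (simp add: mult.commute)
  qed
  have bA: "\<bar>A x\<bar> \<le> B * maj x powr (p - 1)" for x
  proof -
    have "\<bar>A x\<bar> = \<bar>u x\<bar> powr (p - 1) * \<bar>\<zeta> x\<bar>"
      using powr_mult_self[of "\<bar>u x\<bar>" "p - 1"] by (simp add: A_def abs_mult)
    also have "\<dots> \<le> maj x powr (p - 1) * B" using B powr_le_maj(2) by (intro mult_mono) auto
    finally show ?thesis by (simp add: mult.commute)
  qed
  have A1g: "inner (A1 x) (g x) = \<zeta> x * norm (g x) powr p" for x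
    using powr_mult_self[of "norm (g x)" "p - 1"] powr_mult_self[of "norm (g x)" p]
    by (simp add: A1_def dot_square_norm power2_eq_square mult.assoc[symmetric])
  have zero: "norm (0::'a) \<le> B * maj x powr (p - 1)" for x using B by simp
  note l1 = tendsto_chain_integral[of A0 A1 B F "deriv F" D, OF _ _ bA0 bA1 F'(1) F'(2) F(2)]
  note i1 = integrable_chain_limit[of A0 A1 B F "deriv F" D, OF _ _ bA0 bA1 F'(1) F'(2) F(2)]
  \<comment> \<open>The right-hand side is the same kind of limit, with flux coefficient 0.\<close>
  note l2 = tendsto_chain_integral[of A "\<lambda>x. 0" B F "deriv F" D, OF _ _ bA zero F'(1) F'(2) F(2)]
  show "integrable (lebesgue_on \<Omega>) ?L" using i1 by (simp add: A0_def A1g)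
  have eq: "(LINT x|lebesgue_on \<Omega>. A0 x * F (\<phi> n x) + deriv F (\<phi> n x) * inner (A1 x) (grad (\<phi> n) x))
      = lam * (LINT x|lebesgue_on \<Omega>. A x * F (\<phi> n x) + deriv F (\<phi> n x) * inner 0 (grad (\<phi> n) x))" for n
  proof -
    define v where "v x = \<zeta> x * F (\<phi> n x)" for x
    have "test_function \<Omega> v"
      unfolding test_function_iff v_def[abs_def]
      using smooth_mult[OF \<zeta>(1) smooth_compose[OF F(1) smooth_\<phi>]] \<zeta> by auto
    note w = weak[OF this]
    have gv: "grad v x = F (\<phi> n x) *\<^sub>R grad \<zeta> x + (\<zeta> x * deriv F (\<phi> n x)) *\<^sub>R grad (\<phi> n) x" for x
    proof (rule grad_eqI)
      have "((\<lambda>x. F (\<phi> n x)) has_derivative (\<lambda>h. deriv F (\<phi> n x) * inner (grad (\<phi> n) x) h)) (at x)"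
        using has_derivative_compose[OF smooth_grad[OF smooth_\<phi>] F'(1)[unfolded has_field_derivative_def]] .
      from has_derivative_mult[OF smooth_grad[OF \<zeta>(1)] this]
      show "(v has_derivative inner (F (\<phi> n x) *\<^sub>R grad \<zeta> x + (\<zeta> x * deriv F (\<phi> n x)) *\<^sub>R grad (\<phi> n) x)) (at x)"
        unfolding v_def[abs_def] by (rule has_derivative_eq_rhs) (auto simp: inner_add_left algebra_simps)
    qed
    have "norm (g x) powr (p - 2) * inner (g x) (grad v x)
        = A0 x * F (\<phi> n x) + deriv F (\<phi> n x) * inner (A1 x) (grad (\<phi> n) x)" for x
      by (simp add: gv A0_def A1_def inner_add_right algebra_simps)
    moreover have "\<bar>u x\<bar> powr (p - 2) * u x * v x = A x * F (\<phi> n x) + deriv F (\<phi> n x) * inner 0 (grad (\<phi> n) x)" for x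
      by (simp add: A_def v_def)
    ultimately show ?thesis using w by simp
  qed
  have "(LINT x|lebesgue_on \<Omega>. A0 x * F (u x) + deriv F (u x) * inner (A1 x) (g x))
    = lam * (LINT x|lebesgue_on \<Omega>. A x * F (u x) + deriv F (u x) * inner 0 (g x))"
    by (rule LIMSEQ_unique[OF l1[unfolded eq] tendsto_mult_left[OF l2]]) auto
  then show "(LINT x|lebesgue_on \<Omega>. norm (g x) powr (p - 2) * inner (g x) (grad \<zeta> x) * F (u x)
          + deriv F (u x) * (\<zeta> x * norm (g x) powr p))
        = lam * (LINT x|lebesgue_on \<Omega>. \<bar>u x\<bar> powr (p - 2) * u x * \<zeta> x * F (u x))"
    by (simp add: A0_def A1g A_def)
qed

text \<open>The integrand is the derivative of \<open>\<xi> * G (u)\<close> in direction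
  \<open>b\<close>; with \<open>\<phi> n\<close> in place of \<open>u\<close> it is classical and
  integrates to 0. Only continuous first derivatives of \<open>\<xi>\<close> and \<open>G\<close>
  are asked for, because both will be built from primitives of continuous functions.\<close>

lemma
  fixes b :: 'a
  assumes \<xi>: "\<And>x. (\<xi> has_derivative inner (X x)) (at x)" "continuous_on UNIV X"
      "compact K" "K \<subseteq> \<Omega>" "\<And>x. x \<notin> K \<Longrightarrow> \<xi> x = 0"
    and G: "\<And>t. (G has_real_derivative G' t) (at t)" "continuous_on UNIV G'" "\<And>t. \<bar>G' t\<bar> \<le> D"
  shows integrable_divergence: "integrable (lebesgue_on \<Omega>) (\<lambda>x. inner (X x) b * G (u x) + G' (u x) * (\<xi> x * inner b (g x)))"
    and divergence: "(LINT x|lebesgue_on \<Omega>. inner (X x) b * G (u x) + G' (u x) * (\<xi> x * inner b (g x))) = 0"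
proof -
  have cont\<xi>: "continuous_on UNIV \<xi>" by (meson \<xi>(1) has_derivative_at_withinI has_derivative_continuous_on)
  have contG: "continuous_on UNIV G" by (meson G(1) DERIV_isCont continuous_at_imp_continuous_on)
  have X0: "X x = 0" if "x \<notin> K" for x
    using has_derivative_grad[OF \<xi>(1)] grad_locally_const[of "- K" x \<xi> 0] \<xi>(3,5) that
    by (metis Compl_iff compact_imp_closed grad_eqI[OF \<xi>(1)] open_Compl)
  obtain B1 where B1: "B1 > 0" "\<And>x. norm (X x) \<le> B1"
    using continuous_compact_support_bounded[OF \<xi>(2,3) X0] by blast
  obtain B2 where B2: "B2 > 0" "\<And>x. norm (\<xi> x) \<le> B2"
    using continuous_compact_support_bounded[OF cont\<xi> \<xi>(3,5)] by blast
  define C where "C = (B1 + B2) * norm b"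
  have one: "1 \<le> maj x powr (p - 1)" for x using maj_ge(1)[of x] p by (simp add: ge_one_powr_ge_zero)
  have C: "C \<le> C * maj x powr (p - 1)" for x
    using mult_left_mono[OF one[of x], of C] B1 B2 by (simp add: C_def)
  have b0: "\<bar>inner (X x) b\<bar> \<le> C * maj x powr (p - 1)" for x
  proof -
    have "\<bar>inner (X x) b\<bar> \<le> norm (X x) * norm b" by (rule Cauchy_Schwarz_ineq2)
    also have "\<dots> \<le> C" unfolding C_def using B1 B2 by (intro mult_right_mono) (auto intro: add_increasing2)
    finally show ?thesis using C[of x] by simp
  qed
  have b1: "norm (\<xi> x *\<^sub>R b) \<le> C * maj x powr (p - 1)" for x
  proof -
    have "norm (\<xi> x *\<^sub>R b) \<le> C" unfolding C_def norm_scaleR using B1 B2 by (intro mult_right_mono) (auto intro: add_increasing)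
    then show ?thesis using C[of x] by simp
  qed
  have [measurable]: "(\<lambda>x. inner (X x) b) \<in> borel_measurable (lebesgue_on \<Omega>)"
    "(\<lambda>x. \<xi> x *\<^sub>R b) \<in> borel_measurable (lebesgue_on \<Omega>)"
    using \<xi>(2) cont\<xi> by (auto intro!: continuous_lebesgue_on continuous_intros)
  note l = tendsto_chain_integral[of "\<lambda>x. inner (X x) b" "\<lambda>x. \<xi> x *\<^sub>R b" C G G' D, OF _ _ b0 b1 G]
  note i = integrable_chain_limit[of "\<lambda>x. inner (X x) b" "\<lambda>x. \<xi> x *\<^sub>R b" C G G' D, OF _ _ b0 b1 G]
  show "integrable (lebesgue_on \<Omega>) (\<lambda>x. inner (X x) b * G (u x) + G' (u x) * (\<xi> x * inner b (g x)))"
    using i by simp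
  have "(LINT x|lebesgue_on \<Omega>. inner (X x) b * G (\<phi> n x) + G' (\<phi> n x) * inner (\<xi> x *\<^sub>R b) (grad (\<phi> n) x)) = 0" for n
  proof -
    define D' where "D' x h = inner (X x) h * G (\<phi> n x) + \<xi> x * (G' (\<phi> n x) * inner (grad (\<phi> n) x) h)" for x h
    have cont: "continuous_on UNIV (\<lambda>x. D' x b)"
      unfolding D'_def
      by (intro continuous_intros \<xi>(2) cont\<xi> continuous_on_compose2[OF contG] continuous_on_compose2[OF G(2)]
          smooth_continuous smooth_continuous_grad smooth_\<phi>) auto
    have "((\<lambda>x. G (\<phi> n x)) has_derivative (\<lambda>h. G' (\<phi> n x) * inner (grad (\<phi> n) x) h)) (at x)" for x
      using has_derivative_compose[OF smooth_grad[OF smooth_\<phi>] G(1)[unfolded has_field_derivative_def]] .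
    from has_derivative_mult[OF \<xi>(1) this]
    have "((\<lambda>x. \<xi> x * G (\<phi> n x)) has_derivative D' x) (at x)" for x
      by (rule has_derivative_eq_rhs) (auto simp: D'_def)
    then have "(LINT x|lborel. D' x b) = 0"
      by (rule integral_directional_derivative[where f' = D', OF _ cont \<xi>(3)]) (simp add: \<xi>(5))
    moreover have "(LINT x|lebesgue_on \<Omega>. D' x b) = (LINT x|lborel. D' x b)"
    proof (rule integral_lebesgue_on_compact_support[OF \<Omega>_lebesgue cont])
      fix x assume "x \<notin> \<Omega>"
      then have "x \<notin> K" using \<xi>(4) by auto
      then show "D' x b = 0" by (simp add: D'_def X0 \<xi>(5))
    qed
    ultimately show ?thesis by (simp add: D'_def inner_commute mult_ac)
  qed
  from l[unfolded this] show "(LINT x|lebesgue_on \<Omega>. inner (X x) b * G (u x) + G' (u x) * (\<xi> x * inner b (g x))) = 0"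
    by (simp add: LIMSEQ_const_iff)
qed

end

section \<open>Auxiliary functions of one real variable\<close>

lemma bounded_if_bounded_outside:
  fixes f :: "real \<Rightarrow> real"
  assumes "continuous_on UNIV f" "\<And>t. t \<notin> {a..b} \<Longrightarrow> \<bar>f t\<bar> \<le> B"
  obtains D where "\<And>t. \<bar>f t\<bar> \<le> D"
proof -
  have "bounded (f ` {a..b})"
    using assms(1) by (meson compact_Icc compact_continuous_image compact_imp_bounded continuous_on_subset subset_UNIV)
  then obtain B' where "\<And>t. t \<in> {a..b} \<Longrightarrow> \<bar>f t\<bar> \<le> B'"
    unfolding bounded_iff by fastforce
  then have "\<bar>f t\<bar> \<le> max B B'" for t
    using assms(2)[of t] by (cases "t \<in> {a..b}") (auto simp: le_max_iff_disj)
  then show ?thesis by (rule that)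
qed

lemma deriv_smooth_step_0: "t < 0 \<Longrightarrow> deriv smooth_step t = 0" "t > 1 \<Longrightarrow> deriv smooth_step t = 0"
  using deriv_locally_const[of "{..<0}" t smooth_step 0] deriv_locally_const[of "{1<..}" t smooth_step 1]
  by (auto simp: smooth_step_values)

lemma smooth_step_affine_derivative:
  "((\<lambda>t. smooth_step (c * t + d)) has_real_derivative deriv smooth_step (c * t + d) * c) (at t)"
  by (rule DERIV_chain'[where f = "\<lambda>t. c * t + d"])
     (auto intro!: derivative_eq_intros smooth_real_derivative(1) smooth_smooth_step)

text \<open>A smooth stand-in for \<open>min 0 t\<close>: the rescalings
  \<open>H (N * t) / N\<close> converge to it, and the bounds \<open>\<bar>t\<bar>\<close> and
  \<open>D\<close> survive rescaling, as dominated convergence requires. Vanishing for all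
  \<open>t \<ge> 0\<close> will remove the term with the gradient of the cutoff.\<close>

lemma smooth_negative_part:
  obtains H D where "smooth H" "\<And>t. t \<ge> 0 \<Longrightarrow> H t = 0" "\<And>t. t \<le> - 1 \<Longrightarrow> H t = t" "\<And>t. \<bar>H t\<bar> \<le> \<bar>t\<bar>"
    "\<And>t. t \<ge> 0 \<Longrightarrow> deriv H t = 0" "\<And>t. t < - 1 \<Longrightarrow> deriv H t = (1::real)" "\<And>t. \<bar>deriv H t\<bar> \<le> D"
proof -
  define H where "H t = t * smooth_step ((- 1) * t + 0)" for t :: real
  have sm: "smooth H"
    unfolding H_def[abs_def] by (intro smooth_mult smooth_ident smooth_compose[OF smooth_smooth_step] smooth_affine)
  have "(H has_real_derivative smooth_step (- t) - t * deriv smooth_step (- t)) (at t)" for t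
    unfolding H_def[abs_def]
    using DERIV_mult[OF DERIV_ident smooth_step_affine_derivative[of "-1" 0 t]] by (simp add: mult.commute)
  then have d: "deriv H t = smooth_step (- t) - t * deriv smooth_step (- t)" for t
    by (rule DERIV_imp_deriv)
  have d0: "deriv H t = 0" if "t \<ge> 0" for t
    using that deriv_smooth_step_0(1)[of "- t"] by (cases "t = 0") (auto simp: d smooth_step_values)
  have d1: "deriv H t = 1" if "t < - 1" for t
    using that by (simp add: d smooth_step_values deriv_smooth_step_0)
  have "\<bar>deriv H t\<bar> \<le> 1" if "t \<notin> {-1..0}" for t
    using that d0[of t] d1[of t] by fastforce
  then obtain D where D: "\<And>t. \<bar>deriv H t\<bar> \<le> D"
    using bounded_if_bounded_outside[OF smooth_real_derivative(2)[OF sm]] by blast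
  show ?thesis
  proof (rule that[OF sm _ _ _ d0 d1 D])
    show "\<bar>H t\<bar> \<le> \<bar>t\<bar>" for t
      using smooth_step_values(3,4)[of "- t"] by (simp add: H_def abs_mult mult_left_le)
  qed (auto simp: H_def smooth_step_values)
qed

text \<open>The rescaling \<open>e * h (t / e)\<close> equals \<open>t + e\<close> for
  \<open>t \<ge> 0\<close> and is at least \<open>e / 2\<close> everywhere, so its negative powers
  are smooth on the whole line.\<close>

lemma smooth_shift:
  obtains h D where "smooth h" "\<And>t. t \<ge> 0 \<Longrightarrow> h t = 1 + t" "\<And>t. h t \<ge> 1 / 2"
    "\<And>t. t \<ge> 0 \<Longrightarrow> deriv h t = (1::real)" "\<And>t. \<bar>deriv h t\<bar> \<le> D"
proof -
  \<comment> \<open>The argument \<open>2 * t + 1\<close> confines the transition to the interval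
    from \<open>- 1 / 2\<close> to 0. Below it the product vanishes, inside it the product is at
    least \<open>t\<close>, whence the bound \<open>1 / 2\<close>.\<close>
  define h where "h t = 1 + t * smooth_step (2 * t + 1)" for t :: real
  have sm: "smooth h"
    unfolding h_def[abs_def]
    by (intro smooth_add smooth_const smooth_mult smooth_ident smooth_compose[OF smooth_smooth_step] smooth_affine)
  have "(h has_real_derivative smooth_step (2 * t + 1) + t * (deriv smooth_step (2 * t + 1) * 2)) (at t)" for t
    unfolding h_def[abs_def]
    using DERIV_add[OF DERIV_const DERIV_mult[OF DERIV_ident smooth_step_affine_derivative[of 2 1 t]], of 1] by (simp add: mult_ac)
  then have d: "deriv h t = smooth_step (2 * t + 1) + t * (deriv smooth_step (2 * t + 1) * 2)" for t
    by (rule DERIV_imp_deriv)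
  have d0: "deriv h t = 1" if "t \<ge> 0" for t
    using that deriv_smooth_step_0(2)[of "2 * t + 1"] by (cases "t = 0") (auto simp: d smooth_step_values)
  have d1: "deriv h t = 0" if "t < - 1" for t
    using that by (simp add: d smooth_step_values deriv_smooth_step_0)
  have "\<bar>deriv h t\<bar> \<le> 1" if "t \<notin> {-1..0}" for t
    using that d0[of t] d1[of t] by fastforce
  then obtain D where D: "\<And>t. \<bar>deriv h t\<bar> \<le> D"
    using bounded_if_bounded_outside[OF smooth_real_derivative(2)[OF sm]] by blast
  show ?thesis
  proof (rule that[OF sm _ _ d0 D])
    show "h t \<ge> 1 / 2" for t
    proof (cases "t \<ge> - 1 / 2")
      case True
      have "t * smooth_step (2 * t + 1) \<ge> - 1 / 2"
      proof (cases "t \<ge> 0")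
        case False
        then have "t * smooth_step (2 * t + 1) \<ge> t * 1"
          by (intro mult_left_mono_neg smooth_step_values) auto
        then show ?thesis using True by simp
      next
        case nonneg: True
        then have "0 \<le> t * smooth_step (2 * t + 1)" by (intro mult_nonneg_nonneg smooth_step_values)
        then show ?thesis by linarith
      qed
      then show ?thesis by (simp add: h_def)
    qed (simp add: h_def smooth_step_values)
  qed (auto simp: h_def smooth_step_values)
qed

text \<open>The total rise of \<open>\<theta>\<close> is at most the measure of an open set around
  \<open>E\<close>, still below \<open>S\<close>. Integration by parts against
  \<open>\<theta>\<close> thus gains 1 on \<open>E\<close> at the price of a factor
  \<open>S\<close>, which is the source of both smallness estimates below.\<close>

lemma small_primitive:
  fixes E :: "real set"
  assumes "compact E" "measure lebesgue E < S"
  obtains \<theta> q where "\<And>t. (\<theta> has_real_derivative q t) (at t)" "continuous_on UNIV q" "\<And>t. 0 \<le> q t"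
    "\<And>t. t \<in> E \<Longrightarrow> q t = 1" "\<And>t. \<bar>\<theta> t\<bar> \<le> S"
proof -
  have E: "E \<in> lmeasurable" using assms(1) by (rule lmeasurable_compact)
  then obtain T where T: "open T" "E \<subseteq> T" "T - E \<in> lmeasurable" "emeasure lebesgue (T - E) < S - measure lebesgue E"
    using sets_lebesgue_outer_open[of E "S - measure lebesgue E"] assms(2) by (auto simp: fmeasurableD)
  have Tm: "T \<in> lmeasurable"
    using fmeasurable.Un[OF E T(3)] T(2) by (simp add: Un_absorb1)
  have "measure lebesgue T = measure lebesgue E + measure lebesgue (T - E)"
    using E T Tm by (simp add: measurable_measure_Diff fmeasurableD)
  moreover have "measure lebesgue (T - E) < S - measure lebesgue E"
    using T(3,4) assms(2) by (simp add: emeasure_eq_measure2 ennreal_less_iff)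
  ultimately have mT: "measure lebesgue T < S" by simp
  obtain q :: "real \<Rightarrow> real" where q: "continuous_on UNIV q" "\<And>x. q x \<in> closed_segment 1 0"
      "\<And>x. x \<in> E \<Longrightarrow> q x = 1" "\<And>x. x \<in> - T \<Longrightarrow> q x = 0"
    using Urysohn[of E "- T" "1::real" 0] assms(1) T(1,2) compact_imp_closed by blast
  have q01: "0 \<le> q x" "q x \<le> 1" for x using q(2)[of x] by (auto simp: closed_segment_eq_real_ivl)
  obtain \<theta> where \<theta>: "\<And>t. (\<theta> has_real_derivative q t) (at t)" "\<theta> 0 = 0"
    using smooth_primitive[OF q(1), of 0] by blast
  have bound: "\<theta> b - \<theta> a \<in> {0..S}" if "a \<le> b" for a b
  proof -
    have I: "(q has_integral (\<theta> b - \<theta> a)) {a..b}"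
      by (rule fundamental_theorem_of_calculus[OF that])
         (use \<theta>(1) in \<open>auto simp: has_real_derivative_iff_has_vector_derivative[symmetric] intro: has_field_derivative_at_within\<close>)
    have "0 \<le> \<theta> b - \<theta> a" by (rule has_integral_nonneg[OF I]) (use q01 in auto)
    moreover have "\<theta> b - \<theta> a \<le> measure lebesgue T"
    proof (rule has_integral_le)
      show "((\<lambda>x. if x \<in> {a..b} then q x else 0) has_integral (\<theta> b - \<theta> a)) UNIV"
        using I by (simp only: has_integral_restrict_UNIV)
      show "(indicat_real T has_integral measure lebesgue T) UNIV"
        using Tm lmeasurable_iff_indicator_has_integral by blast
      show "(if x \<in> {a..b} then q x else 0) \<le> indicat_real T x" for x
        using q01[of x] q(4)[of x] by (auto simp: indicator_def)
    qed
    ultimately show ?thesis using mT by simp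
  qed
  have "\<bar>\<theta> t\<bar> \<le> S" for t
    using bound[of 0 t] bound[of t 0] \<theta>(2) by (cases "t \<ge> 0") auto
  then show ?thesis using that \<theta>(1) q(1,3) q01 by blast
qed

lemma smooth_component: "smooth (\<lambda>x::real^'n. x $ i)"
  using smooth_inner[of "axis i (1::real)"] by (simp add: inner_axis)

lemma smooth_component_compose: "smooth f \<Longrightarrow> smooth (\<lambda>x::real^'n. f (x $ i))"
  by (rule smooth_compose[OF _ smooth_component])

text \<open>\<open>G\<close> is the p-th power of the negative part, continued with constant slope
  below \<open>- m\<close> to keep \<open>k\<close> bounded. With \<open>m\<close> a bound of
  \<open>\<bar>u\<bar>\<close> on the box the truncation is never seen; \<open>p > 1\<close> makes
  \<open>k\<close> continuous at 0.\<close>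

lemma truncated_power_primitive:
  fixes p m :: real
  assumes "1 < p" "0 \<le> m"
  obtains G k D where "\<And>t. (G has_real_derivative k t) (at t)" "continuous_on UNIV k" "\<And>t. \<bar>k t\<bar> \<le> D"
    "\<And>t. t \<ge> 0 \<Longrightarrow> k t = 0" "\<And>t. t \<ge> 0 \<Longrightarrow> G t = 0"
    "\<And>t. - m \<le> t \<Longrightarrow> t \<le> 0 \<Longrightarrow> k t = - p * (- t) powr (p - 1)"
    "\<And>t. - m \<le> t \<Longrightarrow> t \<le> 0 \<Longrightarrow> G t = (- t) powr p"
proof -
  define k where "k t = - p * (min m (max 0 (- t))) powr (p - 1)" for t
  have k: "continuous_on UNIV k"
    unfolding k_def using assms
    by (intro continuous_intros continuous_on_powr') auto
  have "\<bar>k t\<bar> \<le> p * m powr (p - 1)" for t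
    using assms by (auto simp: k_def abs_mult intro!: mult_left_mono powr_mono2)
  moreover have k0: "k t = 0" if "t \<ge> 0" for t using that assms by (simp add: k_def)
  moreover obtain G where G: "\<And>t. (G has_real_derivative k t) (at t)" "G 0 = 0"
    using smooth_primitive[OF k, of 0] by blast
  moreover have "G t = 0" if "t \<ge> 0" for t
  proof (cases "t = 0")
    case False
    have "G t = G 0"
      by (rule DERIV_isconst2[of 0 t])
         (use that False G(1) k0 in \<open>auto intro!: continuous_at_imp_continuous_on DERIV_isCont, metis less_imp_le\<close>)
    then show ?thesis using G by simp
  qed (use G in simp)
  moreover have k1: "k t = - p * (- t) powr (p - 1)" if "- m \<le> t" "t \<le> 0" for t
    using that by (simp add: k_def)
  moreover have "G t = (- t) powr p" if "- m \<le> t" "t \<le> 0" for t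
  proof (cases "t = 0")
    case False
    have "G 0 - (- 0) powr p = G t - (- t) powr p"
    proof (rule DERIV_isconst2[of t 0 "\<lambda>s. G s - (- s) powr p"])
      show "continuous_on {t..0} (\<lambda>s. G s - (- s) powr p)"
        using assms G(1)
        by (intro continuous_intros continuous_on_powr' continuous_at_imp_continuous_on ballI DERIV_isCont[OF G(1)]) auto
      fix s assume s: "t < s" "s < 0"
      have "((\<lambda>s. (- s) powr p) has_real_derivative - p * (- s) powr (p - 1)) (at s)"
        using s by (auto intro!: derivative_eq_intros)
      from DERIV_diff[OF G(1) this] show "((\<lambda>s. G s - (- s) powr p) has_real_derivative 0) (at s)"
        using k1[of s] s that by simp
    qed (use that False in auto)
    then show ?thesis using G(2) by simp
  qed (use G in simp)
  ultimately show ?thesis using that k by blast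
qed

section \<open>Vanishing of the negative part on narrow sets\<close>

text \<open>The end coordinates have positive distance from the closed sets \<open>E1\<close> and
  \<open>E2\<close>, and this margin is the room in which the cutoff descends to 0. The value 1 on a
  whole neighbourhood makes the gradient vanish at the point.\<close>

lemma box_cutoff:
  fixes c d :: "real^2"
  assumes "closed E1" "closed E2" "c $ 1 \<notin> E1" "d $ 1 \<notin> E1" "c $ 2 \<notin> E2" "d $ 2 \<notin> E2"
  obtains \<eta> :: "real^2 \<Rightarrow> real" where "smooth \<eta>" "\<And>x. 0 \<le> \<eta> x" "\<And>x. \<eta> x \<le> 1" "\<And>x. x \<notin> cbox c d \<Longrightarrow> \<eta> x = 0"
    "\<And>x. x \<in> cbox c d \<Longrightarrow> x $ 1 \<in> E1 \<Longrightarrow> x $ 2 \<in> E2 \<Longrightarrow> \<forall>\<^sub>F y in nhds x. y \<in> cbox c d \<and> \<eta> y = 1"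
proof -
  have "\<exists>e. smooth e \<and> (\<forall>t. 0 \<le> e t \<and> e t \<le> 1) \<and> (\<forall>t. t \<notin> {a..b} \<longrightarrow> e t = 0)
      \<and> (\<forall>t\<in>E. a \<le> t \<and> t \<le> b \<longrightarrow> (\<exists>r s. r < t \<and> t < s \<and> a \<le> r \<and> s \<le> b \<and> (\<forall>\<tau>. r \<le> \<tau> \<and> \<tau> \<le> s \<longrightarrow> e \<tau> = (1::real))))"
    if E: "closed E" "a \<notin> E" "b \<notin> E" for E :: "real set" and a b
  proof -
    obtain r1 where r1: "r1 > 0" "\<And>t. t \<in> E \<Longrightarrow> r1 \<le> dist a t" using separate_point_closed[OF E(1,2)] by blast
    obtain r2 where r2: "r2 > 0" "\<And>t. t \<in> E \<Longrightarrow> r2 \<le> dist b t" using separate_point_closed[OF E(1,3)] by blast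
    obtain e :: "real \<Rightarrow> real" where e: "smooth e" "\<And>t. 0 \<le> e t" "\<And>t. e t \<le> 1"
      "\<And>t. a + r1 / 2 \<le> t \<Longrightarrow> t \<le> b - r2 / 2 \<Longrightarrow> e t = 1" "\<And>t. t \<notin> {a..b} \<Longrightarrow> e t = 0"
      by (rule smooth_cutoff_real[of a "a + r1 / 2" "b - r2 / 2" b])
         (use r1(1) in simp, use r2(1) in simp, rule that)
    have "\<exists>r s. r < t \<and> t < s \<and> a \<le> r \<and> s \<le> b \<and> (\<forall>\<tau>. r \<le> \<tau> \<and> \<tau> \<le> s \<longrightarrow> e \<tau> = 1)"
      if "t \<in> E" "a \<le> t" "t \<le> b" for t
    proof (intro exI conjI)
      have "r1 \<le> t - a" "r2 \<le> b - t" using r1(2) r2(2) that by (fastforce simp: dist_real_def)+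
      then show "a + r1 / 2 < t" "t < b - r2 / 2" using r1(1) r2(1) by auto
    qed (use e(4) r1(1) r2(1) in auto)
    then show ?thesis using e by blast
  qed
  note 1 = this[OF assms(1,3,4)] and 2 = this[OF assms(2,5,6)]
  obtain e1 where e1: "smooth e1" "\<And>t. 0 \<le> e1 t" "\<And>t. e1 t \<le> (1::real)" "\<And>t. t \<notin> {c$1..d$1} \<Longrightarrow> e1 t = 0"
    "\<And>t. t \<in> E1 \<Longrightarrow> c$1 \<le> t \<Longrightarrow> t \<le> d$1 \<Longrightarrow> \<exists>r s. r < t \<and> t < s \<and> c$1 \<le> r \<and> s \<le> d$1 \<and> (\<forall>\<tau>. r \<le> \<tau> \<and> \<tau> \<le> s \<longrightarrow> e1 \<tau> = 1)"
    using 1 by blast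
  obtain e2 where e2: "smooth e2" "\<And>t. 0 \<le> e2 t" "\<And>t. e2 t \<le> (1::real)" "\<And>t. t \<notin> {c$2..d$2} \<Longrightarrow> e2 t = 0"
    "\<And>t. t \<in> E2 \<Longrightarrow> c$2 \<le> t \<Longrightarrow> t \<le> d$2 \<Longrightarrow> \<exists>r s. r < t \<and> t < s \<and> c$2 \<le> r \<and> s \<le> d$2 \<and> (\<forall>\<tau>. r \<le> \<tau> \<and> \<tau> \<le> s \<longrightarrow> e2 \<tau> = 1)"
    using 2 by blast
  show ?thesis
  proof (rule that[of "\<lambda>x. e1 (x$1) * e2 (x$2)"])
    show "smooth (\<lambda>x. e1 (x$1) * e2 (x$2))"
      by (intro smooth_mult smooth_component_compose e1 e2)
    show "0 \<le> e1 (x$1) * e2 (x$2)" "e1 (x$1) * e2 (x$2) \<le> 1" for x :: "real^2"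
      using e1 e2 by (auto intro!: mult_le_one)
    show "e1 (x$1) * e2 (x$2) = 0" if "x \<notin> cbox c d" for x
      using that e1(4)[of "x$1"] e2(4)[of "x$2"] by (auto simp: mem_box_cart forall_2)
    show "\<forall>\<^sub>F y in nhds x. y \<in> cbox c d \<and> e1 (y$1) * e2 (y$2) = 1"
      if x: "x \<in> cbox c d" "x $ 1 \<in> E1" "x $ 2 \<in> E2" for x
    proof -
      obtain r s where rs: "r < x$1" "x$1 < s" "c$1 \<le> r" "s \<le> d$1" "\<And>\<tau>. r \<le> \<tau> \<Longrightarrow> \<tau> \<le> s \<Longrightarrow> e1 \<tau> = 1"
        using e1(5)[OF x(2)] x(1) by (auto simp: mem_box_cart)
      obtain r' s' where rs': "r' < x$2" "x$2 < s'" "c$2 \<le> r'" "s' \<le> d$2" "\<And>\<tau>. r' \<le> \<tau> \<Longrightarrow> \<tau> \<le> s' \<Longrightarrow> e2 \<tau> = 1"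
        using e2(5)[OF x(3)] x(1) by (auto simp: mem_box_cart)
      define N where "N = box (vector [r, r'] :: real^2) (vector [s, s'])"
      have "open N" "x \<in> N" using rs rs' by (auto simp: N_def mem_box_cart forall_2)
      then have "\<forall>\<^sub>F y in nhds x. y \<in> N" by (rule eventually_nhds_in_open)
      then show ?thesis
      proof eventually_elim
        case (elim y)
        then show ?case using rs rs' by (auto simp: N_def mem_box_cart forall_2)
      qed
    qed
  qed
qed

lemma eventually_nhds_grad_0:
  assumes "\<forall>\<^sub>F y in nhds x. f y = c"
  shows "grad f x = 0"
proof -
  obtain S where "open S" "x \<in> S" "\<forall>y\<in>S. f y = c" using assms unfolding eventually_nhds by blast
  then show ?thesis by (intro grad_locally_const[of S x f c]) auto
qed

text \<open>The negative part of \<open>u\<close>, cut off to the box, has Rayleigh quotient \<open>lam\<close>; but it lives over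
  the set \<open>E2\<close> of measure less than \<open>S\<close>, where the one-dimensional Poincare inequality bounds the
  Rayleigh quotient below by a multiple of \<open>S powr - p\<close>. Hence it vanishes.\<close>
lemma nonneg_if_small_nodal:
  fixes \<Omega> :: "(real^2) set"
  assumes "p_eig \<Omega> p u g \<phi> lam" and box: "cbox c d \<subseteq> \<Omega>" and cont: "continuous_on \<Omega> u"
    and E: "closed E1" "compact E2" "c $ 1 \<notin> E1" "d $ 1 \<notin> E1" "c $ 2 \<notin> E2" "d $ 2 \<notin> E2"
    and sub: "\<And>x. x \<in> cbox c d \<Longrightarrow> u x \<le> 0 \<Longrightarrow> x $ 1 \<in> E1 \<and> x $ 2 \<in> E2"
    and S: "measure lebesgue E2 < S" "2 powr p * (S * p) powr p * lam < 1"
    and x0: "x0 \<in> cbox c d"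
  shows "0 \<le> u x0"
proof -
  interpret p_eig \<Omega> p u g \<phi> lam by fact
  define M where "M = lebesgue_on \<Omega>"
  have spM: "space M = \<Omega>" by (simp add: M_def)
  obtain \<eta> where \<eta>: "smooth \<eta>" "\<And>x. 0 \<le> \<eta> x" "\<And>x. \<eta> x \<le> 1" "\<And>x. x \<notin> cbox c d \<Longrightarrow> \<eta> x = 0"
    and near: "\<And>x. x \<in> cbox c d \<Longrightarrow> x $ 1 \<in> E1 \<Longrightarrow> x $ 2 \<in> E2 \<Longrightarrow> \<forall>\<^sub>F y in nhds x. y \<in> cbox c d \<and> \<eta> y = 1"
    by (rule box_cutoff[OF E(1) compact_imp_closed[OF E(2)] E(3-6)]) (rule that)
  have near': "\<forall>\<^sub>F y in nhds x. y \<in> cbox c d \<and> \<eta> y = 1" if "x \<in> cbox c d" "u x \<le> 0" for x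
    using near sub that by blast
  have \<eta>1: "\<eta> x = 1" if "x \<in> cbox c d" "u x \<le> 0" for x
    using near'[OF that] by (auto dest: eventually_nhds_x_imp_x)
  \<comment> \<open>No cutoff error arises: \<open>\<eta>\<close> is locally constant at points with
    \<open>u \<le> 0\<close>, while the terms that contain \<open>grad \<eta>\<close> will carry a
    function of \<open>u\<close> vanishing for \<open>u \<ge> 0\<close>.\<close>
  have grad0: "grad \<eta> x = 0" if "x \<notin> cbox c d \<or> u x \<le> 0" for x
  proof (cases "x \<in> cbox c d")
    case True
    then show ?thesis using near'[of x] that
      by (intro eventually_nhds_grad_0[where c = 1]) (auto elim: eventually_mono)
  next
    case False
    then show ?thesis
      by (intro grad_locally_const[of "- cbox c d" x \<eta> 0]) (auto simp: \<eta>(4))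
  qed
  define neg where "neg x = max 0 (- u x)" for x
  define J where "J = (LINT x|M. (if u x < 0 then \<eta> x * norm (g x) powr p else 0))"
  define I where "I = (LINT x|M. \<eta> x * neg x powr p)"
  have [measurable]: "\<eta> \<in> borel_measurable M" "u \<in> borel_measurable M" "g \<in> borel_measurable M"
    using smooth_continuous[OF \<eta>(1)] meas by (auto simp: M_def intro!: continuous_lebesgue_on)
  have [measurable]: "neg \<in> borel_measurable M" unfolding neg_def by measurable
  have intJ: "integrable M (\<lambda>x. if u x < 0 then \<eta> x * norm (g x) powr p else 0)"
    by (rule Bochner_Integration.integrable_bound[OF int(2)[folded M_def]])
       (use \<eta>(2,3) in \<open>auto intro!: mult_left_le_one_le\<close>)
  have intI: "integrable M (\<lambda>x. \<eta> x * neg x powr p)"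
  proof (rule Bochner_Integration.integrable_bound[OF int(1)[folded M_def]])
    show "AE x in M. norm (\<eta> x * neg x powr p) \<le> norm (\<bar>u x\<bar> powr p)"
      using \<eta>(2,3) p by (intro AE_I2) (auto simp: neg_def max_def intro!: mult_left_le_one_le)
  qed measurable
  \<comment> \<open>\<open>J\<close> is the energy and \<open>I\<close> the mass of the cut-off
    negative part. Their relation is the weak equation tested with \<open>\<eta> * F n (u)\<close>,
    where \<open>F n\<close> tends to \<open>min 0\<close>.\<close>
  have JI: "J = lam * I"
  proof -
    obtain H D where H: "smooth H" "\<And>t. t \<ge> 0 \<Longrightarrow> H t = 0" "\<And>t. t \<le> - 1 \<Longrightarrow> H t = t" "\<And>t. \<bar>H t\<bar> \<le> \<bar>t\<bar>"
      "\<And>t. t \<ge> 0 \<Longrightarrow> deriv H t = 0" "\<And>t. t < - 1 \<Longrightarrow> deriv H t = (1::real)" "\<And>t. \<bar>deriv H t\<bar> \<le> D"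
      by (rule smooth_negative_part) (rule that)
    define N where "N n = real (Suc n)" for n
    have N: "N n > 0" for n by (simp add: N_def)
    define F where "F n t = inverse (N n) * H (N n * t + 0)" for n t
    have smF: "smooth (F n)" for n
      unfolding F_def[abs_def] by (intro smooth_mult smooth_const smooth_compose[OF H(1)] smooth_affine)
    have "(F n has_real_derivative deriv H (N n * t)) (at t)" for n t
    proof -
      have "((\<lambda>t. H (N n * t + 0)) has_real_derivative deriv H (N n * t + 0) * N n) (at t)"
        by (rule DERIV_chain'[where f = "\<lambda>t. N n * t + 0"])
           (auto intro!: derivative_eq_intros smooth_real_derivative(1) H(1))
      from DERIV_cmult[OF this, of "inverse (N n)"]
      have "(F n has_real_derivative inverse (N n) * (deriv H (N n * t + 0) * N n)) (at t)"
        unfolding F_def[abs_def] .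
      moreover have "inverse (N n) * (deriv H (N n * t + 0) * N n) = deriv H (N n * t)"
        using N[of n] by (simp add: field_simps)
      ultimately show ?thesis by (simp only:)
    qed
    then have dF: "deriv (F n) t = deriv H (N n * t)" for n t by (rule DERIV_imp_deriv)
    have F0: "F n t = 0" "deriv (F n) t = 0" if "t \<ge> 0" for n t
      using that N[of n] by (auto simp: F_def dF H(2,5))
    have Fle: "\<bar>F n t\<bar> \<le> \<bar>t\<bar>" for n t
      using H(4)[of "N n * t"] N[of n] by (simp add: F_def abs_mult field_simps)
    have Flim: "\<forall>\<^sub>F n in sequentially. F n t = t \<and> deriv (F n) t = 1" if "t < 0" for t
    proof -
      obtain n0 where n0: "real n0 > 1 / (- t)" using reals_Archimedean2 by blast
      show ?thesis
      proof (rule eventually_sequentiallyI[of n0])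
        fix n assume "n0 \<le> n"
        then have "1 / (- t) < N n" using n0 by (simp add: N_def)
        then have "N n * t < - 1" using that by (simp add: field_simps)
        then show "F n t = t \<and> deriv (F n) t = 1" using N[of n] by (simp add: F_def dF H(3,6))
      qed
    qed
    have eq: "(LINT x|M. deriv (F n) (u x) * (\<eta> x * norm (g x) powr p))
        = lam * (LINT x|M. \<bar>u x\<bar> powr (p - 2) * u x * \<eta> x * F n (u x))" for n
    proof -
      have "(LINT x|M. norm (g x) powr (p - 2) * inner (g x) (grad \<eta> x) * F n (u x)
          + deriv (F n) (u x) * (\<eta> x * norm (g x) powr p))
        = lam * (LINT x|M. \<bar>u x\<bar> powr (p - 2) * u x * \<eta> x * F n (u x))"
        unfolding M_def
        by (rule weak_chain[OF \<eta>(1) compact_cbox box \<eta>(4) smF, where D = D]) (auto simp: dF H(7))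
      moreover have "inner (g x) (grad \<eta> x) * F n (u x) = 0" for x
        using grad0[of x] F0[of "u x" n] by (cases "u x \<le> 0") auto
      ultimately show ?thesis by (simp add: mult.assoc)
    qed
    have D: "0 \<le> D" using H(7)[of 0] by (meson abs_ge_zero order_trans)
    have "(\<lambda>n. LINT x|M. deriv (F n) (u x) * (\<eta> x * norm (g x) powr p)) \<longlonglongrightarrow> J"
      unfolding J_def
    proof (rule integral_dominated_convergence[where w = "\<lambda>x. D * norm (g x) powr p"])
      show "(\<lambda>x. deriv (F n) (u x) * (\<eta> x * norm (g x) powr p)) \<in> borel_measurable M" for n
        using borel_measurable_continuous_onI[OF smooth_real_derivative(2)[OF smF[of n]]] by measurable
      show "AE x in M. (\<lambda>n. deriv (F n) (u x) * (\<eta> x * norm (g x) powr p)) \<longlonglongrightarrow> (if u x < 0 then \<eta> x * norm (g x) powr p else 0)"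
      proof (rule AE_I2)
        fix x
        show "(\<lambda>n. deriv (F n) (u x) * (\<eta> x * norm (g x) powr p)) \<longlonglongrightarrow> (if u x < 0 then \<eta> x * norm (g x) powr p else 0)"
          using Flim[of "u x"] F0(2)[of "u x"]
          by (cases "u x < 0") (auto intro!: tendsto_eventually elim: eventually_mono)
      qed
      show "AE x in M. norm (deriv (F n) (u x) * (\<eta> x * norm (g x) powr p)) \<le> D * norm (g x) powr p" for n
      proof (rule AE_I2)
        fix x
        have "\<bar>deriv (F n) (u x)\<bar> * (\<eta> x * norm (g x) powr p) \<le> D * (1 * norm (g x) powr p)"
          using D \<eta>(2,3)[of x] by (intro mult_mono) (auto simp: dF H(7))
        then show "norm (deriv (F n) (u x) * (\<eta> x * norm (g x) powr p)) \<le> D * norm (g x) powr p"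
          using \<eta>(2)[of x] by (simp add: abs_mult)
      qed
    qed (use intJ int(2) in \<open>auto simp: M_def\<close>)
    moreover have "(\<lambda>n. LINT x|M. \<bar>u x\<bar> powr (p - 2) * u x * \<eta> x * F n (u x)) \<longlonglongrightarrow> I"
      unfolding I_def
    proof (rule integral_dominated_convergence[where w = "\<lambda>x. \<bar>u x\<bar> powr p"])
      have pw: "\<bar>t\<bar> powr (p - 2) * \<bar>t\<bar> * \<bar>t\<bar> = \<bar>t\<bar> powr p" for t :: real
        using powr_mult_self[of "\<bar>t\<bar>" "p - 1"] powr_mult_self[of "\<bar>t\<bar>" p] by simp
      show "(\<lambda>x. \<bar>u x\<bar> powr (p - 2) * u x * \<eta> x * F n (u x)) \<in> borel_measurable M" for n
        using borel_measurable_continuous_onI[OF smooth_continuous[OF smF[of n]]] by measurable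
      show "AE x in M. (\<lambda>n. \<bar>u x\<bar> powr (p - 2) * u x * \<eta> x * F n (u x)) \<longlonglongrightarrow> \<eta> x * neg x powr p"
      proof (rule AE_I2)
        fix x
        show "(\<lambda>n. \<bar>u x\<bar> powr (p - 2) * u x * \<eta> x * F n (u x)) \<longlonglongrightarrow> \<eta> x * neg x powr p"
        proof (cases "u x < 0")
          case True
          have *: "\<bar>u x\<bar> powr (p - 2) * u x * \<eta> x * u x = \<eta> x * neg x powr p"
            using pw[of "u x"] True by (simp add: neg_def mult_ac)
          have "\<forall>\<^sub>F n in sequentially. \<bar>u x\<bar> powr (p - 2) * u x * \<eta> x * F n (u x) = \<eta> x * neg x powr p"
            using Flim[OF True] by eventually_elim (simp only: *)
          then show ?thesis by (rule tendsto_eventually)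
        next
          case False
          then show ?thesis using F0(1)[of "u x"] p by (simp add: neg_def)
        qed
      qed
      show "AE x in M. norm (\<bar>u x\<bar> powr (p - 2) * u x * \<eta> x * F n (u x)) \<le> \<bar>u x\<bar> powr p" for n
      proof (rule AE_I2)
        fix x
        have "norm (\<bar>u x\<bar> powr (p - 2) * u x * \<eta> x * F n (u x)) = \<bar>u x\<bar> powr (p - 2) * \<bar>u x\<bar> * (\<eta> x * \<bar>F n (u x)\<bar>)"
          using \<eta>(2)[of x] by (simp add: abs_mult)
        also have "\<dots> \<le> \<bar>u x\<bar> powr (p - 2) * \<bar>u x\<bar> * (1 * \<bar>u x\<bar>)"
          using \<eta>(2,3)[of x] Fle by (intro mult_left_mono mult_mono) auto
        finally show "norm (\<bar>u x\<bar> powr (p - 2) * u x * \<eta> x * F n (u x)) \<le> \<bar>u x\<bar> powr p"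
          using pw[of "u x"] by simp
      qed
    qed (use intI int(1) in \<open>auto simp: M_def\<close>)
    ultimately show ?thesis
      unfolding eq using LIMSEQ_unique tendsto_mult_left by blast
  qed
  have "compact (u ` cbox c d)"
    using cont box by (meson compact_cbox compact_continuous_image continuous_on_subset)
  then have "bounded (u ` cbox c d)" by (rule compact_imp_bounded)
  then obtain m where m: "\<And>x. x \<in> cbox c d \<Longrightarrow> \<bar>u x\<bar> \<le> m"
    unfolding bounded_iff by fastforce
  have m0: "0 \<le> m" using m[OF x0] by linarith
  obtain G k D where G: "\<And>t. (G has_real_derivative k t) (at t)" "continuous_on UNIV k" "\<And>t. \<bar>k t\<bar> \<le> D"
    "\<And>t. t \<ge> 0 \<Longrightarrow> k t = 0" "\<And>t. t \<ge> 0 \<Longrightarrow> G t = 0"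
    "\<And>t. - m \<le> t \<Longrightarrow> t \<le> 0 \<Longrightarrow> k t = - p * (- t) powr (p - 1)"
    "\<And>t. - m \<le> t \<Longrightarrow> t \<le> 0 \<Longrightarrow> G t = (- t) powr p"
    by (rule truncated_power_primitive[OF p m0]) (rule that)
  obtain \<theta> q where \<theta>: "\<And>t. (\<theta> has_real_derivative q t) (at t)" "continuous_on UNIV q" "\<And>t. 0 \<le> q t"
    "\<And>t. t \<in> E2 \<Longrightarrow> q t = 1" "\<And>t. \<bar>\<theta> t\<bar> \<le> S"
    by (rule small_primitive[OF E(2) S(1)]) (rule that)
  define e2 where "e2 = (axis 2 1 :: real^2)"
  have e2: "inner e2 h = h $ 2" "inner h e2 = h $ 2" for h by (simp_all add: e2_def inner_axis inner_axis')
  \<comment> \<open>\<open>X\<close> is the gradient of \<open>\<eta> x * \<theta> (x $ 2)\<close>.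
    At points of the box with \<open>u < 0\<close> it reduces to \<open>e2\<close>, so the
    divergence identity isolates the p-th power of the negative part.\<close>
  define X where "X x = \<theta> (x$2) *\<^sub>R grad \<eta> x + (\<eta> x * q (x$2)) *\<^sub>R e2" for x
  have \<theta>comp: "((\<lambda>x::real^2. \<theta> (x$2)) has_derivative (\<lambda>h. q (x$2) * h $ 2)) (at x)" for x
    by (rule has_derivative_compose[OF _ \<theta>(1)[unfolded has_field_derivative_def]])
       (auto intro: bounded_linear_imp_has_derivative bounded_linear_vec_nth)
  have X: "((\<lambda>x. \<eta> x * \<theta> (x$2)) has_derivative inner (X x)) (at x)" for x
    by (rule has_derivative_eq_rhs[OF has_derivative_mult[OF smooth_grad[OF \<eta>(1)] \<theta>comp]])
       (auto simp: X_def inner_add_left e2 algebra_simps)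
  have contX: "continuous_on UNIV X"
  proof -
    have comp: "continuous_on UNIV (\<lambda>x::real^2. f (x$2))" if "continuous_on UNIV f" for f :: "real \<Rightarrow> real"
      by (rule continuous_on_compose2[OF that, of UNIV "\<lambda>x. x$2"]) (auto intro!: continuous_intros)
    have "continuous_on UNIV \<theta>" using \<theta>(1) by (meson DERIV_isCont continuous_at_imp_continuous_on)
    note * = comp[OF this] comp[OF \<theta>(2)] smooth_continuous[OF \<eta>(1)] smooth_continuous_grad[OF \<eta>(1)]
    show ?thesis unfolding X_def
      by (intro continuous_on_add continuous_on_scaleR continuous_on_mult continuous_on_const *)
  qed
  have "\<eta> x * \<theta> (x$2) = 0" if "x \<notin> cbox c d" for x using \<eta>(4)[OF that] by simp
  note div = integrable_divergence[OF X contX compact_cbox box this G(1-3), of e2]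
    divergence[OF X contX compact_cbox box this G(1-3), of e2]
  \<comment> \<open>\<open>2 powr (p - 1)\<close> is Young's constant for the weight
    \<open>1/2\<close>, which leaves half of \<open>I\<close>; \<open>S\<close> comes from the bound
    on \<open>\<theta>\<close> and \<open>p\<close> from \<open>k\<close>.\<close>
  define C where "C = 2 powr (p - 1) * (S * p) powr p"
  have S0: "0 \<le> S" using \<theta>(5)[of 0] by (meson abs_ge_zero order_trans)
  \<comment> \<open>The Poincare inequality in pointwise form: the term with \<open>g\<close> is
    split by Young's inequality. Away from the points of the box with \<open>u < 0\<close> every
    term is 0.\<close>
  have lower: "(1/2) * (\<eta> x * neg x powr p) - C * (if u x < 0 then \<eta> x * norm (g x) powr p else 0)
      \<le> inner (X x) e2 * G (u x) + k (u x) * (\<eta> x * \<theta> (x$2) * inner e2 (g x))" if "x \<in> \<Omega>" for x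
  proof (cases "x \<in> cbox c d \<and> u x < 0")
    case True
    then have x: "x \<in> cbox c d" "u x < 0" by auto
    have um: "- m \<le> u x" using m[OF x(1)] by linarith
    have [simp]: "\<eta> x = 1" "grad \<eta> x = 0" "q (x$2) = 1" "neg x = - u x"
      using \<eta>1 grad0 x sub[of x] \<theta>(4) by (auto simp: neg_def)
    have XG: "inner (X x) e2 * G (u x) = (- u x) powr p"
      using G(7) um x by (simp add: X_def e2) (simp add: e2_def)
    have "\<bar>k (u x) * (\<theta> (x$2) * (g x $ 2))\<bar> \<le> (p * (- u x) powr (p - 1)) * (S * norm (g x))"
      unfolding abs_mult using \<theta>(5) S0 G(6)[OF um] x p component_le_norm_cart[of "g x" 2]
      by (intro mult_mono) (auto simp: abs_mult)
    also have "\<dots> = (- u x) powr (p - 1) * (S * p * norm (g x))" by simp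
    also have "\<dots> \<le> (1/2) * (- u x) powr p + (1/2) powr (1 - p) * (S * p * norm (g x)) powr p"
      using x S0 p by (intro powr_young) auto
    also have "(1/2) powr (1 - p) * (S * p * norm (g x)) powr p = C * norm (g x) powr p"
    proof -
      have "(1/2) powr (1 - p) = 2 powr (p - 1)"
        using powr_powr[of 2 "- 1" "1 - p"] by (simp add: powr_neg_one)
      moreover have "(S * p * norm (g x)) powr p = (S * p) powr p * norm (g x) powr p"
        using S0 p by (intro powr_mult)
      ultimately show ?thesis by (simp add: C_def)
    qed
    finally show ?thesis using x XG by (simp add: e2)
  next
    case False
    then have "\<eta> x * neg x powr p = 0" "(if u x < 0 then \<eta> x * norm (g x) powr p else 0) = 0"
        "inner (X x) e2 * G (u x) = 0" "k (u x) * (\<eta> x * \<theta> (x$2) * inner e2 (g x)) = 0"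
      using p \<eta>(4)[of x] grad0[of x] G(4,5)[of "u x"] by (auto simp: neg_def X_def not_less)
    then show ?thesis by (simp only: mult_zero_right diff_self add_0 order_refl)
  qed
  have "(1/2) * I - C * J = (LINT x|M. (1/2) * (\<eta> x * neg x powr p) - C * (if u x < 0 then \<eta> x * norm (g x) powr p else 0))"
    unfolding I_def J_def using intI intJ by simp
  also have "\<dots> \<le> (LINT x|M. inner (X x) e2 * G (u x) + k (u x) * (\<eta> x * \<theta> (x$2) * inner e2 (g x)))"
    using intI intJ div(1) lower by (intro integral_mono) (auto simp: M_def)
  also have "\<dots> = 0" using div(2) by (simp add: M_def)
  finally have "(1/2) * I - C * J \<le> 0" .
  \<comment> \<open>With \<open>J = lam * I\<close> the estimate concerns \<open>I\<close> alone,
    and \<open>2 * C * lam\<close> is exactly the quantity assumed to be less than 1.\<close>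
  then have "(1 - 2 * C * lam) * I \<le> 0" unfolding JI by (simp add: algebra_simps)
  moreover have "2 * C * lam < 1"
  proof -
    have "2 powr p = 2 * 2 powr (p - 1)" using powr_mult_self[of 2 p] by simp
    then show ?thesis using S(2) by (simp add: C_def)
  qed
  ultimately have "I \<le> 0" by (simp add: mult_le_0_iff)
  moreover have nn: "0 \<le> \<eta> x * neg x powr p" for x using \<eta>(2) by simp
  ultimately have "I = 0" unfolding I_def by (intro antisym) auto
  then have "AE x in M. \<eta> x * neg x powr p = 0"
    unfolding I_def using integral_nonneg_eq_0_iff_AE[OF intI] nn by simp
  then have ae: "AE x in lebesgue. x \<in> \<Omega> \<longrightarrow> \<eta> x * neg x powr p = 0"
    unfolding M_def by (subst (asm) AE_restrict_space_iff) auto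
  \<comment> \<open>The integral sees \<open>u\<close> only almost everywhere; continuity spreads a
    negative value over an open set, which is not negligible.\<close>
  show "0 \<le> u x0"
  proof (rule ccontr)
    assume neg0: "\<not> 0 \<le> u x0"
    have "\<forall>\<^sub>F y in nhds x0. y \<in> cbox c d \<and> \<eta> y = 1" using near'[OF x0] neg0 by simp
    moreover have "\<forall>\<^sub>F y in nhds x0. u y < 0"
    proof -
      have "isCont u x0" using cont open_\<Omega> box x0 by (auto simp: continuous_on_eq_continuous_at)
      then have "\<forall>\<^sub>F y in at x0. u y < 0"
        using neg0 by (intro order_tendstoD(2)[of u "u x0"]) (auto simp: isCont_def)
      then show ?thesis using neg0 by (simp add: eventually_nhds_conv_at)
    qed
    ultimately have "\<forall>\<^sub>F y in nhds x0. y \<in> cbox c d \<and> \<eta> y = 1 \<and> u y < 0"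
      by eventually_elim auto
    then obtain U where U: "open U" "x0 \<in> U" "\<And>y. y \<in> U \<Longrightarrow> y \<in> cbox c d \<and> \<eta> y = 1 \<and> u y < 0"
      unfolding eventually_nhds by blast
    have "AE x in lebesgue. x \<notin> U"
      using ae
    proof eventually_elim
      case (elim y)
      show ?case
      proof
        assume "y \<in> U"
        then have "y \<in> \<Omega>" "\<eta> y * neg y powr p \<noteq> 0" using U(3)[of y] box by (auto simp: neg_def)
        then show False using elim by simp
      qed
    qed
    then have "U \<in> null_sets lebesgue" using U(1) by (subst AE_iff_null_sets) auto
    then have "negligible U" by (simp add: negligible_iff_null_sets)
    then show False using open_not_negligible[OF U(1)] U(2) by blast
  qed
qed

section \<open>Picone's inequality on a square\<close>

text \<open>\<open>weak_chain\<close> wants a function smooth on the whole line with bounded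
  derivative, but Picone's power is singular at \<open>- e\<close>. The rescaled shift, never below
  \<open>e / 2\<close>, repairs negative arguments, and \<open>u\<close> takes none on the
  square.\<close>

lemma smooth_picone_function:
  assumes p: "1 < p" and e: "0 < (e::real)"
  obtains F D where "smooth F" "\<And>t. t \<ge> 0 \<Longrightarrow> F t = (t + e) powr (1 - p)"
    "\<And>t. t \<ge> 0 \<Longrightarrow> deriv F t = (1 - p) * (t + e) powr (- p)" "\<And>t. \<bar>deriv F t\<bar> \<le> D"
proof -
  obtain h D where h: "smooth h" "\<And>t. t \<ge> 0 \<Longrightarrow> h t = 1 + t" "\<And>t. h t \<ge> 1 / 2"
    "\<And>t. t \<ge> 0 \<Longrightarrow> deriv h t = (1::real)" "\<And>t. \<bar>deriv h t\<bar> \<le> D"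
    by (rule smooth_shift) (rule that)
  define k where "k t = e * h (inverse e * t + 0)" for t
  have k_ge: "k t \<ge> e / 2" for t using h(3)[of "inverse e * t + 0"] e by (simp add: k_def)
  have k_pos: "k t > 0" for t using k_ge[of t] e by linarith
  have k_eq: "k t = t + e" if "t \<ge> 0" for t
    using that e by (simp add: k_def h(2) algebra_simps)
  have smk: "smooth k"
    unfolding k_def[abs_def] by (intro smooth_mult smooth_const smooth_compose[OF h(1)] smooth_affine)
  have "((\<lambda>t. h (inverse e * t + 0)) has_real_derivative deriv h (inverse e * t + 0) * inverse e) (at t)" for t
    by (rule DERIV_chain'[where f = "\<lambda>t. inverse e * t + 0"])
       (auto intro!: derivative_eq_intros smooth_real_derivative(1) h(1))
  from DERIV_cmult[OF this, of e]
  have dk: "(k has_real_derivative e * (deriv h (inverse e * t + 0) * inverse e)) (at t)" for t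
    unfolding k_def[abs_def] .
  have dk': "(k has_real_derivative deriv h (inverse e * t)) (at t)" for t
  proof -
    have "e * (deriv h (inverse e * t + 0) * inverse e) = deriv h (inverse e * t)"
      using e by (simp add: field_simps)
    then show ?thesis using dk[of t] by (simp only:)
  qed
  have "((\<lambda>t. k t powr (1 - p)) has_real_derivative (1 - p) * k t powr (1 - p - 1) * deriv h (inverse e * t)) (at t)" for t
    using DERIV_chain2[OF has_real_derivative_powr[OF k_pos, where r = "1 - p"] dk', of t] by simp
  then have d: "deriv (\<lambda>t. k t powr (1 - p)) t = (1 - p) * k t powr (- p) * deriv h (inverse e * t)" for t
    by (simp add: DERIV_imp_deriv)
  show ?thesis
  proof (rule that[of "\<lambda>t. k t powr (1 - p)" "(p - 1) * (e / 2) powr (- p) * D"])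
    show "smooth (\<lambda>t. k t powr (1 - p))" by (rule smooth_powr[OF smk k_pos])
    show "k t powr (1 - p) = (t + e) powr (1 - p)" if "t \<ge> 0" for t using that by (simp add: k_eq)
    show "deriv (\<lambda>t. k t powr (1 - p)) t = (1 - p) * (t + e) powr (- p)" if "t \<ge> 0" for t
      using that e by (simp add: d k_eq h(4))
    fix t
    have "k t powr (- p) \<le> (e / 2) powr (- p)"
      using k_ge[of t] e p by (intro powr_mono2') auto
    then show "\<bar>deriv (\<lambda>t. k t powr (1 - p)) t\<bar> \<le> (p - 1) * (e / 2) powr (- p) * D"
      unfolding d abs_mult using p h(5) by (intro mult_mono) auto
  qed
qed

text \<open>Each partial derivative of the product of two profiles keeps one undifferentiated
  factor. That factor lies between 0 and 1, hence below its own fractional power, so the bound by a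
  power of the profile passes to the product. Scaling to side \<open>R\<close> costs
  \<open>1 / R\<close>.\<close>

lemma square_cutoff:
  fixes c :: "real^2" and z :: "real \<Rightarrow> real"
  assumes p: "1 < p" and R: "0 < R"
    and z: "smooth z" "\<And>t. 0 \<le> z t" "\<And>t. z t \<le> 1"
    "\<And>t. 1/4 \<le> t \<Longrightarrow> t \<le> 3/4 \<Longrightarrow> z t = 1" "\<And>t. t \<notin> {1/8..7/8} \<Longrightarrow> z t = 0"
    "C > 0" "\<And>t. \<bar>deriv z t\<bar> \<le> C * z t powr ((p - 1) / p)"
  obtains \<zeta> where "smooth \<zeta>" "\<And>x. 0 \<le> \<zeta> x" "\<And>x. \<zeta> x \<le> 1"
    "\<And>x. x \<in> cbox (c + vec (R/4)) (c + vec (3*R/4)) \<Longrightarrow> \<zeta> x = 1"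
    "\<And>x. x \<notin> cbox (c + vec (R/8)) (c + vec (7*R/8)) \<Longrightarrow> \<zeta> x = 0"
    "\<And>x. norm (grad \<zeta> x) \<le> 2 * C / R * \<zeta> x powr ((p - 1) / p)"
    "\<And>x. \<bar>grad \<zeta> x $ 1\<bar> \<le> C / R"
proof -
  define \<kappa> where "\<kappa> = (p - 1) / p"
  have \<kappa>: "0 < \<kappa>" "\<kappa> \<le> 1" using p by (auto simp: \<kappa>_def)
  define w where "w i t = z (inverse R * t + (- (c $ i) / R))" for i t
  have w_eq: "w i t = z ((t - c $ i) / R)" for i t by (simp add: w_def divide_inverse algebra_simps)
  have smw: "smooth (w i)" for i
    unfolding w_def[abs_def] by (rule smooth_compose[OF z(1) smooth_affine])
  have "(w i has_real_derivative deriv z (inverse R * t + (- (c $ i) / R)) * inverse R) (at t)" for i t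
    unfolding w_def[abs_def]
    by (rule DERIV_chain'[where f = "\<lambda>t. inverse R * t + (- (c $ i) / R)"])
       (auto intro!: derivative_eq_intros smooth_real_derivative(1) z(1))
  then have dw: "deriv (w i) t = deriv z (inverse R * t + (- (c $ i) / R)) * inverse R" for i t
    by (rule DERIV_imp_deriv)
  have w01: "0 \<le> w i t" "w i t \<le> 1" for i t using z(2,3) by (auto simp: w_def)
  have dw_le: "\<bar>deriv (w i) t\<bar> \<le> C / R * w i t powr \<kappa>" for i t
    using z(7)[of "inverse R * t + (- (c $ i) / R)"] R
    by (simp add: dw abs_mult w_def \<kappa>_def divide_inverse_commute mult_ac mult_left_mono)
  have w_le: "w i t \<le> w i t powr \<kappa>" for i t
    using powr_mono'[of \<kappa> 1 "w i t"] \<kappa> w01[of i t] by (cases "w i t = 0") auto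
  have dcomp: "((\<lambda>x::real^2. w i (x$i)) has_derivative (\<lambda>h. deriv (w i) (x$i) * h $ i)) (at x)" for i x
    by (rule has_derivative_compose[OF _ smooth_real_derivative(1)[OF smw, unfolded has_field_derivative_def]])
       (auto intro: bounded_linear_imp_has_derivative bounded_linear_vec_nth)
  define \<zeta> where "\<zeta> x = w 1 (x$1) * w 2 (x$2)" for x :: "real^2"
  define D where "D x = (deriv (w 1) (x$1) * w 2 (x$2)) *\<^sub>R axis 1 1 + (w 1 (x$1) * deriv (w 2) (x$2)) *\<^sub>R (axis 2 1 :: real^2)" for x :: "real^2"
  have grad: "grad \<zeta> x = D x" for x
    unfolding \<zeta>_def[abs_def]
    by (rule grad_eqI, rule has_derivative_eq_rhs[OF has_derivative_mult[OF dcomp dcomp]])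
       (auto simp: D_def inner_add_left inner_axis' algebra_simps)
  have pw: "\<zeta> x powr \<kappa> = w 1 (x$1) powr \<kappa> * w 2 (x$2) powr \<kappa>" for x
    using w01 by (simp add: \<zeta>_def powr_mult)
  have part: "\<bar>deriv (w 1) (x$1) * w 2 (x$2)\<bar> \<le> C / R * \<zeta> x powr \<kappa>" "\<bar>w 1 (x$1) * deriv (w 2) (x$2)\<bar> \<le> C / R * \<zeta> x powr \<kappa>" for x
  proof -
    have "\<bar>deriv (w 1) (x$1)\<bar> * \<bar>w 2 (x$2)\<bar> \<le> (C / R * w 1 (x$1) powr \<kappa>) * w 2 (x$2) powr \<kappa>"
      using dw_le w_le[of 2] w01[of 2] R z(6) by (intro mult_mono) auto
    then show "\<bar>deriv (w 1) (x$1) * w 2 (x$2)\<bar> \<le> C / R * \<zeta> x powr \<kappa>" by (simp add: abs_mult pw mult_ac)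
    have "\<bar>w 1 (x$1)\<bar> * \<bar>deriv (w 2) (x$2)\<bar> \<le> w 1 (x$1) powr \<kappa> * (C / R * w 2 (x$2) powr \<kappa>)"
      using dw_le w_le[of 1] w01[of 1] R z(6) by (intro mult_mono) auto
    then show "\<bar>w 1 (x$1) * deriv (w 2) (x$2)\<bar> \<le> C / R * \<zeta> x powr \<kappa>" by (simp add: abs_mult pw mult_ac)
  qed
  have \<zeta>01: "0 \<le> \<zeta> x" "\<zeta> x \<le> 1" for x using w01 by (auto simp: \<zeta>_def mult_le_one)
  show ?thesis
  proof (rule that[of \<zeta>, OF _ \<zeta>01])
    show "smooth \<zeta>" unfolding \<zeta>_def[abs_def] by (intro smooth_mult smooth_component_compose smw)
    show "\<zeta> x = 1" if "x \<in> cbox (c + vec (R/4)) (c + vec (3*R/4))" for x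
    proof -
      have "z ((x$i - c$i) / R) = 1" for i
      proof (rule z(4))
        have "c$i + R/4 \<le> x$i" "x$i \<le> c$i + 3*R/4" using that by (auto simp: mem_box_cart)
        then show "1/4 \<le> (x$i - c$i) / R" "(x$i - c$i) / R \<le> 3/4" using R by (auto simp: field_simps)
      qed
      then show ?thesis by (simp add: \<zeta>_def w_eq)
    qed
    show "\<zeta> x = 0" if "x \<notin> cbox (c + vec (R/8)) (c + vec (7*R/8))" for x
    proof -
      have "(x$1 - c$1) / R \<notin> {1/8..7/8} \<or> (x$2 - c$2) / R \<notin> {1/8..7/8}"
        using that R by (auto simp: mem_box_cart forall_2 field_simps)
      then show ?thesis using z(5) by (auto simp: \<zeta>_def w_eq)
    qed
    show "norm (grad \<zeta> x) \<le> 2 * C / R * \<zeta> x powr ((p - 1) / p)" for x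
    proof -
      have "norm (D x) \<le> \<bar>deriv (w 1) (x$1) * w 2 (x$2)\<bar> + \<bar>w 1 (x$1) * deriv (w 2) (x$2)\<bar>"
        unfolding D_def by (rule order_trans[OF norm_triangle_ineq]) simp
      then show ?thesis using part[of x] by (simp add: grad \<kappa>_def)
    qed
    show "\<bar>grad \<zeta> x $ 1\<bar> \<le> C / R" for x
    proof -
      have "\<bar>grad \<zeta> x $ 1\<bar> \<le> C / R * \<zeta> x powr \<kappa>" using part(1)[of x] by (simp add: grad D_def axis_def)
      also have "\<dots> \<le> C / R * 1"
        using \<zeta>01[of x] \<kappa> R z(6) powr_mono2[of \<kappa> "\<zeta> x" 1] by (intro mult_left_mono) auto
      finally show ?thesis by simp
    qed
  qed
qed

lemma measure_square:
  fixes c :: "real^2"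
  assumes "a \<le> b"
  shows "measure lebesgue (cbox (c + vec a) (c + vec b)) = (b - a)\<^sup>2"
proof -
  have "cbox (c + vec a) (c + vec b) \<noteq> {}" using assms by (auto simp: interval_ne_empty_cart)
  then show ?thesis by (simp add: content_cbox_cart UNIV_2 power2_eq_square)
qed

text \<open>With \<open>a = G / (u + e) * \<zeta> powr (1 / p)\<close> the first term is at most
  \<open>a powr (p - 1) * A\<close>, and Young's inequality with weight \<open>p - 1\<close> cancels
  the second term exactly. The remaining bound involves neither \<open>u\<close> nor
  \<open>e\<close>, so \<open>e\<close> may tend to 0.\<close>

lemma picone_pointwise:
  fixes G Z \<zeta> u e p A :: real
  assumes "1 < p" "0 \<le> G" "0 \<le> \<zeta>" "0 \<le> u" "0 < e" "0 \<le> A"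
    and Z: "Z \<le> A * \<zeta> powr ((p - 1) / p)"
  shows "G powr (p - 1) * Z * (u + e) powr (1 - p) + (1 - p) * (u + e) powr (- p) * (\<zeta> * G powr p)
    \<le> (p - 1) powr (1 - p) * A powr p"
proof -
  define a where "a = G / (u + e) * \<zeta> powr (1 / p)"
  have a: "0 \<le> a" using assms by (simp add: a_def)
  have ap: "a powr q = G powr q * (u + e) powr (- q) * \<zeta> powr (q / p)" for q
    using assms by (simp add: a_def powr_mult powr_divide powr_powr powr_minus field_simps)
  have "G powr (p - 1) * Z * (u + e) powr (1 - p) \<le> G powr (p - 1) * (A * \<zeta> powr ((p - 1) / p)) * (u + e) powr (1 - p)"
    using Z by (intro mult_right_mono mult_left_mono) auto
  also have "\<dots> = a powr (p - 1) * A" by (simp add: ap)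
  also have "\<dots> \<le> (p - 1) * a powr p + (p - 1) powr (1 - p) * A powr p"
    using a assms by (intro powr_young) auto
  also have "a powr p = (u + e) powr (- p) * (\<zeta> * G powr p)" using assms by (simp add: ap)
  finally show ?thesis by (simp add: algebra_simps)
qed

text \<open>The test function is \<open>\<zeta> (u + e) powr (1 - p)\<close> with \<open>e\<close> tending to 0; on the right of the weak
  equation it leaves \<open>lam\<close> times the mass of \<open>\<zeta>\<close> on \<open>{u > 0}\<close>.\<close>
lemma positivity_set_small:
  fixes \<Omega> :: "(real^2) set"
  assumes eig: "p_eig \<Omega> p u g \<phi> lam" and lam: "0 < lam" and R: "0 < R"
    and box: "cbox (c + vec (R/8)) (c + vec (7*R/8)) \<subseteq> \<Omega>"
    and nonneg: "\<And>x. x \<in> cbox (c + vec (R/8)) (c + vec (7*R/8)) \<Longrightarrow> 0 \<le> u x"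
    and sub: "\<And>x. x \<in> cbox (c + vec (R/8)) (c + vec (7*R/8)) \<Longrightarrow> u x = 0 \<Longrightarrow> x $ 1 \<in> E"
    and E: "compact E" "measure lebesgue E < S"
    and z: "smooth z" "\<And>t. 0 \<le> z t" "\<And>t. z t \<le> 1"
    "\<And>t. 1/4 \<le> t \<Longrightarrow> t \<le> 3/4 \<Longrightarrow> z t = 1" "\<And>t. t \<notin> {1/8..7/8} \<Longrightarrow> z t = 0"
    "C > 0" "\<And>t. \<bar>deriv z t\<bar> \<le> C * z t powr ((p - 1) / p)"
  shows "lam * (R\<^sup>2 / 4 - S * C * R) \<le> (p - 1) powr (1 - p) * (2 * C / R) powr p * R\<^sup>2"
proof -
  interpret p_eig \<Omega> p u g \<phi> lam by fact
  define M where "M = lebesgue_on \<Omega>"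
  define K where "K = cbox (c + vec (R/8)) (c + vec (7*R/8))"
  have spM: "space M = \<Omega>" by (simp add: M_def)
  have KM: "K \<in> sets M" using box by (auto simp: M_def K_def sets_restrict_space_iff)
  have mK: "measure M K \<le> R\<^sup>2"
  proof -
    have "measure M K = measure lebesgue K"
      using box by (simp add: M_def K_def measure_restrict_space)
    also have "\<dots> = (3/4 * R)\<^sup>2" using measure_square[of "R/8" "7*R/8" c] R by (simp add: K_def field_simps)
    also have "\<dots> \<le> R\<^sup>2" using R by (intro power_mono) auto
    finally show ?thesis .
  qed
  interpret fin: finite_measure M unfolding M_def by (rule finite_measure_axioms)
  have intK: "integrable M (\<lambda>x. B * indicator K x)" "(LINT x|M. B * indicator K x) = B * measure M K" for B :: real
    using KM by (auto simp: fin.emeasure_finite less_top[symmetric])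
  obtain \<zeta> where \<zeta>: "smooth \<zeta>" "\<And>x. 0 \<le> \<zeta> x" "\<And>x. \<zeta> x \<le> 1"
    "\<And>x. x \<in> cbox (c + vec (R/4)) (c + vec (3*R/4)) \<Longrightarrow> \<zeta> x = 1"
    "\<And>x. x \<notin> cbox (c + vec (R/8)) (c + vec (7*R/8)) \<Longrightarrow> \<zeta> x = 0"
    "\<And>x. norm (grad \<zeta> x) \<le> 2 * C / R * \<zeta> x powr ((p - 1) / p)"
    "\<And>x. \<bar>grad \<zeta> x $ 1\<bar> \<le> C / R"
    by (rule square_cutoff[where c = c, OF p R z]; (assumption | rule that))
  have grad0: "grad \<zeta> x = 0" if "x \<notin> K" for x
    using \<zeta>(6)[of x] \<zeta>(5)[of x] that p by (simp add: K_def)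
  have [measurable]: "\<zeta> \<in> borel_measurable M" "u \<in> borel_measurable M" "g \<in> borel_measurable M" "K \<in> sets M"
    using smooth_continuous[OF \<zeta>(1)] meas KM by (auto simp: M_def intro!: continuous_lebesgue_on)
  define Q where "Q = (p - 1) powr (1 - p) * (2 * C / R) powr p"
  have Q0: "0 \<le> Q" by (simp add: Q_def)
  \<comment> \<open>\<open>P\<close> is squeezed: the weak equation bounds \<open>lam * P\<close>
    from above, and the small projection \<open>E\<close> of the zero set bounds \<open>P\<close>
    from below.\<close>
  define P where "P = (LINT x|M. (if u x > 0 then \<zeta> x else 0))"
  have int\<zeta>: "integrable M \<zeta>"
    by (rule fin.integrable_const_bound[of _ 1]) (use \<zeta>(2,3) in auto)
  have intP: "integrable M (\<lambda>x. if u x > 0 then \<zeta> x else 0)"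
    by (rule fin.integrable_const_bound[of _ 1]) (use \<zeta>(2,3) in auto)
  have "lam * P \<le> Q * R\<^sup>2"
  proof -
    define e where "e n = inverse (real (Suc n))" for n
    have e: "0 < e n" "e \<longlonglongrightarrow> 0" for n
      using LIMSEQ_inverse_real_of_nat by (auto simp: e_def[abs_def])
    have "\<exists>F D. smooth F \<and> (\<forall>t\<ge>0. F t = (t + e n) powr (1 - p))
        \<and> (\<forall>t\<ge>0. deriv F t = (1 - p) * (t + e n) powr (- p)) \<and> (\<forall>t. \<bar>deriv F t\<bar> \<le> D)" for n
      by (rule smooth_picone_function[OF p e(1)[of n]]) blast
    then obtain F D where F: "\<And>n. smooth (F n)" "\<And>n t. t \<ge> 0 \<Longrightarrow> F n t = (t + e n) powr (1 - p)"
      "\<And>n t. t \<ge> 0 \<Longrightarrow> deriv (F n) t = (1 - p) * (t + e n) powr (- p)" "\<And>n t. \<bar>deriv (F n) t\<bar> \<le> D n"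
      by metis
    define I where "I n x = \<bar>u x\<bar> powr (p - 2) * u x * \<zeta> x * F n (u x)" for n x
    \<comment> \<open>The factor \<open>u / (u + e n)\<close> tends to 1 where \<open>u > 0\<close>
      and is 0 at the zeros, so the limit counts just the positivity set.\<close>
    have I_eq: "I n x = (if x \<in> K then (u x / (u x + e n)) powr (p - 1) * \<zeta> x else 0)" for n x
    proof (cases "x \<in> K")
      case True
      then have u: "0 \<le> u x" using nonneg by (simp add: K_def)
      have "u x powr (p - 2) * u x = u x powr (p - 1)"
        using powr_mult_self[OF u, of "p - 1"] by simp
      moreover have "(u x / (u x + e n)) powr (p - 1) = u x powr (p - 1) * (u x + e n) powr (1 - p)"
        using u e(1)[of n] powr_minus[of "u x + e n" "p - 1"] by (simp add: powr_divide field_simps)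
      ultimately show ?thesis using True u by (simp add: I_def F(2))
    qed (simp add: I_def \<zeta>(5) K_def)
    have I01: "0 \<le> I n x" "I n x \<le> 1" for n x
    proof -
      have "(u x / (u x + e n)) powr (p - 1) \<le> 1 powr (p - 1)" if "x \<in> K"
        using that nonneg[of x] e(1)[of n] p by (intro powr_mono2) (auto simp: K_def)
      then show "0 \<le> I n x" "I n x \<le> 1" using \<zeta>(2,3)[of x] by (auto simp: I_eq intro!: mult_le_one)
    qed
    have "lam * (LINT x|M. I n x) \<le> Q * R\<^sup>2" for n
    proof -
      define L where "L x = norm (g x) powr (p - 2) * inner (g x) (grad \<zeta> x) * F n (u x)
          + deriv (F n) (u x) * (\<zeta> x * norm (g x) powr p)" for x
      note args = \<zeta>(1) compact_cbox box \<zeta>(5) F(1)[of n] F(4)[of n]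
      have "(LINT x|M. L x) = lam * (LINT x|M. I n x)"
        unfolding L_def I_def M_def by (rule weak_chain[OF args])
      moreover have "integrable M L"
        unfolding L_def M_def by (rule integrable_weak_lhs[OF args])
      then have "(LINT x|M. L x) \<le> (LINT x|M. Q * indicator K x)"
      proof (rule integral_mono[OF _ intK(1)])
        fix x
        show "L x \<le> Q * indicator K x"
        proof (cases "x \<in> K")
          case True
          then have u: "0 \<le> u x" using nonneg by (simp add: K_def)
          have "norm (g x) powr (p - 2) * inner (g x) (grad \<zeta> x) \<le> norm (g x) powr (p - 2) * (norm (g x) * norm (grad \<zeta> x))"
            by (intro mult_left_mono norm_cauchy_schwarz) auto
          also have "\<dots> = norm (g x) powr (p - 1) * norm (grad \<zeta> x)"
            using powr_mult_self[of "norm (g x)" "p - 1"] by (simp add: mult.assoc[symmetric])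
          finally have "L x \<le> norm (g x) powr (p - 1) * norm (grad \<zeta> x) * (u x + e n) powr (1 - p)
              + (1 - p) * (u x + e n) powr (- p) * (\<zeta> x * norm (g x) powr p)"
            unfolding L_def F(2)[OF u] F(3)[OF u] using \<zeta>(2)[of x] by (intro add_mono mult_right_mono) auto
          also have "\<dots> \<le> Q"
            unfolding Q_def using p u e(1) z(6) R \<zeta>(2,6) by (intro picone_pointwise) auto
          finally show ?thesis using True by simp
        next
          case False
          then show ?thesis using \<zeta>(5)[of x] grad0[of x] by (simp add: L_def K_def)
        qed
      qed
      ultimately show ?thesis using intK(2)[of Q] mult_left_mono[OF mK Q0] by simp
    qed
    moreover have "(\<lambda>n. LINT x|M. I n x) \<longlonglongrightarrow> P"
      unfolding P_def
    proof (rule integral_dominated_convergence[where w = "\<lambda>x. 1"])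
      show "I n \<in> borel_measurable M" for n
        unfolding I_eq[abs_def] by measurable
      show "AE x in M. (\<lambda>n. I n x) \<longlonglongrightarrow> (if 0 < u x then \<zeta> x else 0)"
      proof (rule AE_I2)
        fix x
        show "(\<lambda>n. I n x) \<longlonglongrightarrow> (if 0 < u x then \<zeta> x else 0)"
        proof (cases "x \<in> K \<and> 0 < u x")
          case True
          then have "(\<lambda>n. (u x / (u x + e n)) powr (p - 1) * \<zeta> x) \<longlonglongrightarrow> (u x / (u x + 0)) powr (p - 1) * \<zeta> x"
            by (intro tendsto_intros e(2)) auto
          then show ?thesis using True by (simp add: I_eq)
        next
          case False
          then have "I n x = 0" for n using nonneg[of x] p by (auto simp: I_eq K_def)
          moreover have "0 < u x \<Longrightarrow> \<zeta> x = 0" using False \<zeta>(5)[of x] by (auto simp: K_def)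
          ultimately show ?thesis by simp
        qed
      qed
      show "AE x in M. norm (I n x) \<le> 1" for n using I01 by simp
    qed (use intP in auto)
    ultimately show ?thesis
      by (intro LIMSEQ_le_const2[OF tendsto_mult_left]) auto
  qed
  moreover have "R\<^sup>2 / 4 - S * C * R \<le> P"
  proof -
    obtain \<theta> q where \<theta>: "\<And>t. (\<theta> has_real_derivative q t) (at t)" "continuous_on UNIV q" "\<And>t. 0 \<le> q t"
      "\<And>t. t \<in> E \<Longrightarrow> q t = 1" "\<And>t. \<bar>\<theta> t\<bar> \<le> S"
      by (rule small_primitive[OF E]) (rule that)
    define e1 where "e1 = (axis 1 1 :: real^2)"
    have e1: "inner e1 h = h $ 1" "inner h e1 = h $ 1" for h by (simp_all add: e1_def inner_axis inner_axis')
    define X where "X x = \<theta> (x$1) *\<^sub>R grad \<zeta> x + (\<zeta> x * q (x$1)) *\<^sub>R e1" for x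
    have \<theta>comp: "((\<lambda>x::real^2. \<theta> (x$1)) has_derivative (\<lambda>h. q (x$1) * h $ 1)) (at x)" for x
      by (rule has_derivative_compose[OF _ \<theta>(1)[unfolded has_field_derivative_def]])
         (auto intro: bounded_linear_imp_has_derivative bounded_linear_vec_nth)
    have X: "((\<lambda>x. \<zeta> x * \<theta> (x$1)) has_derivative inner (X x)) (at x)" for x
      by (rule has_derivative_eq_rhs[OF has_derivative_mult[OF smooth_grad[OF \<zeta>(1)] \<theta>comp]])
         (auto simp: X_def inner_add_left e1 algebra_simps)
    have contX: "continuous_on UNIV X"
    proof -
      have comp: "continuous_on UNIV (\<lambda>x::real^2. f (x$1))" if "continuous_on UNIV f" for f :: "real \<Rightarrow> real"
        by (rule continuous_on_compose2[OF that, of UNIV "\<lambda>x. x$1"]) (auto intro!: continuous_intros)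
      have "continuous_on UNIV \<theta>" using \<theta>(1) by (meson DERIV_isCont continuous_at_imp_continuous_on)
      note * = comp[OF this] comp[OF \<theta>(2)] smooth_continuous[OF \<zeta>(1)] smooth_continuous_grad[OF \<zeta>(1)]
      show ?thesis unfolding X_def
        by (intro continuous_on_add continuous_on_scaleR continuous_on_mult continuous_on_const *)
    qed
    have supp: "\<zeta> x * \<theta> (x$1) = 0" if "x \<notin> cbox (c + vec (R/8)) (c + vec (7*R/8))" for x
      using \<zeta>(5)[OF that] by simp
    \<comment> \<open>The constant function 1 as \<open>G\<close> reduces the identity to the
      divergence theorem for \<open>\<zeta> x * \<theta> (x $ 1)\<close>.\<close>
    have const: "((\<lambda>t. 1) has_real_derivative 0) (at t)" "continuous_on UNIV (\<lambda>t::real. 0::real)" "\<bar>0::real\<bar> \<le> 0" for t :: real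
      by auto
    have div: "integrable M (\<lambda>x. inner (X x) e1)" "(LINT x|M. inner (X x) e1) = 0"
      using integrable_divergence[OF X contX compact_cbox box supp const, of e1]
        divergence[OF X contX compact_cbox box supp const, of e1] by (simp_all add: M_def)
    define B where "B = S * (C / R)"
    have S0: "0 \<le> S" using \<theta>(5)[of 0] by (meson abs_ge_zero order_trans)
    \<comment> \<open>What \<open>P\<close> misses of the mass of \<open>\<zeta>\<close> lies on the
      zeros of \<open>u\<close>, where \<open>q = 1\<close>; the divergence pays for it up to the
      \<open>grad \<zeta>\<close> term, which \<open>B\<close> bounds.\<close>
    have le: "indicator (cbox (c + vec (R/4)) (c + vec (3*R/4))) x - (if u x > 0 then \<zeta> x else 0)
        \<le> inner (X x) e1 + B * indicator K x" for x
    proof (cases "x \<in> K")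
      case True
      have "\<bar>\<theta> (x$1) * grad \<zeta> x $ 1\<bar> \<le> B"
        unfolding B_def abs_mult using \<theta>(5) \<zeta>(7) S0 by (intro mult_mono) auto
      then have 1: "\<zeta> x * q (x$1) \<le> inner (X x) e1 + B"
      proof -
        have "e1 $ 1 = 1" by (simp add: e1_def axis_def)
        then have "inner (X x) e1 = \<theta> (x$1) * grad \<zeta> x $ 1 + \<zeta> x * q (x$1)"
          by (simp add: X_def e1)
        then show ?thesis using \<open>\<bar>\<theta> (x$1) * grad \<zeta> x $ 1\<bar> \<le> B\<close> by linarith
      qed
      have "indicator (cbox (c + vec (R/4)) (c + vec (3*R/4))) x \<le> \<zeta> x"
        using \<zeta>(2)[of x] \<zeta>(4)[of x] by (auto simp: indicator_def)
      moreover have "\<zeta> x - (if u x > 0 then \<zeta> x else 0) \<le> \<zeta> x * q (x$1)"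
      proof (cases "u x > 0")
        case False
        then have "u x = 0" using nonneg[of x] True by (simp add: K_def)
        then have "q (x$1) = 1" using sub[of x] True \<theta>(4) by (simp add: K_def)
        then show ?thesis using False by simp
      qed (use \<zeta>(2)[of x] \<theta>(3)[of "x$1"] in simp)
      ultimately show ?thesis using True 1 by simp
    next
      case False
      then have "x \<notin> cbox (c + vec (R/4)) (c + vec (3*R/4))"
        using R by (auto simp: K_def mem_box_cart forall_2)
      then show ?thesis using False \<zeta>(5)[of x] grad0[of x] by (simp add: X_def K_def)
    qed
    have sq: "cbox (c + vec (R/4)) (c + vec (3*R/4)) \<subseteq> K"
      using R by (auto simp: K_def mem_box_cart forall_2)
    have sqM: "cbox (c + vec (R/4)) (c + vec (3*R/4)) \<in> sets M"
      using box sq by (auto simp: M_def K_def sets_restrict_space_iff)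
    have "measure M (cbox (c + vec (R/4)) (c + vec (3*R/4))) = (R / 2)\<^sup>2"
      using box sq measure_square[of "R/4" "3*R/4" c] R by (simp add: M_def K_def measure_restrict_space)
    moreover have int_sq: "integrable M (indicat_real (cbox (c + vec (R/4)) (c + vec (3*R/4))))"
      using sqM by (auto simp: fin.emeasure_finite less_top[symmetric])
    ultimately have "R\<^sup>2 / 4 - P = (LINT x|M. indicator (cbox (c + vec (R/4)) (c + vec (3*R/4))) x - (if u x > 0 then \<zeta> x else 0))"
      using intP sqM by (simp add: P_def power2_eq_square)
    also have "\<dots> \<le> (LINT x|M. inner (X x) e1 + B * indicator K x)"
      by (intro integral_mono Bochner_Integration.integrable_diff Bochner_Integration.integrable_add intP intK int_sq div le)
    also have "\<dots> = B * measure M K" using div intK by simp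
    also have "\<dots> \<le> B * R\<^sup>2" using mK S0 z(6) R by (intro mult_left_mono) (auto simp: B_def)
    also have "\<dots> = S * C * R" using R by (simp add: B_def power2_eq_square)
    finally show ?thesis by simp
  qed
  ultimately show ?thesis
    unfolding Q_def using lam by (meson mult_left_mono less_imp_le order_trans)
qed

section \<open>Projections of the nodal set and the grid of squares\<close>

lemma ex_outside_small_set:
  fixes E :: "real set"
  assumes "compact E" "measure lebesgue E < b - a"
  obtains t where "a < t" "t < b" "t \<notin> E"
proof -
  have "\<not> {a<..<b} \<subseteq> E"
  proof
    assume "{a<..<b} \<subseteq> E"
    then have "measure lebesgue {a<..<b} \<le> measure lebesgue E"
      using assms(1) by (intro measure_mono_fmeasurable) (auto intro: lmeasurable_compact)
    then show False using assms(2) measure_nonneg[of lebesgue E] by (cases "a \<le> b") auto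
  qed
  then obtain t where "t \<in> {a<..<b}" "t \<notin> E" by blast
  then show ?thesis using that[of t] by simp
qed

lemma no_small_nodal_projections:
  fixes \<Omega> :: "(real^2) set"
  assumes eig: "p_eig \<Omega> p u g \<phi> lam" and lam: "0 < lam" and R: "0 < R"
    and box: "cbox c (c + vec R) \<subseteq> \<Omega>" and cont: "continuous_on \<Omega> u"
    and E: "compact E1" "compact E2" "measure lebesgue E1 < \<epsilon> * R" "measure lebesgue E2 < \<epsilon> * R"
    and sub: "\<And>x. x \<in> cbox c (c + vec R) \<Longrightarrow> u x \<le> 0 \<Longrightarrow> x $ 1 \<in> E1 \<and> x $ 2 \<in> E2"
    and z: "smooth z" "\<And>t. 0 \<le> z t" "\<And>t. z t \<le> 1"
    "\<And>t. 1/4 \<le> t \<Longrightarrow> t \<le> 3/4 \<Longrightarrow> z t = 1" "\<And>t. t \<notin> {1/8..7/8} \<Longrightarrow> z t = 0"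
    "C > 0" "\<And>t. \<bar>deriv z t\<bar> \<le> C * z t powr ((p - 1) / p)"
    and \<epsilon>: "\<epsilon> \<le> 1/8" "\<epsilon> * C \<le> 1/8" "\<epsilon> * (8 * p * K) \<le> 1"
    and K: "0 < K" "8 * ((p - 1) powr (1 - p) * (2 * C) powr p) < K powr p"
    and scale: "K \<le> R * lam powr (1 / p)" "R * lam powr (1 / p) \<le> 2 * K"
  shows False
proof -
  interpret p_eig \<Omega> p u g \<phi> lam by fact
  define l where "l = lam powr (1 / p)"
  have l: "0 < l" "lam = l powr p" using lam p by (auto simp: l_def powr_powr)
  have \<epsilon>R: "0 < \<epsilon> * R" using E(3) by (meson measure_nonneg order_le_less_trans)
  then have \<epsilon>0: "0 < \<epsilon>" using R by (simp add: zero_less_mult_iff)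
  have \<epsilon>8: "\<epsilon> * R \<le> R / 8" using mult_right_mono[OF \<epsilon>(1), of R] R by simp
  \<comment> \<open>The rim between the square and its concentric copy has width
    \<open>R / 8\<close>, more than the measure of either projection. So an intermediate box has its
    sides off \<open>E1\<close> and \<open>E2\<close>, as the vanishing of the negative part
    requires; Picone's argument then runs on the inner copy.\<close>
  obtain x0 where x0: "c$1 < x0" "x0 < c$1 + R/8" "x0 \<notin> E1"
    using ex_outside_small_set[OF E(1), of "c$1 + R/8" "c$1"] E(3) \<epsilon>8 by auto
  obtain x1 where x1: "c$1 + 7*R/8 < x1" "x1 < c$1 + R" "x1 \<notin> E1"
    using ex_outside_small_set[OF E(1), of "c$1 + R" "c$1 + 7*R/8"] E(3) \<epsilon>8 by auto
  obtain y0 where y0: "c$2 < y0" "y0 < c$2 + R/8" "y0 \<notin> E2"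
    using ex_outside_small_set[OF E(2), of "c$2 + R/8" "c$2"] E(4) \<epsilon>8 by auto
  obtain y1 where y1: "c$2 + 7*R/8 < y1" "y1 < c$2 + R" "y1 \<notin> E2"
    using ex_outside_small_set[OF E(2), of "c$2 + R" "c$2 + 7*R/8"] E(4) \<epsilon>8 by auto
  define a b where "a = (vector [x0, y0] :: real^2)" and "b = (vector [x1, y1] :: real^2)"
  have ab: "a$1 = x0" "a$2 = y0" "b$1 = x1" "b$2 = y1" by (simp_all add: a_def b_def)
  have sub1: "cbox a b \<subseteq> cbox c (c + vec R)"
    using x0 x1 y0 y1 by (auto simp: mem_box_cart forall_2 ab)
  have sub2: "cbox (c + vec (R/8)) (c + vec (7*R/8)) \<subseteq> cbox a b"
    using x0 x1 y0 y1 by (auto simp: mem_box_cart forall_2 ab)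
  \<comment> \<open>The upper bound on \<open>R * lam powr (1 / p)\<close> enters here: the p-th
    root of the left side is at most \<open>4 * \<epsilon> * p * K\<close>, hence at most
    \<open>1 / 2\<close>.\<close>
  have strip: "2 powr p * (\<epsilon> * R * p) powr p * lam < 1"
  proof -
    have "2 * (\<epsilon> * R * p) * l = 2 * \<epsilon> * p * (R * l)" by simp
    also have "\<dots> \<le> 2 * \<epsilon> * p * (2 * K)"
      using scale(2) \<epsilon>0 p by (intro mult_left_mono) (auto simp: l_def)
    also have "\<dots> < 1" using \<epsilon>(3) by (simp add: mult_ac)
    finally have "(2 * (\<epsilon> * R * p) * l) powr p < 1 powr p"
      using \<epsilon>R p l(1) by (intro powr_less_mono2) auto
    then show ?thesis using \<epsilon>R p l by (simp add: powr_mult)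
  qed
  have nonneg: "0 \<le> u x" if "x \<in> cbox a b" for x
    by (rule nonneg_if_small_nodal[OF eig _ cont compact_imp_closed[OF E(1)] E(2) _ _ _ _ _ E(4) strip that])
       (use box sub1 sub x0 x1 y0 y1 in \<open>auto simp: ab\<close>)
  have "lam * (R\<^sup>2 / 4 - \<epsilon> * R * C * R) \<le> (p - 1) powr (1 - p) * (2 * C / R) powr p * R\<^sup>2"
  proof (rule positivity_set_small[OF eig lam R _ _ _ E(1,3) z])
    show "cbox (c + vec (R/8)) (c + vec (7*R/8)) \<subseteq> \<Omega>" using box sub1 sub2 by blast
    show "0 \<le> u x" if "x \<in> cbox (c + vec (R/8)) (c + vec (7*R/8))" for x using that sub2 nonneg by blast
    show "x $ 1 \<in> E1" if "x \<in> cbox (c + vec (R/8)) (c + vec (7*R/8))" "u x = 0" for x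
      using that sub1 sub2 sub[of x] by auto
  qed
  \<comment> \<open>Discarding the zero set costs at most half of the area of the central square of
    side \<open>R / 2\<close>.\<close>
  moreover have "R\<^sup>2 / 8 \<le> R\<^sup>2 / 4 - \<epsilon> * R * C * R"
    using mult_right_mono[OF \<epsilon>(2), of "R\<^sup>2"] by (simp add: power2_eq_square mult_ac)
  ultimately have "lam * (R\<^sup>2 / 8) \<le> (p - 1) powr (1 - p) * (2 * C / R) powr p * R\<^sup>2"
    using lam by (meson mult_left_mono less_imp_le order_trans)
  then have "lam \<le> 8 * ((p - 1) powr (1 - p) * (2 * C / R) powr p)"
    using R by (simp add: field_simps)
  also have "\<dots> = 8 * ((p - 1) powr (1 - p) * (2 * C) powr p) / R powr p"
    using R z(6) by (simp add: powr_divide)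
  finally have "R powr p * lam \<le> 8 * ((p - 1) powr (1 - p) * (2 * C) powr p)"
    using R by (simp add: field_simps)
  moreover have "K powr p \<le> R powr p * lam"
  proof -
    have "K powr p \<le> (R * l) powr p"
      using scale(1)[folded l_def] K(1) p by (intro powr_mono2) auto
    then show ?thesis using R l by (simp add: powr_mult)
  qed
  ultimately show False using K(2) by simp
qed

lemma pos_if_no_zero:
  fixes u :: "'a::topological_space \<Rightarrow> real"
  assumes "continuous_on S u" "connected S" "\<And>x. x \<in> S \<Longrightarrow> u x \<noteq> 0" "a \<in> S" "b \<in> S" "0 < u a"
  shows "0 < u b"
proof (rule ccontr)
  assume "\<not> 0 < u b"
  then have "0 \<in> u ` S"
    using connectedD_interval[OF connected_continuous_image[OF assms(1,2)], of "u b" "u a" 0] assms by auto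
  then show False using assms(3) by auto
qed

text \<open>If \<open>x $ 1\<close> is off \<open>E1\<close>, the horizontal line through
  \<open>a\<close> followed by the vertical line through \<open>x\<close> meets no zero and carries
  the sign from \<open>a\<close> to \<open>x\<close>; if \<open>x $ 2\<close> is off
  \<open>E2\<close>, the directions are exchanged.\<close>

lemma nonpos_in_projections:
  fixes u :: "real^2 \<Rightarrow> real"
  assumes cont: "continuous_on (cbox c d) u"
    and zero: "\<And>x. x \<in> cbox c d \<Longrightarrow> u x = 0 \<Longrightarrow> x $ 1 \<in> E1 \<and> x $ 2 \<in> E2"
    and a: "a \<in> cbox c d" "a $ 1 \<notin> E1" "a $ 2 \<notin> E2" "0 < u a"
    and x: "x \<in> cbox c d" "u x \<le> 0"
  shows "x $ 1 \<in> E1 \<and> x $ 2 \<in> E2"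
proof -
  have vert: "0 < u w" if "v \<in> cbox c d" "w \<in> cbox c d" "v $ 1 = w $ 1" "v $ 1 \<notin> E1" "0 < u v" for v w
  proof (rule pos_if_no_zero[where S = "cbox (vector [v$1, c$2]) (vector [v$1, d$2])" and a = v])
    let ?S = "cbox (vector [v$1, c$2]) (vector [v$1, d$2]) :: (real^2) set"
    show "connected ?S" by (simp add: convex_connected)
    have S: "?S \<subseteq> cbox c d" using that(1) by (auto simp: mem_box_cart forall_2)
    show "continuous_on ?S u" by (rule continuous_on_subset[OF cont S])
    show "u y \<noteq> 0" if "y \<in> ?S" for y
      using that zero[of y] S \<open>v $ 1 \<notin> E1\<close> by (auto simp: mem_box_cart forall_2 subset_iff)
  qed (use that in \<open>auto simp: mem_box_cart forall_2\<close>)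
  have horiz: "0 < u w" if "v \<in> cbox c d" "w \<in> cbox c d" "v $ 2 = w $ 2" "v $ 2 \<notin> E2" "0 < u v" for v w
  proof (rule pos_if_no_zero[where S = "cbox (vector [c$1, v$2]) (vector [d$1, v$2])" and a = v])
    let ?S = "cbox (vector [c$1, v$2]) (vector [d$1, v$2]) :: (real^2) set"
    show "connected ?S" by (simp add: convex_connected)
    have S: "?S \<subseteq> cbox c d" using that(1) by (auto simp: mem_box_cart forall_2)
    show "continuous_on ?S u" by (rule continuous_on_subset[OF cont S])
    show "u y \<noteq> 0" if "y \<in> ?S" for y
      using that zero[of y] S \<open>v $ 2 \<notin> E2\<close> by (auto simp: mem_box_cart forall_2 subset_iff)
  qed (use that in \<open>auto simp: mem_box_cart forall_2\<close>)
  define v w where "v = (vector [x$1, a$2] :: real^2)" and "w = (vector [a$1, x$2] :: real^2)"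
  have vw: "v \<in> cbox c d" "w \<in> cbox c d" "v$1 = x$1" "v$2 = a$2" "w$1 = a$1" "w$2 = x$2"
    using x(1) a(1) by (auto simp: v_def w_def mem_box_cart forall_2)
  have "0 < u v" "0 < u w" using horiz[of a v] vert[of a w] a vw by auto
  then show ?thesis using vert[of v x] horiz[of w x] x vw by force
qed

text \<open>Only \<open>p\<close> determines the constants, through the profile \<open>z\<close>,
  because the estimates see \<open>R\<close> and \<open>lam\<close> only as
  \<open>R * lam powr (1 / p)\<close>. Which of the two projections is large may change from square
  to square.\<close>

lemma nodal_projection_constants:
  assumes p: "1 < p"
  obtains K \<epsilon> where "0 < K" "0 < \<epsilon>"
    "\<And>(\<Omega> :: (real^2) set) u lam c R. open \<Omega> \<Longrightarrow> bounded \<Omega> \<Longrightarrow> p_eigenfunction p \<Omega> lam u \<Longrightarrow> continuous_on \<Omega> u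
      \<Longrightarrow> 0 < lam \<Longrightarrow> 0 < R \<Longrightarrow> cbox c (c + vec R) \<subseteq> \<Omega>
      \<Longrightarrow> K \<le> R * lam powr (1 / p) \<Longrightarrow> R * lam powr (1 / p) \<le> 2 * K
      \<Longrightarrow> \<exists>i. (\<lambda>x. x $ i) ` (nodal_set \<Omega> u \<inter> cbox c (c + vec R)) \<in> lmeasurable
            \<and> \<epsilon> * R \<le> measure lebesgue ((\<lambda>x. x $ i) ` (nodal_set \<Omega> u \<inter> cbox c (c + vec R)))"
proof -
  obtain z C where z: "smooth z" "\<And>t. 0 \<le> z t" "\<And>t. z t \<le> 1"
    "\<And>t. 1/4 \<le> t \<Longrightarrow> t \<le> 3/4 \<Longrightarrow> z t = 1" "\<And>t. t \<notin> {1/8..7/8} \<Longrightarrow> z t = 0"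
    "C > 0" "\<And>t. \<bar>deriv z t\<bar> \<le> C * z t powr ((p - 1) / p)"
    by (rule power_cutoff[OF p]) (rule that)
  \<comment> \<open>\<open>A\<close> is the bound that Picone's argument puts on
    \<open>R powr p * lam\<close>; the choice \<open>K powr p = A + 1\<close> violates it.\<close>
  define A where "A = 8 * ((p - 1) powr (1 - p) * (2 * C) powr p)"
  define K where "K = (A + 1) powr (1 / p)"
  have A: "0 \<le> A" by (simp add: A_def)
  have K: "0 < K" "A < K powr p" using A p by (auto simp: K_def powr_powr)
  \<comment> \<open>The reciprocal of a sum meets all three smallness conditions of
    \<open>no_small_nodal_projections\<close> at once.\<close>
  define \<epsilon> where "\<epsilon> = 1 / (8 + 8 * C + 8 * p * K)"
  have den: "0 < 8 + 8 * C + 8 * p * K" using p K(1) z(6) by (simp add: add_pos_pos)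
  have \<epsilon>: "0 < \<epsilon>" "\<epsilon> \<le> 1/8" "\<epsilon> * C \<le> 1/8" "\<epsilon> * (8 * p * K) \<le> 1"
    using den p K(1) z(6) by (auto simp: \<epsilon>_def divide_simps)
  show ?thesis
  proof (rule that[OF K(1) \<epsilon>(1)])
    fix \<Omega> :: "(real^2) set" and u lam c R
    assume \<Omega>: "open \<Omega>" "bounded \<Omega>" and u: "p_eigenfunction p \<Omega> lam u" "continuous_on \<Omega> u"
      and lam: "0 < lam" and R: "0 < R" and box: "cbox c (c + vec R) \<subseteq> \<Omega>"
      and scale: "K \<le> R * lam powr (1 / p)" "R * lam powr (1 / p) \<le> 2 * K"
    define Z where "Z = nodal_set \<Omega> u \<inter> cbox c (c + vec R)"
    have contQ: "continuous_on (cbox c (c + vec R)) u" by (rule continuous_on_subset[OF u(2) box])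
    have Z_eq: "Z = {x \<in> cbox c (c + vec R). u x = 0}" using box by (auto simp: Z_def nodal_set_def)
    have "closed Z"
      unfolding Z_eq by (rule continuous_closed_preimage_constant[OF contQ closed_cbox])
    moreover have "bounded Z"
      by (rule bounded_subset[OF bounded_cbox]) (auto simp: Z_eq)
    ultimately have "compact Z" by (simp add: compact_eq_bounded_closed)
    then have cE: "compact ((\<lambda>x. x $ i) ` Z)" for i
      by (intro compact_continuous_image continuous_intros)
    obtain g \<phi> where eig: "p_eig \<Omega> p u g \<phi> lam"
      by (rule p_eigenfunction_approx[OF \<Omega> p u(1)]) (rule that)
    have "\<exists>i. \<epsilon> * R \<le> measure lebesgue ((\<lambda>x. x $ i) ` Z)"
    proof (rule ccontr)
      assume "\<nexists>i. \<epsilon> * R \<le> measure lebesgue ((\<lambda>x. x $ i) ` Z)"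
      then have small: "measure lebesgue ((\<lambda>x. x $ i) ` Z) < \<epsilon> * R" for i by (simp add: not_le)
      have \<epsilon>R: "\<epsilon> * R \<le> R" using \<epsilon>(2) R by simp
      have "\<exists>t. c$i < t \<and> t < c$i + R \<and> t \<notin> (\<lambda>x. x $ i) ` Z" for i
        using ex_outside_small_set[OF cE[of i], of "c$i + R" "c$i"] small[of i] \<epsilon>R by (smt (verit))
      then obtain s where s: "\<And>i. c$i < s i" "\<And>i. s i < c$i + R" "\<And>i. s i \<notin> (\<lambda>x. x $ i) ` Z" by metis
      \<comment> \<open>Both coordinates of \<open>a\<close> avoid the projections, so
        \<open>u a\<close> is nonzero; its sign decides whether the argument is applied to
        \<open>u\<close> or to \<open>- u\<close>, which has the same zeros.\<close>
      define a where "a = (\<chi> i. s i)"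
      have a: "a \<in> cbox c (c + vec R)" "a $ i \<notin> (\<lambda>x. x $ i) ` Z" for i
        using s by (auto simp: a_def mem_box_cart intro: less_imp_le)
      then have ua: "u a \<noteq> 0" by (auto simp: Z_eq)
      note main = no_small_nodal_projections[OF _ lam R box _ cE[of 1] cE[of 2] small[of 1] small[of 2] _ z \<epsilon>(2-4)
          K(1) K(2)[unfolded A_def] scale]
      show False
      proof (cases "0 < u a")
        case True
        show False
          by (rule main[OF eig u(2)], rule nonpos_in_projections[OF contQ _ a(1) a(2) a(2) True])
             (auto simp: Z_eq)
      next
        case False
        then have pos: "0 < - u a" using ua by simp
        show False
          by (rule main[OF p_eig_uminus[OF eig] continuous_on_minus[OF u(2)]],
              rule nonpos_in_projections[OF continuous_on_minus[OF contQ] _ a(1) a(2) a(2) pos])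
             (auto simp: Z_eq)
      qed
    qed
    then show "\<exists>i. (\<lambda>x. x $ i) ` (nodal_set \<Omega> u \<inter> cbox c (c + vec R)) \<in> lmeasurable
            \<and> \<epsilon> * R \<le> measure lebesgue ((\<lambda>x. x $ i) ` (nodal_set \<Omega> u \<inter> cbox c (c + vec R)))"
      unfolding Z_def[symmetric] using lmeasurable_compact[OF cE] by blast
  qed
qed

section \<open>Hausdorff measure of separated pieces and the grid\<close>

lemma lipschitz_image_interval:
  fixes f :: "'a::metric_space \<Rightarrow> real"
  assumes "bounded U" and f: "\<And>x y. \<bar>f x - f y\<bar> \<le> dist x y"
  obtains a where "f ` U \<subseteq> {a..a + diameter U}"
proof (cases "U = {}")
  case False
  define a where "a = Inf (f ` U)"
  have le: "f x - diameter U \<le> f y" if "x \<in> U" "y \<in> U" for x y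
    using f[of x y] diameter_bounded_bound[OF assms(1) that] by linarith
  obtain x0 where "x0 \<in> U" using False by auto
  then have "bdd_below (f ` U)" using le by (intro bdd_belowI2[of U "f x0 - diameter U"]) auto
  then have "a \<le> f x" if "x \<in> U" for x unfolding a_def using that by (auto intro: cInf_lower)
  moreover have "f x - diameter U \<le> a" if "x \<in> U" for x
    unfolding a_def using that le by (intro cInf_greatest) auto
  ultimately show ?thesis by (intro that[of a]) (auto simp: diff_le_eq)
qed auto

text \<open>A covering set of diameter at most \<open>\<delta>\<close> meets at most one
  \<open>Q i\<close>, so its diameter is charged to a single piece. Within a piece the 1-Lipschitz
  map \<open>f i\<close> sends covering sets into intervals of no greater length than their
  diameters, and these cover an image of measure at least \<open>m\<close>.\<close>

lemma hausdorff1_ge_separated: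
  fixes Z :: "'a::metric_space set"
  assumes I: "finite I" and \<delta>: "0 < \<delta>"
    and sep: "\<And>i j x y. i \<in> I \<Longrightarrow> j \<in> I \<Longrightarrow> i \<noteq> j \<Longrightarrow> x \<in> Q i \<Longrightarrow> y \<in> Q j \<Longrightarrow> \<delta> < dist x y"
    and f: "\<And>i x y. i \<in> I \<Longrightarrow> \<bar>f i x - f i y\<bar> \<le> dist x y"
    and m: "\<And>i. i \<in> I \<Longrightarrow> f i ` (Z \<inter> Q i) \<in> lmeasurable" "\<And>i. i \<in> I \<Longrightarrow> m \<le> measure lebesgue (f i ` (Z \<inter> Q i))"
  shows "of_nat (card I) * ennreal m \<le> hausdorff1 Z"
proof -
  have "of_nat (card I) * ennreal m \<le> (\<Sum>k. ennreal (diameter (U k)))"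
    if U: "Z \<subseteq> (\<Union>k. U k)" "\<And>k. bounded (U k)" "\<And>k. diameter (U k) \<le> \<delta>" for U :: "nat \<Rightarrow> 'a set"
  proof -
    define t where "t i k = (if U k \<inter> Q i = {} then 0 else ennreal (diameter (U k)))" for i k
    have "ennreal m \<le> (\<Sum>k. t i k)" if i: "i \<in> I" for i
    proof -
      have "\<exists>a. f i ` U k \<subseteq> {a..a + diameter (U k)}" for k
        using lipschitz_image_interval[OF U(2) f[OF i]] by metis
      then obtain a where a: "\<And>k. f i ` U k \<subseteq> {a k..a k + diameter (U k)}" by metis
      define J where "J k = (if U k \<inter> Q i = {} then {} else {a k..a k + diameter (U k)})" for k
      have "ennreal m \<le> emeasure lebesgue (f i ` (Z \<inter> Q i))"
        using m[OF i] by (simp add: emeasure_eq_measure2 ennreal_leI)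
      also have "\<dots> \<le> emeasure lebesgue (\<Union>k. J k)"
      proof (rule emeasure_mono)
        show "f i ` (Z \<inter> Q i) \<subseteq> (\<Union>k. J k)"
        proof
          fix y assume "y \<in> f i ` (Z \<inter> Q i)"
          then obtain x where x: "x \<in> Z" "x \<in> Q i" "y = f i x" by auto
          then obtain k where "x \<in> U k" using U(1) by auto
          then have "y \<in> J k" using x a[of k] by (auto simp: J_def)
          then show "y \<in> (\<Union>k. J k)" by auto
        qed
      qed (auto simp: J_def)
      also have "\<dots> \<le> (\<Sum>k. emeasure lebesgue (J k))"
        by (rule emeasure_subadditive_countably) (auto simp: J_def)
      also have "(\<lambda>k. emeasure lebesgue (J k)) = t i"
        using diameter_ge_0[OF U(2)] by (auto simp: J_def t_def fun_eq_iff)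
      finally show ?thesis .
    qed
    then have "(\<Sum>i\<in>I. ennreal m) \<le> (\<Sum>i\<in>I. \<Sum>k. t i k)" by (rule sum_mono)
    also have "\<dots> = (\<Sum>k. \<Sum>i\<in>I. t i k)" by (rule suminf_sum[symmetric]) auto
    also have "\<dots> \<le> (\<Sum>k. ennreal (diameter (U k)))"
    proof (rule suminf_le)
      fix k
      show "(\<Sum>i\<in>I. t i k) \<le> ennreal (diameter (U k))"
      proof (cases "\<exists>i\<in>I. U k \<inter> Q i \<noteq> {}")
        case True
        then obtain i x where i: "i \<in> I" "x \<in> U k" "x \<in> Q i" by auto
        have "t j k = 0" if "j \<in> I - {i}" for j
        proof -
          have "U k \<inter> Q j = {}"
          proof (rule ccontr)
            assume "U k \<inter> Q j \<noteq> {}"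
            then obtain y where y: "y \<in> U k" "y \<in> Q j" by auto
            then have "\<delta> < dist x y" using sep[of i j x y] i that by auto
            moreover have "dist x y \<le> \<delta>"
              using diameter_bounded_bound[OF U(2) i(2) y(1)] U(3)[of k] by linarith
            ultimately show False by simp
          qed
          then show ?thesis by (simp add: t_def)
        qed
        then have "(\<Sum>i\<in>I. t i k) = t i k" using I i(1) by (simp add: sum.remove[of I i])
        then show ?thesis by (simp add: t_def)
      qed (auto simp: t_def)
    qed auto
    finally show ?thesis by simp
  qed
  then have "of_nat (card I) * ennreal m \<le> hausdorff1_pre \<delta> Z"
    unfolding hausdorff1_pre_def by (intro Inf_greatest) blast
  also have "\<dots> \<le> hausdorff1 Z"
    unfolding hausdorff1_def using \<delta> by (intro SUP_upper) auto
  finally show ?thesis .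
qed

lemma open_contains_square:
  fixes \<Omega> :: "(real^2) set"
  assumes "open \<Omega>" "\<Omega> \<noteq> {}"
  obtains c L where "0 < L" "cbox c (c + vec L) \<subseteq> \<Omega>"
proof -
  obtain c e where e: "0 < e" "ball c e \<subseteq> \<Omega>" using assms openE by blast
  have "cbox c (c + vec (e/4)) \<subseteq> ball c e"
  proof
    fix x assume "x \<in> cbox c (c + vec (e/4))"
    then have b: "c $ i \<le> x $ i \<and> x $ i \<le> c $ i + e/4" for i by (simp add: mem_box_cart)
    have *: "\<bar>(x - c) $ i\<bar> \<le> e/4" for i
      using e(1) b[of i] by (simp add: abs_le_iff)
    have "norm (x - c) \<le> \<bar>(x - c) $ 1\<bar> + \<bar>(x - c) $ 2\<bar>"
      using norm_le_l1_cart[of "x - c"] by (simp add: sum_2)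
    then have "norm (x - c) \<le> e/4 + e/4" using *[of 1] *[of 2] by linarith
    then show "x \<in> ball c e" using e(1) by (simp add: dist_norm norm_minus_commute)
  qed
  then show ?thesis using that[of "e/4" c] e by auto
qed

theorem theorem2p5:
  fixes \<Omega> :: "(real ^ 2) set" and p :: real
  assumes "open \<Omega>" and "connected \<Omega>" and "\<Omega> \<noteq> {}" and "bounded \<Omega>"
    and "1 < p"
  shows "\<exists>M > 0. \<exists>C > 0. \<forall>lam > M. p_eigenvalue p \<Omega> lam \<longrightarrow>
           (\<forall>u. p_eigenfunction p \<Omega> lam u \<and> continuous_on \<Omega> u \<longrightarrow>
              hausdorff1 (nodal_set \<Omega> u) \<ge> ennreal (C * lam powr (1 / p)))"
proof -
  obtain K \<epsilon> where K: "0 < K" and \<epsilon>: "0 < \<epsilon>"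
    and proj: "\<And>(\<Omega> :: (real^2) set) u lam c R. open \<Omega> \<Longrightarrow> bounded \<Omega> \<Longrightarrow> p_eigenfunction p \<Omega> lam u \<Longrightarrow> continuous_on \<Omega> u
      \<Longrightarrow> 0 < lam \<Longrightarrow> 0 < R \<Longrightarrow> cbox c (c + vec R) \<subseteq> \<Omega>
      \<Longrightarrow> K \<le> R * lam powr (1 / p) \<Longrightarrow> R * lam powr (1 / p) \<le> 2 * K
      \<Longrightarrow> \<exists>i. (\<lambda>x. x $ i) ` (nodal_set \<Omega> u \<inter> cbox c (c + vec R)) \<in> lmeasurable
            \<and> \<epsilon> * R \<le> measure lebesgue ((\<lambda>x. x $ i) ` (nodal_set \<Omega> u \<inter> cbox c (c + vec R)))"
    by (rule nodal_projection_constants[OF assms(5)]) (rule that)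
  obtain c L where L: "0 < L" and cL: "cbox c (c + vec L) \<subseteq> \<Omega>"
    using open_contains_square[OF assms(1,3)] by metis
  \<comment> \<open>Beyond this threshold the quantity \<open>y\<close> below exceeds 1, so that at
    least one square fits.\<close>
  define M where "M = (2 * K / L) powr p"
  \<comment> \<open>There will be \<open>n * n\<close> squares contributing
    \<open>\<epsilon> * R\<close> each. As \<open>2 * n * R = L\<close> and
    \<open>n \<ge> y / 2\<close>, the total is at least \<open>\<epsilon> * L * y / 4\<close>, which
    is this constant times \<open>lam powr (1 / p)\<close>.\<close>
  define C where "C = \<epsilon> * L\<^sup>2 / (8 * K)"
  have "ennreal (C * lam powr (1 / p)) \<le> hausdorff1 (nodal_set \<Omega> u)"
    if lam: "M < lam" and u: "p_eigenfunction p \<Omega> lam u" "continuous_on \<Omega> u" for lam u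
  proof -
    have lam0: "0 < lam" using lam K L by (simp add: M_def) (meson order_le_less_trans powr_ge_zero)
    define l where "l = lam powr (1 / p)"
    have "M powr (1 / p) < l"
      unfolding l_def using lam K L assms(5) by (intro powr_less_mono2) (auto simp: M_def)
    then have l: "2 * K / L < l" using K L assms(5) by (simp add: M_def powr_powr)
    define y where "y = L * l / (2 * K)"
    have y: "1 < y" using l K L by (simp add: y_def field_simps)
    \<comment> \<open>Rounding down keeps \<open>n \<le> y \<le> 2 * n\<close>, which places
      \<open>R * l = y * K / n\<close> between \<open>K\<close> and \<open>2 * K\<close>.\<close>
    define n where "n = nat \<lfloor>y\<rfloor>"
    have "1 \<le> \<lfloor>y\<rfloor>" using y by (simp add: le_floor_iff)
    then have "real n = real_of_int \<lfloor>y\<rfloor>" "1 \<le> real_of_int \<lfloor>y\<rfloor>" by (simp_all add: n_def)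
    then have n: "real n \<le> y" "y / 2 \<le> real n" "1 \<le> n"
      using floor_correct[of y] by linarith+
    define R where "R = L / (2 * real n)"
    have R: "0 < R" "2 * real n * R = L" using n(3) L by (auto simp: R_def)
    have "R * l = y * K / real n" using K n(3) by (simp add: R_def y_def)
    then have "R * l * real n = y * K" using n(3) by simp
    moreover have "K * real n \<le> y * K" "y * K \<le> 2 * K * real n" using n K by (auto simp: mult_ac)
    ultimately have "K * real n \<le> R * l * real n" "R * l * real n \<le> 2 * K * real n" by simp_all
    then have scale: "K \<le> R * lam powr (1 / p)" "R * lam powr (1 / p) \<le> 2 * K"
      using n(3) unfolding l_def by (simp_all only: mult_le_cancel_right)
    \<comment> \<open>Squares of side \<open>R\<close> on a grid of mesh \<open>2 * R\<close>: the
      gaps of width \<open>R\<close> keep them separated.\<close>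
    define corner where "corner k = c + vector [real (fst k) * (2 * R), real (snd k) * (2 * R)]" for k :: "nat \<times> nat"
    define Q where "Q k = cbox (corner k) (corner k + vec R)" for k
    define I where "I = {..<n} \<times> {..<n}"
    have corner: "corner k $ 1 = c$1 + real (fst k) * (2 * R)" "corner k $ 2 = c$2 + real (snd k) * (2 * R)" for k
      by (simp_all add: corner_def)
    have Q\<Omega>: "Q k \<subseteq> \<Omega>" if "k \<in> I" for k
    proof -
      have *: "real i * (2 * R) + R \<le> L" if "i < n" for i
      proof -
        have "(real i + 1) * (2 * R) \<le> real n * (2 * R)" using that R by (intro mult_right_mono) auto
        then show ?thesis using R by (simp add: algebra_simps)
      qed
      have "Q k \<subseteq> cbox c (c + vec L)"
      proof
        fix x assume "x \<in> Q k"
        then have "c$1 + real (fst k) * (2 * R) \<le> x$1" "x$1 \<le> c$1 + real (fst k) * (2 * R) + R"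
          "c$2 + real (snd k) * (2 * R) \<le> x$2" "x$2 \<le> c$2 + real (snd k) * (2 * R) + R"
          by (simp_all add: Q_def mem_box_cart forall_2 corner)
        moreover have "0 \<le> real (fst k) * (2 * R)" "0 \<le> real (snd k) * (2 * R)" using R by auto
        moreover have "fst k < n" "snd k < n" using \<open>k \<in> I\<close> by (auto simp: I_def)
        note *[OF this(1)] *[OF this(2)]
        ultimately have "c$1 \<le> x$1" "x$1 \<le> c$1 + L" "c$2 \<le> x$2" "x$2 \<le> c$2 + L" by linarith+
        then show "x \<in> cbox c (c + vec L)" by (simp add: mem_box_cart forall_2)
      qed
      then show ?thesis using cL by blast
    qed
    have "\<exists>i. (\<lambda>x. x $ i) ` (nodal_set \<Omega> u \<inter> Q k) \<in> lmeasurable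
            \<and> \<epsilon> * R \<le> measure lebesgue ((\<lambda>x. x $ i) ` (nodal_set \<Omega> u \<inter> Q k))" if "k \<in> I" for k
      using proj[OF assms(1,4) u lam0 R(1) _ scale] Q\<Omega>[OF that] unfolding Q_def by blast
    then obtain i where i: "\<And>k. k \<in> I \<Longrightarrow> (\<lambda>x. x $ i k) ` (nodal_set \<Omega> u \<inter> Q k) \<in> lmeasurable"
      "\<And>k. k \<in> I \<Longrightarrow> \<epsilon> * R \<le> measure lebesgue ((\<lambda>x. x $ i k) ` (nodal_set \<Omega> u \<inter> Q k))"
      by metis
    have grid: "R \<le> \<bar>s - t\<bar>" if "a \<noteq> b" "s \<in> {d + real a * (2 * R)..d + real a * (2 * R) + R}"
      "t \<in> {d + real b * (2 * R)..d + real b * (2 * R) + R}" for s t d and a b :: nat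
    proof -
      have *: "real a * (2 * R) + 2 * R \<le> real b * (2 * R)" if "a < b" for a b :: nat
      proof -
        have "(real a + 1) * (2 * R) \<le> real b * (2 * R)" using that R by (intro mult_right_mono) auto
        then show ?thesis by (simp add: algebra_simps)
      qed
      show ?thesis using that *[of a b] *[of b a] by (cases "a < b") auto
    qed
    have sep: "R / 2 < dist x y" if "k \<noteq> k'" "x \<in> Q k" "y \<in> Q k'" for k k' x y
    proof -
      have "R \<le> \<bar>x$1 - y$1\<bar> \<or> R \<le> \<bar>x$2 - y$2\<bar>"
      proof (cases "fst k = fst k'")
        case False
        then show ?thesis using grid[of "fst k" "fst k'" "x$1" "c$1" "y$1"] that
          by (auto simp: Q_def mem_box_cart forall_2 corner)
      next
        case True
        then have "snd k \<noteq> snd k'" using that(1) by (auto simp: prod_eq_iff)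
        then show ?thesis using grid[of "snd k" "snd k'" "x$2" "c$2" "y$2"] that
          by (auto simp: Q_def mem_box_cart forall_2 corner)
      qed
      then have "R \<le> dist x y"
        using component_le_norm_cart[of "x - y" 1] component_le_norm_cart[of "x - y" 2] by (auto simp: dist_norm)
      then show ?thesis using R by simp
    qed
    have "of_nat (card I) * ennreal (\<epsilon> * R) \<le> hausdorff1 (nodal_set \<Omega> u)"
    \<comment> \<open>Distances between different squares are at least \<open>R\<close>; half of
      that gives the strict inequality.\<close>
    proof (rule hausdorff1_ge_separated[where \<delta> = "R/2" and Q = Q and f = "\<lambda>k x. x $ i k"])
      show "\<bar>x $ i k - y $ i k\<bar> \<le> dist x y" for k and x y :: "real^2"
        using component_le_norm_cart[of "x - y" "i k"] by (simp add: dist_norm)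
    qed (use R sep i in \<open>auto simp: I_def\<close>)
    moreover have "of_nat (card I) * ennreal (\<epsilon> * R) = ennreal (real (n * n) * (\<epsilon> * R))"
      using \<epsilon> R by (simp add: I_def ennreal_mult ennreal_of_nat_eq_real_of_nat)
    moreover have "C * lam powr (1 / p) \<le> real (n * n) * (\<epsilon> * R)"
    proof -
      have "C * lam powr (1 / p) = \<epsilon> * L / 2 * (y / 2)"
        using K by (simp add: C_def l_def[symmetric] y_def power2_eq_square)
      also have "\<dots> \<le> \<epsilon> * L / 2 * real n" using n \<epsilon> L by (intro mult_left_mono) auto
      also have "\<dots> = real (n * n) * (\<epsilon> * R)" using R(2)[symmetric] by simp
      finally show ?thesis .
    qed
    ultimately show ?thesis by (metis ennreal_leI order_trans)
  qed
  moreover have "0 < M" "0 < C" using K L \<epsilon> by (auto simp: M_def C_def)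
  ultimately show ?thesis by blast
qed

end
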